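(* Let $\varphi\in\mathscr{S}(G)$. Then there exist a Hilbert space $\mathcal{M}$, a unitary operator $T$ on $\mathcal{M}$ and a unitary operator $$\begin{bmatrix} A&B\\C&D \end{bmatrix} \quad\text{on } \mathbb{C}\oplus \mathcal{M}$$ such that, for all $s\in G$, $$\varphi(s)=A+Bs_T(1-Ds_T)^{-1} C.$$ Conversely, if $\mathcal{M}$ is a Hilbert space, $T$ is a unitary operator on $\mathcal{M}$ and $\begin{bmatrix} A&B\\C&D \end{bmatrix}$ is a unitary operator on $\mathbb{C}\oplus\mathcal{M}$, then any function $\varphi$ on $G$ given by $\varphi(s)=A+Bs_T(1-Ds_T)^{-1} C$ for all $s\in G$ is an analytic function from $G$ to $\mathbb{D}^-$.
   Context: $\mathbb{D}$ is the open unit disc in $\mathbb{C}$ and $\mathbb{D}^-$ is its closure. The symmetrized bidisc is the open set $G=\{(z+w,zw): |z|<1,\ |w|<1\}\subset\mathbb{C}^2$. Superscripts denote components: $s=(s^1,s^2)$ for $s\in G$ (so $|s^1|<2$). $\mathscr{S}(G)$ is the Schur class of $G$: the set of analytic functions on $G$ with values in $\mathbb{D}^-$. Hilbert spaces are complex and operators are bounded and linear. For $s\in G$ and a contractive operator $T$ on a Hilbert space $\mathcal{M}$ (i.e. $\|T\|\le 1$), $s_T=(2s^2T-s^1)(2-s^1T)^{-1}$, an operator on $\mathcal{M}$ (scalars denote the corresponding multiples of the identity). In the block operator matrix on $\mathbb{C}\oplus\mathcal{M}$, $A:\mathbb{C}\to\mathbb{C}$ is identified with a scalar, $B:\mathcal{M}\to\mathbb{C}$,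 $C:\mathbb{C}\to\mathcal{M}$ and $D:\mathcal{M}\to\mathcal{M}$; the operator $Bs_T(1-Ds_T)^{-1}C:\mathbb{C}\to\mathbb{C}$ is likewise identified with a scalar. *)

theory Defs
  imports "HOL-Analysis.Analysis" "HOL-Algebra.Module"
begin

section \<open>The symmetrized bidisc and its Schur class\<close>

definition sym_bidisc :: "(complex \<times> complex) set" where
  "sym_bidisc = {(z + w, z * w) |z w. cmod z < 1 \<and> cmod w < 1}"

text \<open>Analyticity in two complex variables is complex Frechet differentiability at every point:
  the derivative is a complex-linear functional on the space of pairs.\<close>

definition analytic2_on :: "(complex \<times> complex \<Rightarrow> complex) \<Rightarrow> (complex \<times> complex) set \<Rightarrow> bool"
    (infixl \<open>analytic2'_on\<close> 50) where
  "f analytic2_on S \<longleftrightarrow>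
     (\<forall>s\<in>S. \<exists>a b. (f has_derivative (\<lambda>h. a * fst h + b * snd h)) (at s))"

text \<open>Membership constrains a function only on the symmetrized bidisc, which is open.\<close>

definition schur_class :: "(complex \<times> complex \<Rightarrow> complex) set" where
  "schur_class = {f. f analytic2_on sym_bidisc \<and> f ` sym_bidisc \<subseteq> closure (ball 0 1)}"


section \<open>Complex Hilbert spaces\<close>

text \<open>A Hilbert space is a module over the complex numbers with an inner product, linear in the
  first argument. The fields \<open>mult\<close> and \<open>one\<close> inherited from the record of rings play no role.
  The carrier is an arbitrary subset of the element type, so that one can quantify over Hilbert
  spaces. Only the values of functions on the carrier are meaningful.\<close>

definition complex_ring :: "complex ring" where
  "complex_ring = \<lparr>carrier = UNIV, mult = (*), one = 1, zero = 0, add = (+)\<rparr>"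

record 'a hilbert = "(complex, 'a) module" +
  ip :: "'a \<Rightarrow> 'a \<Rightarrow> complex"

definition hnorm :: "'a hilbert \<Rightarrow> 'a \<Rightarrow> real" where
  "hnorm H x = sqrt (Re (ip H x x))"

locale hilbert_space =
  module complex_ring H for H :: "'a hilbert" (structure) +
  assumes ip_add: "\<lbrakk>x \<in> carrier H; y \<in> carrier H; z \<in> carrier H\<rbrakk>
                     \<Longrightarrow> ip H (x \<oplus>\<^bsub>H\<^esub> y) z = ip H x z + ip H y z"
    and ip_smult: "\<lbrakk>x \<in> carrier H; y \<in> carrier H\<rbrakk> \<Longrightarrow> ip H (c \<odot>\<^bsub>H\<^esub> x) y = c * ip H x y"
    and ip_cnj: "\<lbrakk>x \<in> carrier H; y \<in> carrier H\<rbrakk> \<Longrightarrow> ip H y x = cnj (ip H x y)"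
    and ip_nonneg: "x \<in> carrier H \<Longrightarrow> 0 \<le> Re (ip H x x)"
    and ip_definite: "\<lbrakk>x \<in> carrier H; ip H x x = 0\<rbrakk> \<Longrightarrow> x = \<zero>\<^bsub>H\<^esub>"
    and hcomplete: "\<lbrakk>\<And>n. X n \<in> carrier H;
                    \<And>e. e > 0 \<Longrightarrow> \<exists>N. \<forall>m\<ge>N. \<forall>n\<ge>N. hnorm H (X m \<ominus>\<^bsub>H\<^esub> X n) < e\<rbrakk>
                     \<Longrightarrow> \<exists>x\<in>carrier H. (\<lambda>n::nat. hnorm H (X n \<ominus>\<^bsub>H\<^esub> x)) \<longlonglongrightarrow> 0"

definition scalar_hilbert :: "complex hilbert" where
  "scalar_hilbert = \<lparr>carrier = UNIV, mult = (*), one = 1, zero = 0, add = (+), smult = (*),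
     ip = (\<lambda>x y. x * cnj y)\<rparr>"

definition hilbert_sum :: "'a hilbert \<Rightarrow> 'b hilbert \<Rightarrow> ('a \<times> 'b) hilbert" where
  "hilbert_sum H K =
    \<lparr>carrier = carrier H \<times> carrier K,
     mult = undefined,
     one = undefined,
     zero = (\<zero>\<^bsub>H\<^esub>, \<zero>\<^bsub>K\<^esub>),
     add = (\<lambda>(x, y) (x', y'). (x \<oplus>\<^bsub>H\<^esub> x', y \<oplus>\<^bsub>K\<^esub> y')),
     smult = (\<lambda>c (x, y). (c \<odot>\<^bsub>H\<^esub> x, c \<odot>\<^bsub>K\<^esub> y)),
     ip = (\<lambda>(x, y) (x', y'). ip H x x' + ip K y y')\<rparr>"


lemma cring_complex_ring: "cring complex_ring"
proof (rule cringI)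
  show "abelian_group complex_ring"
    by (rule abelian_groupI) (auto simp: complex_ring_def intro: exI [of _ "- x" for x] add.left_inverse)
  show "comm_monoid complex_ring"
    by unfold_locales (auto simp: complex_ring_def)
qed (simp add: complex_ring_def algebra_simps)

lemma abelian_group_scalar_hilbert: "abelian_group scalar_hilbert"
  by (rule abelian_groupI) (auto simp: scalar_hilbert_def intro: add.left_inverse)

lemma scalar_hilbert_minus: "x \<ominus>\<^bsub>scalar_hilbert\<^esub> y = x - y"
proof -
  interpret abelian_group scalar_hilbert by (rule abelian_group_scalar_hilbert)
  have "\<ominus>\<^bsub>scalar_hilbert\<^esub> y = - y"
    by (rule minus_equality) (auto simp: scalar_hilbert_def)
  then show ?thesis by (simp add: a_minus_def) (simp add: scalar_hilbert_def)
qed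

lemma scalar_hilbert_hnorm: "hnorm scalar_hilbert x = cmod x"
  by (simp add: hnorm_def scalar_hilbert_def cmod_def power2_eq_square)

lemma hilbert_space_scalar: "hilbert_space scalar_hilbert"
proof (intro hilbert_space.intro hilbert_space_axioms.intro)
  show "module complex_ring scalar_hilbert"
    by (rule moduleI[OF cring_complex_ring abelian_group_scalar_hilbert])
      (auto simp: complex_ring_def scalar_hilbert_def algebra_simps)
next
  fix s :: "nat \<Rightarrow> complex"
  assume "\<And>e. e > 0 \<Longrightarrow> \<exists>N. \<forall>m\<ge>N. \<forall>n\<ge>N. hnorm scalar_hilbert (s m \<ominus>\<^bsub>scalar_hilbert\<^esub> s n) < e"
  then have "Cauchy s"
    by (auto simp: Cauchy_def dist_norm scalar_hilbert_minus scalar_hilbert_hnorm)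
  then obtain x where "s \<longlonglongrightarrow> x"
    using Cauchy_convergent convergent_def by blast
  then have "(\<lambda>n. cmod (s n - x)) \<longlonglongrightarrow> 0"
    using LIM_zero tendsto_norm_zero by blast
  then show "\<exists>x\<in>carrier scalar_hilbert.
      (\<lambda>n. hnorm scalar_hilbert (s n \<ominus>\<^bsub>scalar_hilbert\<^esub> x)) \<longlonglongrightarrow> 0"
    by (auto simp: scalar_hilbert_minus scalar_hilbert_hnorm) (auto simp: scalar_hilbert_def)
qed (auto simp: scalar_hilbert_def algebra_simps)

lemma hilbert_space_sum:
  assumes "hilbert_space H" "hilbert_space K"
  shows "hilbert_space (hilbert_sum H K)"
proof -
  interpret H: hilbert_space H by fact
  interpret K: hilbert_space K by fact
  let ?S = "hilbert_sum H K"
  note S = hilbert_sum_def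
  have ab: "abelian_group ?S"
  proof (rule abelian_groupI)
    fix p assume "p \<in> carrier ?S"
    then have "(\<ominus>\<^bsub>H\<^esub> fst p, \<ominus>\<^bsub>K\<^esub> snd p) \<in> carrier ?S \<and> (\<ominus>\<^bsub>H\<^esub> fst p, \<ominus>\<^bsub>K\<^esub> snd p) \<oplus>\<^bsub>?S\<^esub> p = \<zero>\<^bsub>?S\<^esub>"
      by (auto simp: S H.l_neg K.l_neg)
    then show "\<exists>q\<in>carrier ?S. q \<oplus>\<^bsub>?S\<^esub> p = \<zero>\<^bsub>?S\<^esub>" by blast
  qed (auto simp: S H.a_ac K.a_ac)
  then interpret S: abelian_group ?S .
  have neg: "\<ominus>\<^bsub>?S\<^esub> p = (\<ominus>\<^bsub>H\<^esub> fst p, \<ominus>\<^bsub>K\<^esub> snd p)" if "p \<in> carrier ?S" for p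
    by (rule S.minus_equality) (use that in \<open>auto simp: S H.l_neg K.l_neg\<close>)
  have minus: "p \<ominus>\<^bsub>?S\<^esub> q = (fst p \<ominus>\<^bsub>H\<^esub> fst q, snd p \<ominus>\<^bsub>K\<^esub> snd q)"
    if "p \<in> carrier ?S" "q \<in> carrier ?S" for p q
    using that by (simp add: a_minus_def neg) (auto simp: S)
  have norm: "hnorm ?S p = sqrt ((hnorm H (fst p))\<^sup>2 + (hnorm K (snd p))\<^sup>2)"
    if "p \<in> carrier ?S" for p
    using that by (auto simp: hnorm_def S H.ip_nonneg K.ip_nonneg)
  have le1: "hnorm H (fst p) \<le> hnorm ?S p" and le2: "hnorm K (snd p) \<le> hnorm ?S p"
    if "p \<in> carrier ?S" for p
    by (auto simp: norm[OF that] intro: real_le_rsqrt)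
  have im: "Im (ip H x x) = 0" if "x \<in> carrier H" for x
    using H.ip_cnj[OF that that] by (metis cnj.simps(2) equal_neg_zero)
  have imK: "Im (ip K x x) = 0" if "x \<in> carrier K" for x
    using K.ip_cnj[OF that that] by (metis cnj.simps(2) equal_neg_zero)
  show ?thesis
  proof (intro hilbert_space.intro hilbert_space_axioms.intro)
    show "module complex_ring ?S"
    proof (rule moduleI[OF cring_complex_ring ab])
      have U: "c \<in> carrier complex_ring" for c by (simp add: complex_ring_def)
      show "c \<odot>\<^bsub>?S\<^esub> p \<in> carrier ?S" if "p \<in> carrier ?S" for c p
        using that U by (auto simp: S)
      show "(c \<oplus>\<^bsub>complex_ring\<^esub> d) \<odot>\<^bsub>?S\<^esub> p = c \<odot>\<^bsub>?S\<^esub> p \<oplus>\<^bsub>?S\<^esub> d \<odot>\<^bsub>?S\<^esub> p"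
        if "p \<in> carrier ?S" for c d p
        using that U by (auto simp: S H.smult_l_distr K.smult_l_distr)
      show "c \<odot>\<^bsub>?S\<^esub> (p \<oplus>\<^bsub>?S\<^esub> q) = c \<odot>\<^bsub>?S\<^esub> p \<oplus>\<^bsub>?S\<^esub> c \<odot>\<^bsub>?S\<^esub> q"
        if "p \<in> carrier ?S" "q \<in> carrier ?S" for c p q
        using that U by (auto simp: S H.smult_r_distr K.smult_r_distr)
      show "(c \<otimes>\<^bsub>complex_ring\<^esub> d) \<odot>\<^bsub>?S\<^esub> p = c \<odot>\<^bsub>?S\<^esub> (d \<odot>\<^bsub>?S\<^esub> p)"
        if "p \<in> carrier ?S" for c d p
        using that U by (auto simp: S H.smult_assoc1 K.smult_assoc1)
      show "\<one>\<^bsub>complex_ring\<^esub> \<odot>\<^bsub>?S\<^esub> p = p" if "p \<in> carrier ?S" for p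
        using that by (auto simp: S)
    qed
  next
    fix p assume p: "p \<in> carrier ?S" and 0: "ip ?S p p = 0"
    obtain x y where xy: "p = (x, y)" "x \<in> carrier H" "y \<in> carrier K"
      using p by (auto simp: S)
    have "ip H x x + ip K y y = 0" using 0 by (simp add: S xy)
    then have "Re (ip H x x) + Re (ip K y y) = 0" by (metis plus_complex.sel(1) zero_complex.sel(1))
    then have "Re (ip H x x) = 0" "Re (ip K y y) = 0"
      using H.ip_nonneg[OF xy(2)] K.ip_nonneg[OF xy(3)] by linarith+
    then have "ip H x x = 0" "ip K y y = 0"
      using im[OF xy(2)] imK[OF xy(3)] by (auto simp: complex_eq_iff)
    then show "p = \<zero>\<^bsub>?S\<^esub>"
      using xy H.ip_definite K.ip_definite by (simp add: S)
  next
    fix s :: "nat \<Rightarrow> 'a \<times> 'b"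
    assume s: "\<And>n. s n \<in> carrier ?S"
      and C: "\<And>e. e > 0 \<Longrightarrow> \<exists>N. \<forall>m\<ge>N. \<forall>n\<ge>N. hnorm ?S (s m \<ominus>\<^bsub>?S\<^esub> s n) < e"
    have s1: "fst (s n) \<in> carrier H" and s2: "snd (s n) \<in> carrier K" for n
      using s[of n] by (auto simp: S)
    have d1: "hnorm H (fst (s m) \<ominus>\<^bsub>H\<^esub> fst (s n)) \<le> hnorm ?S (s m \<ominus>\<^bsub>?S\<^esub> s n)"
      and d2: "hnorm K (snd (s m) \<ominus>\<^bsub>K\<^esub> snd (s n)) \<le> hnorm ?S (s m \<ominus>\<^bsub>?S\<^esub> s n)" for m n
      using le1[OF S.minus_closed[OF s s], of m n] le2[OF S.minus_closed[OF s s], of m n]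
      by (simp_all add: minus s)
    have "\<exists>x\<in>carrier H. (\<lambda>n. hnorm H (fst (s n) \<ominus>\<^bsub>H\<^esub> x)) \<longlonglongrightarrow> 0"
      by (rule H.hcomplete[OF s1]) (meson C d1 le_less_trans)
    then obtain x where x: "x \<in> carrier H" "(\<lambda>n. hnorm H (fst (s n) \<ominus>\<^bsub>H\<^esub> x)) \<longlonglongrightarrow> 0" by blast
    have "\<exists>y\<in>carrier K. (\<lambda>n. hnorm K (snd (s n) \<ominus>\<^bsub>K\<^esub> y)) \<longlonglongrightarrow> 0"
      by (rule K.hcomplete[OF s2]) (meson C d2 le_less_trans)
    then obtain y where y: "y \<in> carrier K" "(\<lambda>n. hnorm K (snd (s n) \<ominus>\<^bsub>K\<^esub> y)) \<longlonglongrightarrow> 0" by blast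
    have xy: "(x, y) \<in> carrier ?S" using x y by (simp add: S)
    have "(\<lambda>n. sqrt ((hnorm H (fst (s n) \<ominus>\<^bsub>H\<^esub> x))\<^sup>2 + (hnorm K (snd (s n) \<ominus>\<^bsub>K\<^esub> y))\<^sup>2)) \<longlonglongrightarrow> sqrt (0\<^sup>2 + 0\<^sup>2)"
      by (intro tendsto_intros x y)
    moreover have "hnorm ?S (s n \<ominus>\<^bsub>?S\<^esub> (x, y)) =
        sqrt ((hnorm H (fst (s n) \<ominus>\<^bsub>H\<^esub> x))\<^sup>2 + (hnorm K (snd (s n) \<ominus>\<^bsub>K\<^esub> y))\<^sup>2)" for n
      using norm[OF S.minus_closed[OF s xy], of n] by (simp add: minus s xy)
    ultimately have "(\<lambda>n. hnorm ?S (s n \<ominus>\<^bsub>?S\<^esub> (x, y))) \<longlonglongrightarrow> 0" by simp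
    with xy show "\<exists>p\<in>carrier ?S. (\<lambda>n. hnorm ?S (s n \<ominus>\<^bsub>?S\<^esub> p)) \<longlonglongrightarrow> 0" by blast
  next
    fix p q assume "p \<in> carrier ?S" "q \<in> carrier ?S"
    then show "ip ?S q p = cnj (ip ?S p q)"
      using H.ip_cnj[of "fst p" "fst q"] K.ip_cnj[of "snd p" "snd q"]
      by (cases p; cases q) (simp add: S)
  qed (auto simp: S H.ip_add K.ip_add H.ip_smult K.ip_smult H.ip_nonneg K.ip_nonneg algebra_simps)
qed


section \<open>Operators\<close>

definition bounded_op :: "'a hilbert \<Rightarrow> 'b hilbert \<Rightarrow> ('a \<Rightarrow> 'b) \<Rightarrow> bool" where
  "bounded_op H K X \<longleftrightarrow>
     X \<in> carrier H \<rightarrow> carrier K \<and>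
     (\<forall>x\<in>carrier H. \<forall>y\<in>carrier H. X (x \<oplus>\<^bsub>H\<^esub> y) = X x \<oplus>\<^bsub>K\<^esub> X y) \<and>
     (\<forall>c. \<forall>x\<in>carrier H. X (c \<odot>\<^bsub>H\<^esub> x) = c \<odot>\<^bsub>K\<^esub> X x) \<and>
     (\<exists>b. \<forall>x\<in>carrier H. hnorm K (X x) \<le> b * hnorm H x)"

definition inverse_ops :: "'a hilbert \<Rightarrow> ('a \<Rightarrow> 'a) \<Rightarrow> ('a \<Rightarrow> 'a) \<Rightarrow> bool" where
  "inverse_ops H X Y \<longleftrightarrow> (\<forall>x\<in>carrier H. Y (X x) = x \<and> X (Y x) = x)"

definition adjoint_ops :: "'a hilbert \<Rightarrow> ('a \<Rightarrow> 'a) \<Rightarrow> ('a \<Rightarrow> 'a) \<Rightarrow> bool" where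
  "adjoint_ops H X Y \<longleftrightarrow> (\<forall>x\<in>carrier H. \<forall>y\<in>carrier H. ip H (X x) y = ip H x (Y y))"

definition unitary_op :: "'a hilbert \<Rightarrow> ('a \<Rightarrow> 'a) \<Rightarrow> bool" where
  "unitary_op H U \<longleftrightarrow>
     bounded_op H H U \<and> (\<exists>V. bounded_op H H V \<and> adjoint_ops H U V \<and> inverse_ops H U V)"

definition invertible_op :: "'a hilbert \<Rightarrow> ('a \<Rightarrow> 'a) \<Rightarrow> bool" where
  "invertible_op H X \<longleftrightarrow> bounded_op H H X \<and> (\<exists>Y. bounded_op H H Y \<and> inverse_ops H X Y)"

text \<open>This is the inverse operator when \<open>X\<close> is invertible, and has no meaning otherwise.\<close>

definition op_inv :: "'a hilbert \<Rightarrow> ('a \<Rightarrow> 'a) \<Rightarrow> 'a \<Rightarrow> 'a" where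
  "op_inv H X = inv_into (carrier H) X"

definition block_op ::
  "'a hilbert \<Rightarrow> complex \<Rightarrow> ('a \<Rightarrow> complex) \<Rightarrow> (complex \<Rightarrow> 'a) \<Rightarrow> ('a \<Rightarrow> 'a)
     \<Rightarrow> complex \<times> 'a \<Rightarrow> complex \<times> 'a" where
  "block_op M A B C D = (\<lambda>(z, x). (A * z + B x, C z \<oplus>\<^bsub>M\<^esub> D x))"

definition unitary_block ::
  "'a hilbert \<Rightarrow> complex \<Rightarrow> ('a \<Rightarrow> complex) \<Rightarrow> (complex \<Rightarrow> 'a) \<Rightarrow> ('a \<Rightarrow> 'a) \<Rightarrow> bool" where
  "unitary_block M A B C D \<longleftrightarrow>
     bounded_op M scalar_hilbert B \<and> bounded_op scalar_hilbert M C \<and> bounded_op M M D \<and>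
     unitary_op (hilbert_sum scalar_hilbert M) (block_op M A B C D)"


section \<open>The realization formula\<close>

definition denom_op :: "'a hilbert \<Rightarrow> complex \<times> complex \<Rightarrow> ('a \<Rightarrow> 'a) \<Rightarrow> 'a \<Rightarrow> 'a" where
  "denom_op M s T = (\<lambda>x. (2 \<odot>\<^bsub>M\<^esub> x) \<ominus>\<^bsub>M\<^esub> (fst s \<odot>\<^bsub>M\<^esub> T x))"

text \<open>The operator \<open>s\<^sub>T = (2 s\<^sup>2 T - s\<^sup>1) (2 - s\<^sup>1 T)\<^sup>-\<^sup>1\<close>, where \<open>s = (s\<^sup>1, s\<^sup>2)\<close>.\<close>

definition op_sub :: "'a hilbert \<Rightarrow> complex \<times> complex \<Rightarrow> ('a \<Rightarrow> 'a) \<Rightarrow> 'a \<Rightarrow> 'a" where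
  "op_sub M s T =
     (\<lambda>x. ((2 * snd s) \<odot>\<^bsub>M\<^esub> T x) \<ominus>\<^bsub>M\<^esub> (fst s \<odot>\<^bsub>M\<^esub> x)) \<circ> op_inv M (denom_op M s T)"

definition resolvent_op ::
  "'a hilbert \<Rightarrow> ('a \<Rightarrow> 'a) \<Rightarrow> ('a \<Rightarrow> 'a) \<Rightarrow> complex \<times> complex \<Rightarrow> 'a \<Rightarrow> 'a" where
  "resolvent_op M T D s = (\<lambda>x. x \<ominus>\<^bsub>M\<^esub> D (op_sub M s T x))"

text \<open>Both operators inverted in the formula \<open>A + B s\<^sub>T (1 - D s\<^sub>T)\<^sup>-\<^sup>1 C\<close> are invertible.\<close>

definition realization_defined ::
  "'a hilbert \<Rightarrow> ('a \<Rightarrow> 'a) \<Rightarrow> ('a \<Rightarrow> 'a) \<Rightarrow> complex \<times> complex \<Rightarrow> bool" where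
  "realization_defined M T D s \<longleftrightarrow>
     invertible_op M (denom_op M s T) \<and> invertible_op M (resolvent_op M T D s)"

text \<open>An operator on the scalars is identified with its value at 1.\<close>

definition realization ::
  "'a hilbert \<Rightarrow> ('a \<Rightarrow> 'a) \<Rightarrow> complex \<Rightarrow> ('a \<Rightarrow> complex) \<Rightarrow> (complex \<Rightarrow> 'a) \<Rightarrow> ('a \<Rightarrow> 'a)
     \<Rightarrow> complex \<times> complex \<Rightarrow> complex" where
  "realization M T A B C D s =
     A + (B \<circ> op_sub M s T \<circ> op_inv M (resolvent_op M T D s) \<circ> C) 1"

end

theory Submission
  imports Defs "HOL-Complex_Analysis.Cauchy_Integral_Formula"
begin

text \<open>
A realization is governed by the affine operator pencil \<open>2 - s\<^sup>1 T - D (2 s\<^sup>2 T - s\<^sup>1)\<close>. For unitary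
\<open>T\<close> one computes \<open>\<parallel>(2 - s\<^sup>1 T) x\<parallel>\<^sup>2 - \<parallel>(2 s\<^sup>2 T - s\<^sup>1) x\<parallel>\<^sup>2 \<ge> 4 (1 - |s\<^sup>2|\<^sup>2 - |s\<^sup>1 - s\<^sup>2 cnj s\<^sup>1|) \<parallel>x\<parallel>\<^sup>2\<close>,
and the coefficient is positive exactly on the symmetrized bidisc. So \<open>s\<^sub>T\<close> is a strict contraction,
which gives invertibility, boundedness by 1 and analyticity.

For the other direction lift \<open>\<phi>\<close> to \<open>f (z, w) = \<phi> (z + w, z w)\<close> on the bidisc. An Agler
decomposition \<open>1 - f f\<^sup>* = (1 - z z\<^sup>*) A + (1 - w w\<^sup>*) B\<close> with positive kernels comes from the
multiplication operator \<open>E\<close> by \<open>f\<close> on \<open>L\<^sup>2 \<otimes> H\<^sup>2\<close>: the shorted form of \<open>1 - E E\<^sup>*\<close> on \<open>H\<^sup>2 \<otimes> H\<^sup>2\<close>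
decreases under the first backward shift, and its difference to the form of \<open>1 - f f\<^sup>*\<close> decreases
under the second one. Symmetrize the decomposition, let \<open>u\<close> be a Gram vector of its first kernel and
\<open>v\<close> the flip of \<open>u\<close>. Then \<open>z u - w v \<mapsto> u - v\<close> is isometric. If \<open>T\<close> is a unitary extension, then
\<open>u = (1 - w T) x\<close> and \<open>v = (1 - z T) x\<close>, and the decomposition turns into
\<open>1 - \<phi> \<phi>\<^sup>* = \<langle>y, y\<rangle> - \<langle>s\<^sub>T y, s\<^sub>T y\<rangle>\<close> with \<open>y = (2 - s\<^sup>1 T) x / 2\<close>. A unitary extension of the
isometry \<open>(1, s\<^sub>T y) \<mapsto> (\<phi>, y)\<close> is the colligation. Working at countably many dense points keeps the
Hilbert space separable, and continuity yields the formula everywhere.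
\<close>

section \<open>Hilbert spaces and bounded operators\<close>

text \<open>Taking the first variable in \<open>L2\<close> instead of \<open>H2\<close> makes its
  shift unitary and commuting with the adjoint of \<open>E\<close>. The defect form on the large
  space is therefore invariant, and monotonicity has to be proved only for what shorting removes. An
  isometry between subspaces need not extend to a unitary on the same space, because the orthogonal
  complements may differ in dimension. Doubling the space removes this obstruction. It is done once
  for \<open>T\<close> and once for the colligation, which is why the state space is a nested sum;
  the sum is finally copied into sequences along an injection, since the theorem fixes the type of
  its elements. The direction from realizations to Schur functions also serves the other one: it
  makes the constructed realization continuous, so that agreement on a dense set suffices.\<close>

context hilbert_space
begin

lemma smult_in [simp, intro]: "x \<in> carrier H \<Longrightarrow> c \<odot> x \<in> carrier H"
  by (rule smult_closed) (simp_all add: complex_ring_def)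

lemma ip_add_right: "\<lbrakk>x \<in> carrier H; y \<in> carrier H; z \<in> carrier H\<rbrakk> \<Longrightarrow> ip H z (x \<oplus> y) = ip H z x + ip H z y"
  by (metis ip_add ip_cnj complex_cnj_add add.m_closed)

lemma ip_smult_right: "\<lbrakk>x \<in> carrier H; y \<in> carrier H\<rbrakk> \<Longrightarrow> ip H x (c \<odot> y) = cnj c * ip H x y"
  by (metis ip_smult ip_cnj complex_cnj_mult smult_in)

lemma ip_zero_left [simp]: "x \<in> carrier H \<Longrightarrow> ip H \<zero> x = 0"
  using ip_add[of \<zero> \<zero> x] by simp

lemma ip_zero_right [simp]: "x \<in> carrier H \<Longrightarrow> ip H x \<zero> = 0"
  using ip_add_right[of \<zero> \<zero> x] by simp

lemma ip_uminus: "\<lbrakk>x \<in> carrier H; y \<in> carrier H\<rbrakk> \<Longrightarrow> ip H (\<ominus> x) y = - ip H x y"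
  using ip_add[of "\<ominus> x" x y] by (simp add: l_neg add_eq_0_iff2)

lemma ip_uminus_right: "\<lbrakk>x \<in> carrier H; y \<in> carrier H\<rbrakk> \<Longrightarrow> ip H y (\<ominus> x) = - ip H y x"
  using ip_add_right[of "\<ominus> x" x y] by (simp add: l_neg add_eq_0_iff2)

lemma ip_diff: "\<lbrakk>x \<in> carrier H; y \<in> carrier H; z \<in> carrier H\<rbrakk> \<Longrightarrow> ip H (x \<ominus> y) z = ip H x z - ip H y z"
  by (simp add: a_minus_def ip_add ip_uminus)

lemma ip_diff_right: "\<lbrakk>x \<in> carrier H; y \<in> carrier H; z \<in> carrier H\<rbrakk> \<Longrightarrow> ip H z (x \<ominus> y) = ip H z x - ip H z y"
  by (simp add: a_minus_def ip_add_right ip_uminus_right)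

lemmas ip_simps = ip_add ip_add_right ip_smult ip_smult_right ip_uminus ip_uminus_right ip_diff ip_diff_right

lemma Im_ip_self: "x \<in> carrier H \<Longrightarrow> Im (ip H x x) = 0"
  by (metis ip_cnj cnj.simps(2) equal_neg_zero)

lemma hnorm_sq: "x \<in> carrier H \<Longrightarrow> (hnorm H x)\<^sup>2 = Re (ip H x x)"
  by (simp add: hnorm_def ip_nonneg)

lemma ip_self: "x \<in> carrier H \<Longrightarrow> ip H x x = complex_of_real ((hnorm H x)\<^sup>2)"
  by (simp add: complex_eq_iff hnorm_sq Im_ip_self)

lemma hnorm_nonneg [simp]: "x \<in> carrier H \<Longrightarrow> 0 \<le> hnorm H x"
  by (simp add: hnorm_def ip_nonneg)

lemma hnorm_eq_0:
  assumes "x \<in> carrier H"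
  shows "hnorm H x = 0 \<longleftrightarrow> x = \<zero>"
proof
  assume "hnorm H x = 0"
  then show "x = \<zero>" using ip_self[of x] assms by (intro ip_definite) simp_all
qed (simp add: hnorm_def)

lemma hnorm_le_0D: "\<lbrakk>x \<in> carrier H; hnorm H x \<le> 0\<rbrakk> \<Longrightarrow> x = \<zero>"
  using hnorm_eq_0 hnorm_nonneg order_antisym by blast

lemma hnorm_zero [simp]: "hnorm H \<zero> = 0"
  by (simp add: hnorm_def)

lemma minus_eq_zeroD: "\<lbrakk>x \<in> carrier H; y \<in> carrier H; x \<ominus> y = \<zero>\<rbrakk> \<Longrightarrow> x = y"
  using minus_equality[of x "\<ominus> y"] by (simp add: a_minus_def)

lemma minus_self: "x \<in> carrier H \<Longrightarrow> x \<ominus> x = \<zero>"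
  by (simp add: a_minus_def r_neg)

text \<open>Testing against all \<open>z\<close> and rewriting with \<open>ip_simps\<close> turns a
  vector identity into a scalar one that \<open>algebra_simps\<close> settles; most linear algebra
  below goes through this rule.\<close>

lemma ip_eqI:
  assumes "x \<in> carrier H" "y \<in> carrier H" "\<And>z. z \<in> carrier H \<Longrightarrow> ip H x z = ip H y z"
  shows "x = y"
proof -
  have "ip H (x \<ominus> y) (x \<ominus> y) = 0"
    using assms by (simp add: ip_diff)
  then have "x \<ominus> y = \<zero>"
    using assms by (intro ip_definite) auto
  then show ?thesis using assms minus_eq_zeroD by blast
qed

lemma Re_ip_commute: "\<lbrakk>x \<in> carrier H; y \<in> carrier H\<rbrakk> \<Longrightarrow> Re (ip H x y) = Re (ip H y x)"
  by (metis ip_cnj cnj.simps(1))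

lemma hnorm_add_sq:
  assumes "x \<in> carrier H" "y \<in> carrier H"
  shows "(hnorm H (x \<oplus> y))\<^sup>2 = (hnorm H x)\<^sup>2 + (hnorm H y)\<^sup>2 + 2 * Re (ip H x y)"
  using assms by (simp add: hnorm_sq ip_simps Re_ip_commute[of y x])

lemma hnorm_diff_sq:
  assumes "x \<in> carrier H" "y \<in> carrier H"
  shows "(hnorm H (x \<ominus> y))\<^sup>2 = (hnorm H x)\<^sup>2 + (hnorm H y)\<^sup>2 - 2 * Re (ip H x y)"
  using assms by (simp add: hnorm_sq ip_simps Re_ip_commute[of y x])

lemma hnorm_smult:
  assumes "x \<in> carrier H"
  shows "hnorm H (c \<odot> x) = cmod c * hnorm H x"
proof (rule power2_eq_imp_eq)
  have "ip H (c \<odot> x) (c \<odot> x) = (c * cnj c) * ip H x x"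
    using assms by (simp add: ip_simps)
  also have "\<dots> = complex_of_real ((cmod c)\<^sup>2 * (hnorm H x)\<^sup>2)"
    using assms by (simp add: ip_self complex_norm_square flip: of_real_power)
  finally show "(hnorm H (c \<odot> x))\<^sup>2 = (cmod c * hnorm H x)\<^sup>2"
    using assms by (simp add: hnorm_sq power_mult_distrib)
qed (use assms in auto)

lemma Cauchy_Schwarz:
  assumes x: "x \<in> carrier H" and y: "y \<in> carrier H"
  shows "cmod (ip H x y) \<le> hnorm H x * hnorm H y"
proof (cases "y = \<zero>")
  case False
  define n where "n = (hnorm H y)\<^sup>2"
  have n: "n > 0" using False y hnorm_eq_0 by (simp add: n_def)
  \<comment> \<open>\<open>c \<odot> y\<close> is the orthogonal projection of \<open>x\<close> onto
    the line of \<open>y\<close>; nonnegativity of the squared norm of the rest is the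
    inequality.\<close>
  define c where "c = ip H x y / of_real n"
  have "0 \<le> Re (ip H (x \<ominus> c \<odot> y) (x \<ominus> c \<odot> y))"
    using x y by (intro ip_nonneg) auto
  also have "ip H (x \<ominus> c \<odot> y) (x \<ominus> c \<odot> y)
      = ip H x x - c * cnj (ip H x y) - cnj c * ip H x y + c * cnj c * of_real n"
    using x y by (simp add: ip_simps algebra_simps ip_cnj[of x y] n_def ip_self[OF y])
  also have "\<dots> = of_real ((hnorm H x)\<^sup>2) - of_real ((cmod (ip H x y))\<^sup>2 / n)"
    using n by (simp add: c_def ip_self[OF x] field_simps) (simp add: complex_norm_square flip: of_real_power)
  finally have "(cmod (ip H x y))\<^sup>2 / n \<le> (hnorm H x)\<^sup>2" by simp
  then have "(cmod (ip H x y))\<^sup>2 \<le> (hnorm H x * hnorm H y)\<^sup>2"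
    using n by (simp add: field_simps n_def)
  then show ?thesis
    using x y by (rule_tac power2_le_imp_le) auto
qed (use x in simp)

lemma hnorm_triangle:
  assumes x: "x \<in> carrier H" and y: "y \<in> carrier H"
  shows "hnorm H (x \<oplus> y) \<le> hnorm H x + hnorm H y"
proof (rule power2_le_imp_le)
  have "Re (ip H x y) \<le> hnorm H x * hnorm H y"
    using Cauchy_Schwarz[OF x y] complex_Re_le_cmod order_trans by blast
  then show "(hnorm H (x \<oplus> y))\<^sup>2 \<le> (hnorm H x + hnorm H y)\<^sup>2"
    using x y by (simp add: hnorm_add_sq power2_sum)
qed (use x y in auto)

lemma hnorm_uminus: "x \<in> carrier H \<Longrightarrow> hnorm H (\<ominus> x) = hnorm H x"
  by (simp add: hnorm_def ip_simps)

lemma hnorm_triangle_diff: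
  assumes "x \<in> carrier H" "y \<in> carrier H"
  shows "hnorm H (x \<ominus> y) \<le> hnorm H x + hnorm H y"
  using hnorm_triangle[of x "\<ominus> y"] assms by (simp add: a_minus_def hnorm_uminus)

lemma hnorm_triangle_ineq2:
  assumes "x \<in> carrier H" "y \<in> carrier H"
  shows "hnorm H x - hnorm H y \<le> hnorm H (x \<ominus> y)"
proof -
  have "x = (x \<ominus> y) \<oplus> y"
    using assms by (intro ip_eqI) (auto simp: ip_simps)
  then show ?thesis using hnorm_triangle[of "x \<ominus> y" y] assms by (metis diff_le_eq minus_closed)
qed

end

section \<open>Algebra of bounded operators\<close>

lemma bounded_opD:
  assumes "bounded_op H K X"
  shows "x \<in> carrier H \<Longrightarrow> X x \<in> carrier K"
    "\<lbrakk>x \<in> carrier H; y \<in> carrier H\<rbrakk> \<Longrightarrow> X (x \<oplus>\<^bsub>H\<^esub> y) = X x \<oplus>\<^bsub>K\<^esub> X y"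
    "x \<in> carrier H \<Longrightarrow> X (c \<odot>\<^bsub>H\<^esub> x) = c \<odot>\<^bsub>K\<^esub> X x"
  using assms by (auto simp: bounded_op_def)

lemma bounded_opI:
  assumes "\<And>x. x \<in> carrier H \<Longrightarrow> X x \<in> carrier K"
    "\<And>x y. \<lbrakk>x \<in> carrier H; y \<in> carrier H\<rbrakk> \<Longrightarrow> X (x \<oplus>\<^bsub>H\<^esub> y) = X x \<oplus>\<^bsub>K\<^esub> X y"
    "\<And>c x. x \<in> carrier H \<Longrightarrow> X (c \<odot>\<^bsub>H\<^esub> x) = c \<odot>\<^bsub>K\<^esub> X x"
    "\<And>x. x \<in> carrier H \<Longrightarrow> hnorm K (X x) \<le> b * hnorm H x"
  shows "bounded_op H K X"
  using assms unfolding bounded_op_def by blast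

lemma bounded_op_bound:
  assumes "hilbert_space H" "bounded_op H K X"
  obtains b where "b > 0" "\<And>x. x \<in> carrier H \<Longrightarrow> hnorm K (X x) \<le> b * hnorm H x"
proof -
  interpret hilbert_space H by fact
  obtain b where b: "\<And>x. x \<in> carrier H \<Longrightarrow> hnorm K (X x) \<le> b * hnorm H x"
    using assms unfolding bounded_op_def by blast
  have "hnorm K (X x) \<le> max b 1 * hnorm H x" if "x \<in> carrier H" for x
    using b[OF that] mult_right_mono[of b "max b 1" "hnorm H x"] hnorm_nonneg[OF that] by linarith
  then show ?thesis by (intro that[of "max b 1"]) auto
qed

lemma bounded_op_diff:
  assumes "hilbert_space H" "hilbert_space K" "bounded_op H K X" "x \<in> carrier H" "y \<in> carrier H"
  shows "X (x \<ominus>\<^bsub>H\<^esub> y) = X x \<ominus>\<^bsub>K\<^esub> X y"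
proof -
  interpret H: hilbert_space H by fact
  interpret K: hilbert_space K by fact
  note X = bounded_opD[OF assms(3)]
  have "X x = X ((x \<ominus>\<^bsub>H\<^esub> y) \<oplus>\<^bsub>H\<^esub> y)"
    using assms by (intro arg_cong[of _ _ X] H.ip_eqI) (auto simp: H.ip_simps)
  also have "\<dots> = X (x \<ominus>\<^bsub>H\<^esub> y) \<oplus>\<^bsub>K\<^esub> X y"
    using assms by (intro X) auto
  finally show ?thesis
    using assms by (intro K.ip_eqI) (auto simp: K.ip_simps X)
qed

lemma bounded_op_comp:
  assumes "hilbert_space H" "hilbert_space K" "hilbert_space L" "bounded_op H K X" "bounded_op K L Y"
  shows "bounded_op H L (Y \<circ> X)"
proof -
  obtain b where b: "b > 0" "\<And>x. x \<in> carrier H \<Longrightarrow> hnorm K (X x) \<le> b * hnorm H x"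
    using bounded_op_bound[OF assms(1,4)] by blast
  obtain c where c: "c > 0" "\<And>x. x \<in> carrier K \<Longrightarrow> hnorm L (Y x) \<le> c * hnorm K x"
    using bounded_op_bound[OF assms(2,5)] by blast
  note X = bounded_opD[OF assms(4)] and Y = bounded_opD[OF assms(5)]
  show ?thesis
  proof (rule bounded_opI)
    show "hnorm L ((Y \<circ> X) x) \<le> (c * b) * hnorm H x" if "x \<in> carrier H" for x
      using c(2)[OF X(1)[OF that]] b(2)[OF that] c(1)
      by (simp add: mult.assoc) (meson less_imp_le mult_left_mono order_trans)
  qed (auto simp: X Y)
qed

lemma bounded_op_lincomb:
  assumes "hilbert_space H" "hilbert_space K" "bounded_op H K X" "bounded_op H K Y"
  shows "bounded_op H K (\<lambda>x. (a \<odot>\<^bsub>K\<^esub> X x) \<ominus>\<^bsub>K\<^esub> (b \<odot>\<^bsub>K\<^esub> Y x))"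
proof -
  interpret H: hilbert_space H by fact
  interpret K: hilbert_space K by fact
  obtain m where m: "m > 0" "\<And>x. x \<in> carrier H \<Longrightarrow> hnorm K (X x) \<le> m * hnorm H x"
    using bounded_op_bound[OF assms(1,3)] by blast
  obtain n where n: "n > 0" "\<And>x. x \<in> carrier H \<Longrightarrow> hnorm K (Y x) \<le> n * hnorm H x"
    using bounded_op_bound[OF assms(1,4)] by blast
  note X = bounded_opD[OF assms(3)] and Y = bounded_opD[OF assms(4)]
  show ?thesis
  proof (rule bounded_opI)
    fix x assume x: "x \<in> carrier H"
    have "hnorm K ((a \<odot>\<^bsub>K\<^esub> X x) \<ominus>\<^bsub>K\<^esub> (b \<odot>\<^bsub>K\<^esub> Y x)) \<le> cmod a * hnorm K (X x) + cmod b * hnorm K (Y x)"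
      using K.hnorm_triangle_diff[of "a \<odot>\<^bsub>K\<^esub> X x" "b \<odot>\<^bsub>K\<^esub> Y x"] x X Y by (simp add: K.hnorm_smult)
    also have "\<dots> \<le> cmod a * (m * hnorm H x) + cmod b * (n * hnorm H x)"
      using m(2)[OF x] n(2)[OF x] by (intro add_mono mult_left_mono) auto
    finally show "hnorm K ((a \<odot>\<^bsub>K\<^esub> X x) \<ominus>\<^bsub>K\<^esub> (b \<odot>\<^bsub>K\<^esub> Y x)) \<le> (cmod a * m + cmod b * n) * hnorm H x"
      by (simp add: algebra_simps)
  next
    fix x y assume "x \<in> carrier H" "y \<in> carrier H"
    then show "(a \<odot>\<^bsub>K\<^esub> X (x \<oplus>\<^bsub>H\<^esub> y)) \<ominus>\<^bsub>K\<^esub> (b \<odot>\<^bsub>K\<^esub> Y (x \<oplus>\<^bsub>H\<^esub> y)) =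
      ((a \<odot>\<^bsub>K\<^esub> X x) \<ominus>\<^bsub>K\<^esub> (b \<odot>\<^bsub>K\<^esub> Y x)) \<oplus>\<^bsub>K\<^esub> ((a \<odot>\<^bsub>K\<^esub> X y) \<ominus>\<^bsub>K\<^esub> (b \<odot>\<^bsub>K\<^esub> Y y))"
      by (intro K.ip_eqI) (auto simp: X Y K.ip_simps algebra_simps)
  next
    fix c x assume "x \<in> carrier H"
    then show "(a \<odot>\<^bsub>K\<^esub> X (c \<odot>\<^bsub>H\<^esub> x)) \<ominus>\<^bsub>K\<^esub> (b \<odot>\<^bsub>K\<^esub> Y (c \<odot>\<^bsub>H\<^esub> x)) =
      c \<odot>\<^bsub>K\<^esub> ((a \<odot>\<^bsub>K\<^esub> X x) \<ominus>\<^bsub>K\<^esub> (b \<odot>\<^bsub>K\<^esub> Y x))"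
      by (intro K.ip_eqI) (auto simp: X Y K.ip_simps algebra_simps)
  qed (use X Y in auto)
qed

lemma bounded_op_id: "bounded_op H H (\<lambda>x. x)"
  by (rule bounded_opI[where b = 1]) auto

section \<open>Inverses of operators bounded below and of perturbations of the identity\<close>

context hilbert_space
begin

lemma bounded_below_inj:
  assumes "bounded_op H H X" "m > 0" "\<And>x. x \<in> carrier H \<Longrightarrow> m * hnorm H x \<le> hnorm H (X x)"
    "x \<in> carrier H" "y \<in> carrier H" "X x = X y"
  shows "x = y"
proof -
  have "X (x \<ominus> y) = \<zero>"
    using assms bounded_op_diff[OF hilbert_space_axioms hilbert_space_axioms assms(1)]
    by (simp add: bounded_opD[OF assms(1)] minus_self)
  then have "m * hnorm H (x \<ominus> y) \<le> 0"
    using assms(3)[of "x \<ominus> y"] assms by simp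
  then have "hnorm H (x \<ominus> y) = 0"
    using assms(2) hnorm_nonneg[of "x \<ominus> y"] assms(4,5)
    by (metis mult_le_0_iff minus_closed order_antisym not_less)
  then show ?thesis using assms(4,5) hnorm_eq_0[of "x \<ominus> y"] minus_eq_zeroD[of x y] by simp
qed

text \<open>The lower bound gives injectivity and the bound \<open>1 / m\<close> for the inverse, so
  surjectivity is all that has to be found for a concrete operator. It also gives
  \<open>op_inv\<close> its meaning: \<open>inv_into\<close> inverts \<open>X\<close> once
  \<open>X\<close> is a bijection of the carrier.\<close>

lemma bounded_below_surj_invertible:
  assumes X: "bounded_op H H X" and m: "m > 0" "\<And>x. x \<in> carrier H \<Longrightarrow> m * hnorm H x \<le> hnorm H (X x)"
    and surj: "\<And>y. y \<in> carrier H \<Longrightarrow> \<exists>x\<in>carrier H. X x = y"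
  shows "bounded_op H H (op_inv H X)" "inverse_ops H X (op_inv H X)" "invertible_op H X"
proof -
  note Xd = bounded_opD[OF X]
  have inj: "inj_on X (carrier H)"
    using bounded_below_inj[OF X m] by (auto simp: inj_on_def)
  have im: "X ` carrier H = carrier H"
    using surj Xd(1) by (force simp: image_iff)
  have in_: "op_inv H X y \<in> carrier H" "X (op_inv H X y) = y" if "y \<in> carrier H" for y
    using that im unfolding op_inv_def by (auto simp: inv_into_into f_inv_into_f)
  have l: "op_inv H X (X x) = x" if "x \<in> carrier H" for x
    using that inj by (simp add: op_inv_def)
  show inv: "inverse_ops H X (op_inv H X)"
    by (simp add: inverse_ops_def in_ l)
  show b: "bounded_op H H (op_inv H X)"
  proof (rule bounded_opI[where b = "1 / m"])
    fix x y assume xy: "x \<in> carrier H" "y \<in> carrier H"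
    have "X (op_inv H X x \<oplus> op_inv H X y) = x \<oplus> y"
      using xy in_ by (simp add: Xd)
    then show "op_inv H X (x \<oplus> y) = op_inv H X x \<oplus> op_inv H X y"
      using xy in_ l by (metis add.m_closed)
  next
    fix c x assume x: "x \<in> carrier H"
    have "X (c \<odot> op_inv H X x) = c \<odot> x"
      using x in_ by (simp add: Xd)
    then show "op_inv H X (c \<odot> x) = c \<odot> op_inv H X x"
      using x in_ l by (metis smult_in)
  next
    fix x assume x: "x \<in> carrier H"
    show "hnorm H (op_inv H X x) \<le> 1 / m * hnorm H x"
      using m(2)[OF in_(1)[OF x]] in_(2)[OF x] m(1) by (simp add: field_simps)
  qed (use in_ in auto)
  show "invertible_op H X"
    unfolding invertible_op_def using X b inv by blast
qed

lemma invertible_op_inv: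
  assumes "invertible_op H X" "x \<in> carrier H"
  shows "op_inv H X x \<in> carrier H" "X (op_inv H X x) = x" "op_inv H X (X x) = x"
proof -
  obtain Y where Y: "bounded_op H H X" "bounded_op H H Y" "inverse_ops H X Y"
    using assms(1) by (auto simp: invertible_op_def)
  have inj: "inj_on X (carrier H)"
    by (rule inj_on_inverseI[where g = Y]) (use Y in \<open>auto simp: inverse_ops_def\<close>)
  have im: "x \<in> X ` carrier H"
    by (rule image_eqI[where x = "Y x"]) (use Y assms(2) bounded_opD(1)[OF Y(2)] in \<open>auto simp: inverse_ops_def\<close>)
  show "op_inv H X x \<in> carrier H" "X (op_inv H X x) = x" "op_inv H X (X x) = x"
    using inj im assms(2) unfolding op_inv_def by (auto simp: inv_into_into f_inv_into_f)
qed

text \<open>The Neumann series, written as the fixed-point iteration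
  \<open>s (Suc n) = y \<oplus> X (s n)\<close> started at zero.\<close>

lemma contraction_solve:
  assumes X: "bounded_op H H X" and r: "0 \<le> r" "r < 1"
    and Xr: "\<And>x. x \<in> carrier H \<Longrightarrow> hnorm H (X x) \<le> r * hnorm H x" and y: "y \<in> carrier H"
  shows "\<exists>x\<in>carrier H. x \<ominus> X x = y"
proof -
  note Xd = bounded_opD[OF X]
  note Xm = bounded_op_diff[OF hilbert_space_axioms hilbert_space_axioms X]
  \<comment> \<open>The fixed point of \<open>t \<mapsto> hnorm H y + r * t\<close>: the iteration
    never leaves the ball of radius \<open>K\<close>, and each application of \<open>X\<close>
    shrinks differences by \<open>r\<close>.\<close>
  define K where "K = hnorm H y / (1 - r)"
  have K: "K \<ge> 0" "hnorm H y + r * K = K" using r y by (auto simp: K_def field_simps)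
  define s where "s = rec_nat \<zero> (\<lambda>_ x. y \<oplus> X x)"
  have s0: "s 0 = \<zero>" and sS: "s (Suc n) = y \<oplus> X (s n)" for n by (auto simp: s_def)
  have s: "s n \<in> carrier H" for n by (induction n) (auto simp: s0 sS y Xd)
  have sK: "hnorm H (s n) \<le> K" for n
  proof (induction n)
    case (Suc n)
    have "hnorm H (s (Suc n)) \<le> hnorm H y + hnorm H (X (s n))"
      unfolding sS using y s Xd by (intro hnorm_triangle) auto
    also have "\<dots> \<le> hnorm H y + r * K"
      using Xr[OF s[of n]] mult_left_mono[OF Suc r(1)] by linarith
    finally show ?case using K by simp
  qed (use K in \<open>simp add: s0\<close>)
  have d: "hnorm H (s (n + k) \<ominus> s n) \<le> r ^ n * K" for n k
  proof (induction n)
    case 0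
    have "s k \<ominus> \<zero> = s k" using s by (intro ip_eqI) (auto simp: ip_simps)
    then show ?case using sK by (simp add: s0)
  next
    case (Suc n)
    have "s (Suc n + k) \<ominus> s (Suc n) = X (s (n + k) \<ominus> s n)"
      using s Xd y by (intro ip_eqI) (auto simp: ip_simps sS Xm)
    then show ?case
      using Xr[of "s (n + k) \<ominus> s n"] mult_left_mono[OF Suc r(1)] s by (simp add: mult.assoc)
  qed
  have "\<exists>x\<in>carrier H. (\<lambda>n. hnorm H (s n \<ominus> x)) \<longlonglongrightarrow> 0"
  proof (rule hcomplete[OF s])
    fix e :: real assume e: "e > 0"
    have "(\<lambda>n. r ^ n * K) \<longlonglongrightarrow> 0 * K"
      using r by (intro tendsto_intros LIMSEQ_power_zero) auto
    then have "eventually (\<lambda>n. r ^ n * K < e) sequentially"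
      using e by (intro order_tendstoD) auto
    then obtain N where N: "\<And>n. n \<ge> N \<Longrightarrow> r ^ n * K < e" by (auto simp: eventually_sequentially)
    have sym: "hnorm H (s m \<ominus> s n) = hnorm H (s n \<ominus> s m)" for m n
      using s by (intro power2_eq_imp_eq[of _ "hnorm H (s n \<ominus> s m)"])
        (auto simp: hnorm_diff_sq Re_ip_commute[of "s m"])
    have "hnorm H (s m \<ominus> s n) < e" if "m \<ge> N" "n \<ge> N" for m n
    proof (cases "n \<le> m")
      case True
      then show ?thesis using d[of n "m - n"] N[OF that(2)] by simp
    next
      case False
      then show ?thesis using d[of m "n - m"] N[OF that(1)] sym by simp
    qed
    then show "\<exists>N. \<forall>m\<ge>N. \<forall>n\<ge>N. hnorm H (s m \<ominus> s n) < e" by blast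
  qed
  then obtain x where x: "x \<in> carrier H" and lim: "(\<lambda>n. hnorm H (s n \<ominus> x)) \<longlonglongrightarrow> 0" by blast
  have "hnorm H (x \<ominus> X x \<ominus> y) \<le> hnorm H (s (Suc n) \<ominus> x) + r * hnorm H (s n \<ominus> x)" for n
  proof -
    have "x \<ominus> X x \<ominus> y = X (s n \<ominus> x) \<ominus> (s (Suc n) \<ominus> x)"
      using s x y Xd by (intro ip_eqI) (auto simp: ip_simps sS Xm)
    then have "hnorm H (x \<ominus> X x \<ominus> y) \<le> hnorm H (X (s n \<ominus> x)) + hnorm H (s (Suc n) \<ominus> x)"
      using s x Xd by (metis hnorm_triangle_diff minus_closed)
    then show ?thesis using Xr[of "s n \<ominus> x"] s x by simp
  qed
  moreover have "(\<lambda>n. hnorm H (s (Suc n) \<ominus> x) + r * hnorm H (s n \<ominus> x)) \<longlonglongrightarrow> 0 + r * 0"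
    using lim by (intro tendsto_intros LIMSEQ_Suc)
  ultimately have "hnorm H (x \<ominus> X x \<ominus> y) \<le> 0"
    by (intro LIMSEQ_le_const[where a = "hnorm H (x \<ominus> X x \<ominus> y)"]) auto
  then have "x \<ominus> X x \<ominus> y = \<zero>"
    using x y Xd(1) by (intro hnorm_le_0D) auto
  then have "x \<ominus> X x = y" using minus_eq_zeroD[OF minus_closed[OF x Xd(1)[OF x]] y] by blast
  then show ?thesis using x by blast
qed

lemma one_minus_contraction:
  assumes X: "bounded_op H H X" and r: "0 \<le> r" "r < 1"
    and Xr: "\<And>x. x \<in> carrier H \<Longrightarrow> hnorm H (X x) \<le> r * hnorm H x"
  shows "invertible_op H (\<lambda>x. x \<ominus> X x)"
    and "\<And>x. x \<in> carrier H \<Longrightarrow> (1 - r) * hnorm H x \<le> hnorm H (x \<ominus> X x)"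
proof -
  note Xd = bounded_opD[OF X]
  show b: "(1 - r) * hnorm H x \<le> hnorm H (x \<ominus> X x)" if "x \<in> carrier H" for x
    using hnorm_triangle_ineq2[of x "X x"] Xr[OF that] that Xd by (simp add: algebra_simps)
  \<comment> \<open>The unit coefficients bring \<open>1 - X\<close> into the shape of
    \<open>bounded_op_lincomb\<close>.\<close>
  have B: "bounded_op H H (\<lambda>x. (1 \<odot> x) \<ominus> (1 \<odot> X x))"
    using bounded_op_lincomb[OF hilbert_space_axioms hilbert_space_axioms bounded_op_id X] .
  have eq: "(1 \<odot> x) = x" if "x \<in> carrier H" for x
    using that by (intro ip_eqI) (auto simp: ip_simps)
  have B': "bounded_op H H (\<lambda>x. x \<ominus> X x)"
    using B unfolding bounded_op_def by (auto simp: eq Xd Pi_iff)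
  show "invertible_op H (\<lambda>x. x \<ominus> X x)"
    by (rule bounded_below_surj_invertible(3)[OF B' _ b contraction_solve[OF X r Xr]]) (use r in auto)
qed

end

section \<open>Realizations are Schur functions\<close>

lemma unitary_op_bounded: "unitary_op H U \<Longrightarrow> bounded_op H H U"
  by (simp add: unitary_op_def)

lemma unitary_op_ip:
  assumes "unitary_op H U" "x \<in> carrier H" "y \<in> carrier H"
  shows "ip H (U x) (U y) = ip H x y"
proof -
  obtain V where V: "bounded_op H H V" "adjoint_ops H U V" "inverse_ops H U V"
    using assms by (auto simp: unitary_op_def)
  have "U y \<in> carrier H" using bounded_opD(1)[OF unitary_op_bounded[OF assms(1)] assms(3)] .
  then show ?thesis using V assms by (simp add: adjoint_ops_def inverse_ops_def)
qed

lemma unitary_op_hnorm: "\<lbrakk>unitary_op H U; x \<in> carrier H\<rbrakk> \<Longrightarrow> hnorm H (U x) = hnorm H x"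
  by (simp add: hnorm_def unitary_op_ip)

section \<open>An inequality that describes the symmetrized bidisc\<close>

lemma sym_bidisc_gap:
  assumes "s \<in> sym_bidisc"
  shows "cmod (fst s) < 2" "0 < 1 - (cmod (snd s))\<^sup>2 - cmod (fst s - snd s * cnj (fst s))"
proof -
  obtain z w where s: "s = (z + w, z * w)" and zw: "cmod z < 1" "cmod w < 1"
    using assms by (auto simp: sym_bidisc_def)
  show "cmod (fst s) < 2" using norm_triangle_ineq[of z w] zw by (simp add: s)
  define a b where "a = cmod z" and "b = cmod w"
  have ab: "0 \<le> a" "a < 1" "0 \<le> b" "b < 1" using zw by (auto simp: a_def b_def)
  \<comment> \<open>Grouped by \<open>z\<close> and \<open>w\<close>, both coefficients are real and
    positive. The triangle inequality then leaves only the moduli \<open>a\<close> and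
    \<open>b\<close>, and the gap factors as \<open>(1 - a b) (1 - a) (1 - b)\<close>.\<close>
  have "fst s - snd s * cnj (fst s) = z * of_real (1 - b\<^sup>2) + w * of_real (1 - a\<^sup>2)"
    unfolding s a_def b_def by (simp add: complex_norm_square algebra_simps del: of_real_power)
  then have "cmod (fst s - snd s * cnj (fst s)) \<le> cmod (z * of_real (1 - b\<^sup>2)) + cmod (w * of_real (1 - a\<^sup>2))"
    using norm_triangle_ineq by metis
  also have "\<dots> = a * (1 - b\<^sup>2) + b * (1 - a\<^sup>2)"
    using ab by (simp only: norm_mult norm_of_real) (simp add: a_def b_def abs_square_le_1 power_le_one)
  finally have "1 - (cmod (snd s))\<^sup>2 - cmod (fst s - snd s * cnj (fst s))
      \<ge> 1 - (a * b)\<^sup>2 - (a * (1 - b\<^sup>2) + b * (1 - a\<^sup>2))"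
    by (simp add: s a_def b_def norm_mult)
  moreover have "1 - (a * b)\<^sup>2 - (a * (1 - b\<^sup>2) + b * (1 - a\<^sup>2)) = (1 - a * b) * (1 - a) * (1 - b)"
    by (simp add: power2_eq_square algebra_simps)
  moreover have "a * b < 1" using ab mult_strict_mono[of a 1 b 1] by (cases "b = 0") auto
  then have "(1 - a * b) * (1 - a) * (1 - b) > 0" using ab by simp
  ultimately show "0 < 1 - (cmod (snd s))\<^sup>2 - cmod (fst s - snd s * cnj (fst s))" by linarith
qed

text \<open>This is for openness: an existential definition becomes one strict inequality between
  continuous functions. For the converse \<open>z\<close> and \<open>w\<close> are the roots of
  \<open>t^2 - s1 t + s2\<close>, with moduli \<open>a\<close> and \<open>b\<close>. If
  \<open>a \<ge> 1\<close>, the reverse triangle inequality bounds the left side below by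
  \<open>1 + (1 - a b) (a - 1) (1 - b)\<close>, which is at least 1.\<close>

lemma sym_bidisc_iff: "s \<in> sym_bidisc \<longleftrightarrow> (cmod (snd s))\<^sup>2 + cmod (fst s - snd s * cnj (fst s)) < 1"
proof
  assume *: "(cmod (snd s))\<^sup>2 + cmod (fst s - snd s * cnj (fst s)) < 1"
  define z where "z = (fst s + csqrt ((fst s)\<^sup>2 - 4 * snd s)) / 2"
  define w where "w = fst s - z"
  have "z * w = ((fst s)\<^sup>2 - (csqrt ((fst s)\<^sup>2 - 4 * snd s))\<^sup>2) / 4"
    by (simp add: z_def w_def power2_eq_square field_simps del: power2_csqrt)
  then have s: "s = (z + w, z * w)" by (simp add: w_def prod_eq_iff)
  have lt1: "cmod z < 1" if "(cmod (z * w))\<^sup>2 + cmod (z + w - z * w * cnj (z + w)) < 1" for z w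
  proof (rule ccontr)
    assume "\<not> cmod z < 1"
    define a b where "a = cmod z" and "b = cmod w"
    have a: "a \<ge> 1" "b \<ge> 0" using \<open>\<not> cmod z < 1\<close> by (auto simp: a_def b_def)
    have "(cmod (z * w))\<^sup>2 < 1\<^sup>2"
      using that norm_ge_zero[of "z + w - z * w * cnj (z + w)"] unfolding one_power2 by linarith
    then have "(a * b)\<^sup>2 < 1\<^sup>2" by (simp add: a_def b_def norm_mult)
    then have ab: "a * b < 1" by (rule power2_less_imp_less) simp
    have b: "b \<le> 1" using ab a mult_right_mono[of 1 a b] by simp
    have "z + w - z * w * cnj (z + w) = z * of_real (1 - b\<^sup>2) - w * of_real (a\<^sup>2 - 1)"
      unfolding a_def b_def by (simp add: complex_norm_square algebra_simps del: of_real_power)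
    then have "cmod (z + w - z * w * cnj (z + w)) \<ge> cmod (z * of_real (1 - b\<^sup>2)) - cmod (w * of_real (a\<^sup>2 - 1))"
      using norm_triangle_ineq2 by metis
    also have "cmod (z * of_real (1 - b\<^sup>2)) - cmod (w * of_real (a\<^sup>2 - 1)) = a * (1 - b\<^sup>2) - b * (a\<^sup>2 - 1)"
      using a b by (simp only: norm_mult norm_of_real) (simp add: a_def b_def abs_square_le_1 power_le_one)
    finally have "(a * b)\<^sup>2 + (a * (1 - b\<^sup>2) - b * (a\<^sup>2 - 1)) < 1"
      using that by (simp add: a_def b_def norm_mult)
    moreover have "(a * b)\<^sup>2 + (a * (1 - b\<^sup>2) - b * (a\<^sup>2 - 1)) = 1 + (1 - a * b) * (a - 1) * (1 - b)"
      by (simp add: power2_eq_square algebra_simps)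
    moreover have "(1 - a * b) * (a - 1) * (1 - b) \<ge> 0" using a b ab by simp
    ultimately show False by linarith
  qed
  have "cmod z < 1" "cmod w < 1"
    using lt1[of z w] lt1[of w z] * by (simp_all add: s mult.commute add.commute)
  then show "s \<in> sym_bidisc" unfolding sym_bidisc_def s by blast
qed (use sym_bidisc_gap(2)[of s] in linarith)

lemma open_sym_bidisc: "open sym_bidisc"
proof -
  have "sym_bidisc = {s. (cmod (snd s))\<^sup>2 + cmod (fst s - snd s * cnj (fst s)) < 1}"
    using sym_bidisc_iff by blast
  moreover have "open {s :: complex \<times> complex. (cmod (snd s))\<^sup>2 + cmod (fst s - snd s * cnj (fst s)) < 1}"
    by (intro open_Collect_less continuous_intros)
  ultimately show ?thesis by simp
qed

section \<open>The operators of a realization with unitary data\<close>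

locale unitary_realization = hilbert_space M for M :: "'a hilbert" (structure) +
  fixes T A B C D
  assumes unitary_T: "unitary_op M T"
    and unitary_ABCD: "unitary_block M A B C D"
begin

lemma T_bounded: "bounded_op M M T" and B_bounded: "bounded_op M scalar_hilbert B"
  and C_bounded: "bounded_op scalar_hilbert M C" and D_bounded: "bounded_op M M D"
  using unitary_T unitary_ABCD by (auto simp: unitary_op_def unitary_block_def)

lemmas T_simps = bounded_opD[OF T_bounded]
lemmas D_simps = bounded_opD[OF D_bounded]

lemma B_simps:
  "\<lbrakk>x \<in> carrier M; y \<in> carrier M\<rbrakk> \<Longrightarrow> B (x \<oplus> y) = B x + B y"
  "x \<in> carrier M \<Longrightarrow> B (c \<odot> x) = c * B x"
  using bounded_opD[OF B_bounded] by (auto simp: scalar_hilbert_def)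

lemma C_in [simp]: "C c \<in> carrier M"
  using bounded_opD(1)[OF C_bounded] by (simp add: scalar_hilbert_def)

lemma T_diff: "\<lbrakk>x \<in> carrier M; y \<in> carrier M\<rbrakk> \<Longrightarrow> T (x \<ominus> y) = T x \<ominus> T y"
  and D_diff: "\<lbrakk>x \<in> carrier M; y \<in> carrier M\<rbrakk> \<Longrightarrow> D (x \<ominus> y) = D x \<ominus> D y"
  by (auto intro: bounded_op_diff[OF hilbert_space_axioms hilbert_space_axioms] T_bounded D_bounded)

lemma B_diff: "\<lbrakk>x \<in> carrier M; y \<in> carrier M\<rbrakk> \<Longrightarrow> B (x \<ominus> y) = B x - B y"
  using bounded_op_diff[OF hilbert_space_axioms hilbert_space_scalar B_bounded]
  by (simp add: scalar_hilbert_minus)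

lemma C_zero: "C 0 = \<zero>"
proof -
  have "C (0 * 0) = 0 \<odot> C 0" using bounded_opD(3)[OF C_bounded, of 0 0] by (simp add: scalar_hilbert_def)
  then have "hnorm M (C 0) = 0" by (metis C_in hnorm_smult mult_eq_0_iff norm_zero mult_zero_left)
  then show ?thesis by (simp add: hnorm_eq_0)
qed

lemma colligation_isometry:
  assumes x: "x \<in> carrier M"
  shows "(cmod (A * z + B x))\<^sup>2 + (hnorm M (C z \<oplus> D x))\<^sup>2 = (cmod z)\<^sup>2 + (hnorm M x)\<^sup>2"
proof -
  let ?S = "hilbert_sum scalar_hilbert M"
  have n: "(hnorm ?S (c, y))\<^sup>2 = (cmod c)\<^sup>2 + (hnorm M y)\<^sup>2" if "y \<in> carrier M" for c y
  proof -
    have "Re (c * cnj c) = (cmod c)\<^sup>2" by (metis Re_complex_of_real complex_norm_square)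
    then show ?thesis using that by (simp add: hnorm_def hilbert_sum_def scalar_hilbert_def ip_nonneg)
  qed
  have "unitary_op ?S (block_op M A B C D)" using unitary_ABCD by (simp add: unitary_block_def)
  then have "hnorm ?S (block_op M A B C D (z, x)) = hnorm ?S (z, x)"
    using x by (intro unitary_op_hnorm) (auto simp: hilbert_sum_def scalar_hilbert_def)
  then have "(hnorm ?S (block_op M A B C D (z, x)))\<^sup>2 = (hnorm ?S (z, x))\<^sup>2" by simp
  then show ?thesis using x by (simp add: block_op_def n D_simps)
qed

lemma D_contraction:
  assumes "x \<in> carrier M"
  shows "hnorm M (D x) \<le> hnorm M x"
proof (rule power2_le_imp_le)
  have "(cmod (B x))\<^sup>2 + (hnorm M (D x))\<^sup>2 = (hnorm M x)\<^sup>2"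
    using colligation_isometry[OF assms, of 0] assms by (simp add: C_zero D_simps(1))
  then show "(hnorm M (D x))\<^sup>2 \<le> (hnorm M x)\<^sup>2"
    by (metis le_add_same_cancel2 zero_le_power2)
qed (use assms in simp)

definition numer :: "complex \<times> complex \<Rightarrow> 'a \<Rightarrow> 'a" where
  "numer s x = ((2 * snd s) \<odot> T x) \<ominus> (fst s \<odot> x)"

text \<open>Clears both inverses of the formula at once: by \<open>realization_eq\<close>, a
  solution \<open>x\<close> of \<open>pencil s x = C 1\<close> gives the value
  \<open>A + B (numer s x)\<close>.\<close>

definition pencil :: "complex \<times> complex \<Rightarrow> 'a \<Rightarrow> 'a" where
  "pencil s x = denom_op M s T x \<ominus> D (numer s x)"

lemma numer_in [simp]: "x \<in> carrier M \<Longrightarrow> numer s x \<in> carrier M"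
  and denom_in [simp]: "x \<in> carrier M \<Longrightarrow> denom_op M s T x \<in> carrier M"
  by (auto simp: numer_def denom_op_def T_simps)

lemma numer_bounded: "bounded_op M M (numer s)" and denom_bounded: "bounded_op M M (denom_op M s T)"
  unfolding numer_def denom_op_def
  by (auto intro!: bounded_op_lincomb bounded_op_id T_bounded hilbert_space_axioms)

text \<open>Since \<open>T\<close> is isometric, the terms \<open>|s1|^2 |x|^2\<close> cancel. The
  cross terms combine to \<open>- 4 Re ((s1 - s2 cnj s1) (T x, x))\<close>, which Cauchy-Schwarz
  controls.\<close>

lemma denom_minus_numer_sq:
  assumes x: "x \<in> carrier M"
  shows "(hnorm M (denom_op M s T x))\<^sup>2 - (hnorm M (numer s x))\<^sup>2
    \<ge> 4 * (1 - (cmod (snd s))\<^sup>2 - cmod (fst s - snd s * cnj (fst s))) * (hnorm M x)\<^sup>2"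
proof -
  let ?n = "(hnorm M x)\<^sup>2" and ?t = "ip M (T x) x"
  have Tx: "T x \<in> carrier M" "hnorm M (T x) = hnorm M x"
    using x T_simps unitary_op_hnorm[OF unitary_T] by auto
  have "Re (cnj (fst s) * ip M x (T x)) = Re (fst s * ?t)"
    by (metis Tx(1) x ip_cnj complex_cnj_cnj complex_cnj_mult cnj.simps(1))
  then have d: "(hnorm M (denom_op M s T x))\<^sup>2 = 4 * ?n + (cmod (fst s))\<^sup>2 * ?n - 4 * Re (fst s * ?t)"
    using x Tx by (simp add: denom_op_def hnorm_diff_sq hnorm_smult power_mult_distrib ip_smult ip_smult_right)
  have "Re (cnj (fst s) * ((2 * snd s) * ?t)) = 2 * Re (snd s * cnj (fst s) * ?t)"
    by (simp add: algebra_simps)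
  then have n: "(hnorm M (numer s x))\<^sup>2 = 4 * (cmod (snd s))\<^sup>2 * ?n + (cmod (fst s))\<^sup>2 * ?n
      - 4 * Re (snd s * cnj (fst s) * ?t)"
    using x Tx by (simp add: numer_def hnorm_diff_sq hnorm_smult norm_mult power_mult_distrib ip_smult
        ip_smult_right del: times_complex.sel)
  have "cmod ?t \<le> ?n" using Cauchy_Schwarz[OF Tx(1) x] Tx by (simp add: power2_eq_square)
  then have "Re ((fst s - snd s * cnj (fst s)) * ?t) \<le> cmod (fst s - snd s * cnj (fst s)) * ?n"
    using complex_Re_le_cmod[of "(fst s - snd s * cnj (fst s)) * ?t"]
      mult_left_mono[of "cmod ?t" ?n "cmod (fst s - snd s * cnj (fst s))"]
    by (simp add: norm_mult del: times_complex.sel)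
  then show ?thesis
    unfolding d n by (simp add: algebra_simps)
qed

lemma numer_contraction:
  assumes "s \<in> sym_bidisc"
  obtains r where "0 \<le> r" "r < 1" "\<And>x. x \<in> carrier M \<Longrightarrow> hnorm M (numer s x) \<le> r * hnorm M (denom_op M s T x)"
proof -
  define e where "e = 1 - (cmod (snd s))\<^sup>2 - cmod (fst s - snd s * cnj (fst s))"
  have e: "e > 0" using sym_bidisc_gap[OF assms] by (simp add: e_def)
  have e1: "e \<le> 1"
    unfolding e_def using zero_le_power2[of "cmod (snd s)"] norm_ge_zero[of "fst s - snd s * cnj (fst s)"]
    by linarith
  \<comment> \<open>The denominator has norm at most 4, so the gap \<open>4 e |x|^2\<close> is at
    least \<open>e / 4\<close> times the squared norm of \<open>denom_op M s T x\<close>.\<close>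
  have "hnorm M (numer s x) \<le> sqrt (1 - e / 4) * hnorm M (denom_op M s T x)" if x: "x \<in> carrier M" for x
  proof (rule power2_le_imp_le)
    have "hnorm M (denom_op M s T x) \<le> 2 * hnorm M x + cmod (fst s) * hnorm M x"
      unfolding denom_op_def using x T_simps hnorm_triangle_diff[of "2 \<odot> x" "fst s \<odot> T x"]
      by (simp add: hnorm_smult unitary_op_hnorm[OF unitary_T])
    also have "\<dots> \<le> 4 * hnorm M x"
      using sym_bidisc_gap(1)[OF assms] mult_right_mono[of "cmod (fst s)" 2 "hnorm M x"] x by simp
    finally have "(hnorm M (denom_op M s T x))\<^sup>2 \<le> (4 * hnorm M x)\<^sup>2"
      using x by (intro power_mono) auto
    then have "e / 4 * (hnorm M (denom_op M s T x))\<^sup>2 \<le> e / 4 * (16 * (hnorm M x)\<^sup>2)"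
      using e by (intro mult_left_mono) (auto simp: power_mult_distrib)
    then have "(hnorm M (numer s x))\<^sup>2 \<le> (1 - e / 4) * (hnorm M (denom_op M s T x))\<^sup>2"
      using denom_minus_numer_sq[OF x, of s] by (fold e_def) (simp add: algebra_simps)
    then show "(hnorm M (numer s x))\<^sup>2 \<le> (sqrt (1 - e / 4) * hnorm M (denom_op M s T x))\<^sup>2"
      using e1 by (simp add: power_mult_distrib)
  qed (use x e1 in auto)
  then show ?thesis using e e1 by (intro that[of "sqrt (1 - e / 4)"]) auto
qed

lemma denom_bounded_below:
  assumes "x \<in> carrier M"
  shows "(2 - cmod (fst s)) * hnorm M x \<le> hnorm M (denom_op M s T x)"
  unfolding denom_op_def using assms T_simps hnorm_triangle_ineq2[of "2 \<odot> x" "fst s \<odot> T x"]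
  by (simp add: hnorm_smult unitary_op_hnorm[OF unitary_T] algebra_simps)

lemma smult_one_eq: "x \<in> carrier M \<Longrightarrow> 1 \<odot> x = x"
  by (intro ip_eqI) (simp_all add: ip_simps)

lemma denom_surj:
  assumes s: "s \<in> sym_bidisc" and y: "y \<in> carrier M"
  shows "\<exists>x\<in>carrier M. denom_op M s T x = y"
proof -
  \<comment> \<open>\<open>2 - s1 T = 2 (1 - X)\<close> with \<open>X = (s1 / 2) T\<close>, a strict
    contraction because \<open>|s1| < 2\<close>; the summand \<open>0 \<odot> x\<close> fits
    \<open>X\<close> to \<open>bounded_op_lincomb\<close>.\<close>
  define X where "X = (\<lambda>x. ((fst s / 2) \<odot> T x) \<ominus> (0 \<odot> x))"
  have X: "bounded_op M M X"
    unfolding X_def by (intro bounded_op_lincomb bounded_op_id T_bounded hilbert_space_axioms)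
  have Xx: "X x = (fst s / 2) \<odot> T x" if "x \<in> carrier M" for x
    unfolding X_def using that T_simps by (intro ip_eqI) (auto simp: ip_simps)
  have "\<exists>x\<in>carrier M. x \<ominus> X x = (1 / 2) \<odot> y"
    by (rule contraction_solve[OF X, of "cmod (fst s) / 2"])
      (use sym_bidisc_gap(1)[OF s] y in \<open>auto simp: Xx hnorm_smult T_simps norm_divide unitary_op_hnorm[OF unitary_T]\<close>)
  then obtain x where x: "x \<in> carrier M" "x \<ominus> X x = (1 / 2) \<odot> y" by blast
  have "denom_op M s T x = 2 \<odot> (x \<ominus> X x)"
    unfolding denom_op_def using x(1) T_simps(1)[OF x(1)] by (intro ip_eqI) (auto simp: ip_simps Xx algebra_simps)
  also have "\<dots> = y"
    unfolding x(2) using y by (intro ip_eqI) (auto simp: ip_simps)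
  finally show ?thesis using x by blast
qed

lemma denom_invertible:
  assumes s: "s \<in> sym_bidisc"
  shows "bounded_op M M (op_inv M (denom_op M s T))" "invertible_op M (denom_op M s T)"
  using bounded_below_surj_invertible[OF denom_bounded _ denom_bounded_below denom_surj[OF s]]
    sym_bidisc_gap(1)[OF s] by simp_all

lemma op_sub_eq: "op_sub M s T = numer s \<circ> op_inv M (denom_op M s T)"
  by (simp add: op_sub_def numer_def fun_eq_iff)

lemma op_sub_in: "\<lbrakk>s \<in> sym_bidisc; x \<in> carrier M\<rbrakk> \<Longrightarrow> op_sub M s T x \<in> carrier M"
  by (simp add: op_sub_eq invertible_op_inv[OF denom_invertible(2)])

lemma op_sub_denom:
  assumes "s \<in> sym_bidisc" "x \<in> carrier M"
  shows "op_sub M s T (denom_op M s T x) = numer s x"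
  using assms by (simp add: op_sub_eq invertible_op_inv[OF denom_invertible(2)])

lemma op_sub_contraction:
  assumes s: "s \<in> sym_bidisc"
  obtains r where "0 \<le> r" "r < 1" "\<And>x. x \<in> carrier M \<Longrightarrow> hnorm M (op_sub M s T x) \<le> r * hnorm M x"
proof -
  obtain r where r: "0 \<le> r" "r < 1"
    and rn: "\<And>x. x \<in> carrier M \<Longrightarrow> hnorm M (numer s x) \<le> r * hnorm M (denom_op M s T x)"
    using numer_contraction[OF s] by blast
  have "hnorm M (op_sub M s T x) \<le> r * hnorm M x" if "x \<in> carrier M" for x
    using rn[of "op_inv M (denom_op M s T) x"] invertible_op_inv[OF denom_invertible(2)[OF s] that]
    by (simp add: op_sub_eq)
  with r that show ?thesis by blast
qed

lemma resolvent_invertible: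
  assumes s: "s \<in> sym_bidisc"
  shows "invertible_op M (resolvent_op M T D s)"
proof -
  obtain r where r: "0 \<le> r" "r < 1" "\<And>x. x \<in> carrier M \<Longrightarrow> hnorm M (op_sub M s T x) \<le> r * hnorm M x"
    using op_sub_contraction[OF s] by blast
  have X: "bounded_op M M (D \<circ> op_sub M s T)"
    unfolding op_sub_eq
    by (intro bounded_op_comp[OF hilbert_space_axioms hilbert_space_axioms hilbert_space_axioms]
        numer_bounded D_bounded denom_invertible s)
  have "invertible_op M (\<lambda>x. x \<ominus> (D \<circ> op_sub M s T) x)"
  proof (rule one_minus_contraction(1)[OF X r(1,2)])
    show "hnorm M ((D \<circ> op_sub M s T) x) \<le> r * hnorm M x" if "x \<in> carrier M" for x
      using D_contraction[OF op_sub_in[OF s that]] r(3)[OF that] by simp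
  qed
  then show ?thesis by (simp add: resolvent_op_def)
qed

lemma realization_defined: "s \<in> sym_bidisc \<Longrightarrow> realization_defined M T D s"
  by (simp add: realization_defined_def denom_invertible resolvent_invertible)

lemma pencil_eq:
  assumes "s \<in> sym_bidisc" "x \<in> carrier M"
  shows "pencil s x = resolvent_op M T D s (denom_op M s T x)"
  using assms by (simp add: pencil_def resolvent_op_def op_sub_denom)

lemma pencil_surj:
  assumes s: "s \<in> sym_bidisc" and y: "y \<in> carrier M"
  shows "\<exists>x\<in>carrier M. pencil s x = y"
  using denom_surj[OF s invertible_op_inv(1)[OF resolvent_invertible[OF s] y]]
    invertible_op_inv(2)[OF resolvent_invertible[OF s] y] pencil_eq[OF s]
  by (metis (no_types))

lemma realization_eq:
  assumes s: "s \<in> sym_bidisc" and x: "x \<in> carrier M" "pencil s x = C 1"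
  shows "realization M T A B C D s = A + B (numer s x)"
proof -
  have "op_inv M (resolvent_op M T D s) (C 1) = denom_op M s T x"
    using x pencil_eq[OF s x(1)] invertible_op_inv(3)[OF resolvent_invertible[OF s], of "denom_op M s T x"]
    by simp
  then show ?thesis using s x by (simp add: realization_def op_sub_denom)
qed

lemma pencil_bounded_below:
  assumes s: "s \<in> sym_bidisc"
  obtains m where "m > 0" "\<And>x. x \<in> carrier M \<Longrightarrow> m * hnorm M x \<le> hnorm M (pencil s x)"
proof -
  obtain r where r: "0 \<le> r" "r < 1"
    and rn: "\<And>x. x \<in> carrier M \<Longrightarrow> hnorm M (numer s x) \<le> r * hnorm M (denom_op M s T x)"
    using numer_contraction[OF s] by blast
  have "(1 - r) * (2 - cmod (fst s)) * hnorm M x \<le> hnorm M (pencil s x)" if x: "x \<in> carrier M" for x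
  proof -
    have "(1 - r) * ((2 - cmod (fst s)) * hnorm M x) \<le> (1 - r) * hnorm M (denom_op M s T x)"
      using r denom_bounded_below[OF x] by (intro mult_left_mono) auto
    also have "\<dots> \<le> hnorm M (denom_op M s T x) - hnorm M (D (numer s x))"
      using rn[OF x] D_contraction[of "numer s x"] x by (simp add: algebra_simps)
    also have "\<dots> \<le> hnorm M (pencil s x)"
      unfolding pencil_def using x D_simps by (intro hnorm_triangle_ineq2) auto
    finally show ?thesis by (simp add: mult.assoc)
  qed
  then show ?thesis using r sym_bidisc_gap(1)[OF s] by (intro that[of "(1 - r) * (2 - cmod (fst s))"]) auto
qed

text \<open>The colligation sends \<open>(1, numer s x)\<close> to the pair of the value and
  \<open>denom_op M s T x\<close>. By equality of norms, 1 minus the squared modulus of the value is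
  the difference of the squared norms of denominator and numerator.\<close>

lemma realization_bounded:
  assumes s: "s \<in> sym_bidisc"
  shows "cmod (realization M T A B C D s) \<le> 1"
proof -
  obtain x where x: "x \<in> carrier M" "pencil s x = C 1" using pencil_surj[OF s, of "C 1"] by auto
  have "C 1 \<oplus> D (numer s x) = denom_op M s T x"
    unfolding x(2)[symmetric] pencil_def using x D_simps by (intro ip_eqI) (auto simp: ip_simps)
  then have "(cmod (A * 1 + B (numer s x)))\<^sup>2 + (hnorm M (denom_op M s T x))\<^sup>2 = 1 + (hnorm M (numer s x))\<^sup>2"
    using colligation_isometry[of "numer s x" 1] x by simp
  moreover obtain r where r: "0 \<le> r" "r < 1" "hnorm M (numer s x) \<le> r * hnorm M (denom_op M s T x)"
    using numer_contraction[OF s] x by metis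
  then have "hnorm M (numer s x) \<le> hnorm M (denom_op M s T x)"
    using x mult_right_mono[of r 1 "hnorm M (denom_op M s T x)"] by simp
  then have "(hnorm M (numer s x))\<^sup>2 \<le> (hnorm M (denom_op M s T x))\<^sup>2" using x by (intro power_mono) auto
  ultimately have "(cmod (A + B (numer s x)))\<^sup>2 \<le> 1\<^sup>2" by simp
  then show ?thesis unfolding realization_eq[OF s x] by (rule power2_le_imp_le) simp
qed

lemma pencil_bounded: "bounded_op M M (pencil s)"
proof -
  have "bounded_op M M (\<lambda>x. (1 \<odot> denom_op M s T x) \<ominus> (1 \<odot> (D \<circ> numer s) x))"
    by (intro bounded_op_lincomb denom_bounded hilbert_space_axioms
        bounded_op_comp[OF hilbert_space_axioms hilbert_space_axioms hilbert_space_axioms]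
        numer_bounded D_bounded)
  then show ?thesis
    unfolding bounded_op_def pencil_def by (auto simp: smult_one_eq D_simps(1) Pi_iff)
qed

text \<open>No inverse is differentiated. Because the pencil is affine in \<open>s\<close>, the
  increment of the realization is exactly linear in \<open>s - s0\<close>, with coefficients
  evaluated at the moving solution \<open>X s\<close>; replacing \<open>X s\<close> by
  \<open>x0\<close> costs a quadratic error.\<close>

lemma realization_analytic:
  assumes s0: "s0 \<in> sym_bidisc" and \<phi>: "\<And>s. s \<in> sym_bidisc \<Longrightarrow> \<phi> s = realization M T A B C D s"
  shows "\<exists>a b. (\<phi> has_derivative (\<lambda>h. a * fst h + b * snd h)) (at s0)"
proof -
  obtain m where m: "m > 0" "\<And>x. x \<in> carrier M \<Longrightarrow> m * hnorm M x \<le> hnorm M (pencil s0 x)"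
    using pencil_bounded_below[OF s0] by blast
  obtain x0 where x0: "x0 \<in> carrier M" "pencil s0 x0 = C 1" using pencil_surj[OF s0, of "C 1"] by auto
  have "\<forall>s\<in>sym_bidisc. \<exists>x. x \<in> carrier M \<and> pencil s x = C 1"
    using pencil_surj[OF _ C_in] by blast
  then obtain X where X: "\<And>s. s \<in> sym_bidisc \<Longrightarrow> X s \<in> carrier M" "\<And>s. s \<in> sym_bidisc \<Longrightarrow> pencil s (X s) = C 1"
    by (subst (asm) bchoice_iff) blast
  define R where "R = op_inv M (pencil s0)"
  have inv: "invertible_op M (pencil s0)" and R: "bounded_op M M R"
    using bounded_below_surj_invertible[OF pencil_bounded m pencil_surj[OF s0]] by (simp_all add: R_def)
  note Rs = bounded_opD[OF R] and Rm = bounded_op_diff[OF hilbert_space_axioms hilbert_space_axioms R]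
  note Ps = bounded_opD[OF pencil_bounded]
    and Pm = bounded_op_diff[OF hilbert_space_axioms hilbert_space_axioms pencil_bounded]
  \<comment> \<open>The functional that sends the right-hand side of \<open>pencil s0 x = y\<close>
    to \<open>B (numer s0 x)\<close>.\<close>
  define l where "l = B \<circ> (numer s0 \<circ> R)"
  have l: "bounded_op M scalar_hilbert l"
    unfolding l_def
    by (intro bounded_op_comp[where K = M] hilbert_space_axioms hilbert_space_scalar B_bounded numer_bounded R)
  have ls3: "l (c \<odot> x) = c * l x" if "x \<in> carrier M" for x c
    using that bounded_opD(3)[OF l] by (simp add: scalar_hilbert_def)
  have ls12: "l (x \<oplus> y) = l x + l y" "l (x \<ominus> y) = l x - l y"
    if "x \<in> carrier M" "y \<in> carrier M" for x y
    using that bounded_opD[OF l] bounded_op_diff[OF hilbert_space_axioms hilbert_space_scalar l]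
    by (simp_all add: scalar_hilbert_minus) (simp_all add: scalar_hilbert_def)
  note ls = ls12 ls3
  obtain bl where bl: "bl > 0" "\<And>x. x \<in> carrier M \<Longrightarrow> cmod (l x) \<le> bl * hnorm M x"
    using bounded_op_bound[OF hilbert_space_axioms l] unfolding scalar_hilbert_hnorm by blast
  obtain bB where bB: "bB > 0" "\<And>x. x \<in> carrier M \<Longrightarrow> cmod (B x) \<le> bB * hnorm M x"
    using bounded_op_bound[OF hilbert_space_axioms B_bounded] unfolding scalar_hilbert_hnorm by blast
  \<comment> \<open>At \<open>x0\<close> these are the partial derivatives. The terms with
    \<open>l\<close> come from the change of the pencil, the other ones from the change of
    \<open>numer\<close>.\<close>
  define \<alpha> where "\<alpha> x = l (T x \<ominus> D x) - B x" for x
  define \<beta> where "\<beta> x = 2 * (B (T x) + l (D (T x)))" for x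
  have \<alpha>m: "\<alpha> (x \<ominus> y) = \<alpha> x - \<alpha> y" and \<beta>m: "\<beta> (x \<ominus> y) = \<beta> x - \<beta> y"
    if "x \<in> carrier M" "y \<in> carrier M" for x y
    using that by (simp_all add: \<alpha>_def \<beta>_def T_diff D_diff B_diff ls T_simps(1) D_simps(1) algebra_simps)
  define K where "K = 2 * bl + 2 * bB"
  have K: "K > 0" using bl bB by (simp add: K_def)
  have Th: "hnorm M (T x) = hnorm M x" if "x \<in> carrier M" for x
    using unitary_op_hnorm[OF unitary_T that] .
  have \<alpha>b: "cmod (\<alpha> x) \<le> K * hnorm M x" if x: "x \<in> carrier M" for x
  proof -
    have "hnorm M (T x \<ominus> D x) \<le> 2 * hnorm M x"
      using hnorm_triangle_diff[of "T x" "D x"] D_contraction[OF x] x by (simp add: T_simps(1) D_simps(1) Th)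
    then have "cmod (l (T x \<ominus> D x)) \<le> bl * (2 * hnorm M x)"
      using bl(2)[of "T x \<ominus> D x"] bl(1) mult_left_mono[of _ _ bl] x
      by (meson T_simps(1) D_simps(1) less_imp_le minus_closed order_trans)
    moreover have "0 \<le> bB * hnorm M x" using bB x by simp
    ultimately show ?thesis
      unfolding \<alpha>_def K_def using norm_triangle_ineq4[of "l (T x \<ominus> D x)" "B x"] bB(2)[OF x]
      by (simp add: algebra_simps)
  qed
  have \<beta>b: "cmod (\<beta> x) \<le> K * hnorm M x" if x: "x \<in> carrier M" for x
  proof -
    have "cmod (l (D (T x))) \<le> bl * hnorm M x"
    proof (rule order_trans)
      show "cmod (l (D (T x))) \<le> bl * hnorm M (D (T x))"
        using x by (intro bl(2)) (simp add: T_simps(1) D_simps(1))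
      show "bl * hnorm M (D (T x)) \<le> bl * hnorm M x"
        using D_contraction[of "T x"] x bl(1) by (simp add: T_simps(1) Th)
    qed
    moreover have "cmod (B (T x)) \<le> bB * hnorm M x" using bB(2)[of "T x"] x by (simp add: T_simps(1) Th)
    ultimately show ?thesis
      unfolding \<beta>_def K_def using norm_triangle_ineq[of "B (T x)" "l (D (T x))"]
      by (simp only: norm_mult norm_numeral) (simp add: algebra_simps)
  qed
  have diff: "pencil s0 (X s) \<ominus> C 1 = (fst (s - s0) \<odot> (T (X s) \<ominus> D (X s))) \<oplus> ((2 * snd (s - s0)) \<odot> D (T (X s)))"
    if s: "s \<in> sym_bidisc" for s
  proof -
    have "pencil s0 (X s) \<ominus> pencil s (X s) =
        (fst (s - s0) \<odot> (T (X s) \<ominus> D (X s))) \<oplus> ((2 * snd (s - s0)) \<odot> D (T (X s)))"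
      using X(1)[OF s]
      by (intro ip_eqI)
        (auto simp: pencil_def denom_op_def numer_def T_simps(1) D_simps D_diff ip_simps algebra_simps)
    then show ?thesis by (simp add: X(2)[OF s])
  qed
  have eq: "realization M T A B C D s - realization M T A B C D s0
      = fst (s - s0) * \<alpha> (X s) + snd (s - s0) * \<beta> (X s)" if s: "s \<in> sym_bidisc" for s
  proof -
    note [simp] = X(1)[OF s] x0(1)
    have "X s \<ominus> x0 = R (pencil s0 (X s) \<ominus> pencil s0 x0)"
      using invertible_op_inv(3)[OF inv, of "X s \<ominus> x0"] by (simp add: R_def Pm)
    then have "B (numer s0 (X s \<ominus> x0)) = l (pencil s0 (X s) \<ominus> C 1)" by (simp add: l_def x0)
    also have "\<dots> = fst (s - s0) * l (T (X s) \<ominus> D (X s)) + 2 * snd (s - s0) * l (D (T (X s)))"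
      by (simp add: diff[OF s] ls T_simps(1) D_simps(1))
    finally have 1: "B (numer s0 (X s)) - B (numer s0 x0) = \<dots>"
      using bounded_op_diff[OF hilbert_space_axioms hilbert_space_axioms numer_bounded, of "X s" x0 s0]
      by (simp add: B_diff)
    have 2: "B (numer s (X s)) - B (numer s0 (X s)) = 2 * snd (s - s0) * B (T (X s)) - fst (s - s0) * B (X s)"
      by (simp add: numer_def B_diff B_simps T_simps(1) algebra_simps)
    have 3: "A + B (numer s (X s)) - (A + B (numer s0 x0))
        = (B (numer s (X s)) - B (numer s0 (X s))) + (B (numer s0 (X s)) - B (numer s0 x0))" by simp
    show ?thesis
      unfolding realization_eq[OF s X(1)[OF s] X(2)[OF s]] realization_eq[OF s0 x0] \<alpha>_def \<beta>_def 3
      unfolding 1 2 by (simp add: algebra_simps)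
  qed
  \<comment> \<open>With \<open>h = norm (s - s0)\<close>, the pencil changes by an operator of norm
    at most \<open>4 h\<close>. Requiring \<open>8 h \<le> m\<close> lets half of \<open>m\<close>
    absorb the unknown distance, which doubles the constant to 8.\<close>
  have close: "hnorm M (X s \<ominus> x0) \<le> 8 * norm (s - s0) / m * hnorm M x0"
    if s: "s \<in> sym_bidisc" and d: "8 * norm (s - s0) \<le> m" for s
  proof -
    note [simp] = X(1)[OF s] x0(1)
    let ?h = "norm (s - s0)" and ?d = "hnorm M (X s \<ominus> x0)"
    have f: "cmod (fst (s - s0)) \<le> ?h" "cmod (snd (s - s0)) \<le> ?h"
      using norm_fst_le[of "fst (s - s0)" "snd (s - s0)"] norm_snd_le[of "snd (s - s0)" "fst (s - s0)"]
      by (simp_all only: prod.collapse)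
    have "m * ?d \<le> hnorm M (pencil s0 (X s) \<ominus> C 1)"
      using m(2)[of "X s \<ominus> x0"] by (simp add: Pm x0)
    also have "\<dots> \<le> cmod (fst (s - s0)) * hnorm M (T (X s) \<ominus> D (X s))
        + 2 * cmod (snd (s - s0)) * hnorm M (D (T (X s)))"
      unfolding diff[OF s]
      using hnorm_triangle[of "fst (s - s0) \<odot> (T (X s) \<ominus> D (X s))" "(2 * snd (s - s0)) \<odot> D (T (X s))"]
      by (simp add: hnorm_smult norm_mult T_simps(1) D_simps(1) del: fst_diff snd_diff)
    also have "\<dots> \<le> ?h * (2 * hnorm M (X s)) + 2 * ?h * hnorm M (X s)"
      using f hnorm_triangle_diff[of "T (X s)" "D (X s)"] D_contraction[of "X s"] D_contraction[of "T (X s)"]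
      by (intro add_mono mult_mono) (auto simp: T_simps(1) D_simps(1) Th)
    also have "\<dots> = 4 * ?h * hnorm M (X s)" by simp
    also have "\<dots> \<le> 4 * ?h * (hnorm M x0 + ?d)"
      using hnorm_triangle_ineq2[of "X s" x0] by (intro mult_left_mono) auto
    finally have "m * ?d \<le> 4 * ?h * hnorm M x0 + 4 * ?h * ?d" by (simp add: algebra_simps)
    moreover have "8 * ?h * ?d \<le> m * ?d" using d by (intro mult_right_mono) auto
    ultimately have "m * ?d \<le> 8 * ?h * hnorm M x0" by linarith
    then show ?thesis using m(1) by (simp add: field_simps)
  qed
  have "(\<phi> has_derivative (\<lambda>h. \<alpha> x0 * fst h + \<beta> x0 * snd h)) (at s0)"
    unfolding has_derivative_at_alt
  proof (intro conjI allI impI)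
    show "bounded_linear (\<lambda>h. \<alpha> x0 * fst h + \<beta> x0 * snd h)"
      by (intro bounded_linear_add bounded_linear_mult_right[THEN bounded_linear_compose]
          bounded_linear_fst bounded_linear_snd)
    fix e :: real assume e: "e > 0"
    obtain d0 where d0: "d0 > 0" "ball s0 d0 \<subseteq> sym_bidisc"
      using open_sym_bidisc s0 by (meson openE)
    \<comment> \<open>The remainder is at most \<open>Q h^2\<close>; in the radius,
      \<open>Q + 1\<close> avoids a division by zero.\<close>
    define Q where "Q = 2 * K * (8 / m * hnorm M x0)"
    have Q: "Q \<ge> 0" using K m x0 by (simp add: Q_def)
    define d where "d = min d0 (min (m / 8) (e / (Q + 1)))"
    have dp: "d > 0" using d0 m e Q by (simp add: d_def)
    have "norm (\<phi> y - \<phi> s0 - (\<alpha> x0 * fst (y - s0) + \<beta> x0 * snd (y - s0))) \<le> e * norm (y - s0)"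
      if y: "norm (y - s0) < d" for y
    proof -
      let ?h = "norm (y - s0)"
      have "y \<in> ball s0 d0" using y by (simp add: d_def dist_norm norm_minus_commute)
      then have yG: "y \<in> sym_bidisc" using d0 by blast
      have ym: "8 * ?h \<le> m" using y by (simp add: d_def)
      note [simp] = X(1)[OF yG] x0(1)
      have f: "cmod (fst (y - s0)) \<le> ?h" "cmod (snd (y - s0)) \<le> ?h"
        using norm_fst_le[of "fst (y - s0)" "snd (y - s0)"] norm_snd_le[of "snd (y - s0)" "fst (y - s0)"]
      by (simp_all only: prod.collapse)
      have "\<phi> y - \<phi> s0 - (\<alpha> x0 * fst (y - s0) + \<beta> x0 * snd (y - s0))
          = fst (y - s0) * \<alpha> (X y \<ominus> x0) + snd (y - s0) * \<beta> (X y \<ominus> x0)"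
        using eq[OF yG] by (simp add: \<phi>[OF yG] \<phi>[OF s0] \<alpha>m \<beta>m algebra_simps)
      also have "cmod \<dots> \<le> cmod (fst (y - s0)) * cmod (\<alpha> (X y \<ominus> x0)) + cmod (snd (y - s0)) * cmod (\<beta> (X y \<ominus> x0))"
        by (rule order_trans[OF norm_triangle_ineq]) (simp add: norm_mult)
      also have "\<dots> \<le> ?h * (K * hnorm M (X y \<ominus> x0)) + ?h * (K * hnorm M (X y \<ominus> x0))"
        using f \<alpha>b[of "X y \<ominus> x0"] \<beta>b[of "X y \<ominus> x0"] by (intro add_mono mult_mono) auto
      also have "\<dots> = ?h * (2 * K * hnorm M (X y \<ominus> x0))" by simp
      also have "\<dots> \<le> ?h * (2 * K * (8 * ?h / m * hnorm M x0))"
        using close[OF yG ym] K by (intro mult_left_mono) auto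
      also have "\<dots> = ?h * (Q * ?h)" by (simp add: Q_def)
      also have "\<dots> \<le> ?h * e"
      proof (intro mult_left_mono)
        have "Q * ?h \<le> (Q + 1) * ?h" by (simp add: mult_right_mono)
        also have "\<dots> \<le> (Q + 1) * (e / (Q + 1))" using y Q by (intro mult_left_mono) (auto simp: d_def)
        also have "\<dots> = e" using Q by simp
        finally show "Q * ?h \<le> e" .
      qed auto
      finally show ?thesis by (simp add: mult.commute)
    qed
    with dp show "\<exists>d>0. \<forall>y. norm (y - s0) < d \<longrightarrow>
        norm (\<phi> y - \<phi> s0 - (\<alpha> x0 * fst (y - s0) + \<beta> x0 * snd (y - s0))) \<le> e * norm (y - s0)" by blast
  qed
  then show ?thesis by blast
qed

lemma realization_schur_class:
  assumes "\<And>s. s \<in> sym_bidisc \<Longrightarrow> \<phi> s = realization M T A B C D s"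
  shows "\<phi> \<in> schur_class"
  unfolding schur_class_def analytic2_on_def
  using realization_analytic[of _ \<phi>] realization_bounded assms by auto

end

section \<open>Unitary extension of isometries\<close>

context hilbert_space
begin

text \<open>Nearest point in a closed subspace. The parallelogram law, applied to midpoints in
  \<open>L\<close>, makes a minimising sequence Cauchy; orthogonality follows by moving the
  minimiser along \<open>l\<close>.\<close>

lemma orthogonal_projection:
  assumes L: "L \<subseteq> carrier H" "\<zero> \<in> L"
    and add: "\<And>x y. \<lbrakk>x \<in> L; y \<in> L\<rbrakk> \<Longrightarrow> x \<oplus> y \<in> L" and smult: "\<And>c x. x \<in> L \<Longrightarrow> c \<odot> x \<in> L"
    and closed: "\<And>X x. \<lbrakk>\<And>n. X n \<in> L; x \<in> carrier H; (\<lambda>n::nat. hnorm H (X n \<ominus> x)) \<longlonglongrightarrow> 0\<rbrakk> \<Longrightarrow> x \<in> L"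
    and h: "h \<in> carrier H"
  shows "\<exists>p\<in>L. \<forall>l\<in>L. ip H (h \<ominus> p) l = 0"
proof -
  have Lc: "l \<in> carrier H" if "l \<in> L" for l using L that by blast
  define d where "d = (INF l\<in>L. (hnorm H (h \<ominus> l))\<^sup>2)"
  have bdd: "bdd_below ((\<lambda>l. (hnorm H (h \<ominus> l))\<^sup>2) ` L)" by (rule bdd_belowI[of _ 0]) auto
  have d: "d \<le> (hnorm H (h \<ominus> l))\<^sup>2" if "l \<in> L" for l
    unfolding d_def using bdd that by (intro cINF_lower)
  have "\<exists>l\<in>L. (hnorm H (h \<ominus> l))\<^sup>2 < d + 1 / real (Suc n)" for n
    using L cINF_less_iff[OF _ bdd, of "d + 1 / real (Suc n)"] unfolding d_def by auto
  then obtain q where q: "\<And>n. q n \<in> L" "\<And>n. (hnorm H (h \<ominus> q n))\<^sup>2 < d + 1 / real (Suc n)" by metis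
  note qc = Lc[OF q(1)]
  have par: "(hnorm H (q m \<ominus> q n))\<^sup>2 \<le> 2 / real (Suc m) + 2 / real (Suc n)" for m n
  proof -
    let ?a = "(1 / 2) \<odot> (q m \<oplus> q n)"
    have "(hnorm H (q m \<ominus> q n))\<^sup>2 = 2 * (hnorm H (h \<ominus> q m))\<^sup>2 + 2 * (hnorm H (h \<ominus> q n))\<^sup>2
        - 4 * (hnorm H (h \<ominus> ?a))\<^sup>2"
      using h qc by (simp add: hnorm_sq ip_simps algebra_simps)
    moreover have "d \<le> (hnorm H (h \<ominus> ?a))\<^sup>2" using q add smult by (intro d) auto
    ultimately show ?thesis using q(2)[of m] q(2)[of n] by simp
  qed
  have "\<exists>p\<in>carrier H. (\<lambda>n. hnorm H (q n \<ominus> p)) \<longlonglongrightarrow> 0"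
  proof (rule hcomplete[OF qc])
    fix e :: real assume e: "e > 0"
    obtain N where N: "4 / e\<^sup>2 < real (Suc N)" using reals_Archimedean2 by (metis less_SucI of_nat_less_iff order_less_trans lessI)
    have "hnorm H (q m \<ominus> q n) < e" if mn: "m \<ge> N" "n \<ge> N" for m n
    proof (rule power2_less_imp_less)
      have "2 / real (Suc m) \<le> 2 / real (Suc N)" "2 / real (Suc n) \<le> 2 / real (Suc N)"
        using mn by (auto intro!: divide_left_mono)
      then have "(hnorm H (q m \<ominus> q n))\<^sup>2 \<le> 4 / real (Suc N)" using par[of m n] by simp
      also have "\<dots> < e\<^sup>2" using N e by (simp add: field_simps)
      finally show "(hnorm H (q m \<ominus> q n))\<^sup>2 < e\<^sup>2" .
    qed (use e in simp)
    then show "\<exists>N. \<forall>m\<ge>N. \<forall>n\<ge>N. hnorm H (q m \<ominus> q n) < e" by blast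
  qed
  then obtain p where p: "p \<in> carrier H" "(\<lambda>n. hnorm H (q n \<ominus> p)) \<longlonglongrightarrow> 0" by blast
  have pL: "p \<in> L" using closed[OF q(1) p] .
  have hp: "(hnorm H (h \<ominus> p))\<^sup>2 \<le> d"
  proof (rule LIMSEQ_le_const)
    have "(\<lambda>n. (sqrt (d + 1 / real (Suc n)) + hnorm H (q n \<ominus> p))\<^sup>2) \<longlonglongrightarrow> (sqrt (d + 0) + 0)\<^sup>2"
      by (intro tendsto_intros p LIMSEQ_Suc[OF lim_1_over_n])
    moreover have "d \<ge> 0" unfolding d_def using L by (intro cINF_greatest) auto
    ultimately show "(\<lambda>n. (sqrt (d + 1 / real (Suc n)) + hnorm H (q n \<ominus> p))\<^sup>2) \<longlonglongrightarrow> d" by simp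
    have "(hnorm H (h \<ominus> p))\<^sup>2 \<le> (sqrt (d + 1 / real (Suc n)) + hnorm H (q n \<ominus> p))\<^sup>2" for n
    proof (rule power_mono)
      have "h \<ominus> p = (h \<ominus> q n) \<oplus> (q n \<ominus> p)"
        using h p(1) qc by (intro ip_eqI) (auto simp: ip_simps)
      then have "hnorm H (h \<ominus> p) \<le> hnorm H (h \<ominus> q n) + hnorm H (q n \<ominus> p)"
        using h p(1) qc hnorm_triangle by simp
      moreover have "hnorm H (h \<ominus> q n) \<le> sqrt (d + 1 / real (Suc n))"
        using q(2)[of n] by (intro real_le_rsqrt) auto
      ultimately show "hnorm H (h \<ominus> p) \<le> sqrt (d + 1 / real (Suc n)) + hnorm H (q n \<ominus> p)" by simp
    qed (use h p in auto)
    then show "\<exists>N. \<forall>n\<ge>N. (hnorm H (h \<ominus> p))\<^sup>2 \<le> (sqrt (d + 1 / real (Suc n)) + hnorm H (q n \<ominus> p))\<^sup>2" by blast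
  qed
  have "ip H (h \<ominus> p) l = 0" if l: "l \<in> L" for l
  proof (cases "l = \<zero>")
    case False
    let ?r = "h \<ominus> p"
    have r: "?r \<in> carrier H" "l \<in> carrier H" using h p Lc[OF l] by auto
    define n where "n = (hnorm H l)\<^sup>2"
    have n: "n > 0" using False r hnorm_eq_0 by (simp add: n_def)
    define c where "c = ip H ?r l / of_real n"
    have "h \<ominus> (p \<oplus> c \<odot> l) = ?r \<ominus> c \<odot> l"
      using h p(1) r by (intro ip_eqI) (auto simp: ip_simps)
    then have "d \<le> (hnorm H (?r \<ominus> c \<odot> l))\<^sup>2"
      using d[of "p \<oplus> c \<odot> l"] pL l add smult by simp
    also have "\<dots> = (hnorm H ?r)\<^sup>2 + (cmod c)\<^sup>2 * n - 2 * Re (cnj c * ip H ?r l)"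
      using r by (simp add: hnorm_diff_sq hnorm_smult ip_smult_right power_mult_distrib n_def)
    also have "ip H ?r l = c * of_real n" using n by (simp add: c_def)
    also have "cnj c * (c * of_real n) = of_real ((cmod c)\<^sup>2 * n)"
      by (simp add: complex_norm_square del: of_real_power)
    finally have "d \<le> (hnorm H ?r)\<^sup>2 - (cmod c)\<^sup>2 * n" by (simp add: mult.commute)
    then have "(cmod c)\<^sup>2 * n \<le> 0" using hp by linarith
    then have "c = 0" using n by (simp add: mult_le_0_iff)
    then show ?thesis using n by (simp add: c_def)
  qed (use h p in auto)
  with pL show ?thesis by blast
qed

lemma ip_tendsto_zero:
  assumes X: "\<And>n. X n \<in> carrier H" "x \<in> carrier H" "v \<in> carrier H" "(\<lambda>n. hnorm H (X n \<ominus> x)) \<longlonglongrightarrow> 0"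
    and "\<And>n. ip H (X n) v = 0"
  shows "ip H x v = 0"
proof -
  have "cmod (ip H x v) \<le> hnorm H (X n \<ominus> x) * hnorm H v" for n
    using Cauchy_Schwarz[of "X n \<ominus> x" v] assms by (simp add: ip_diff)
  moreover have "(\<lambda>n. hnorm H (X n \<ominus> x) * hnorm H v) \<longlonglongrightarrow> 0 * hnorm H v"
    by (intro tendsto_intros assms)
  ultimately have "cmod (ip H x v) \<le> 0 * hnorm H v"
    by (intro LIMSEQ_le_const[where a = "cmod (ip H x v)"]) auto
  then show ?thesis by simp
qed

text \<open>\<open>R = 2 p - 1\<close> for the projection \<open>p\<close> onto the double
  orthogonal complement \<open>L\<close> of \<open>S\<close>. With \<open>L\<close> in place of a
  closed span, closedness is immediate from \<open>ip_tendsto_zero\<close>. \<open>R\<close> is a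
  self-adjoint involution, hence its own adjoint and inverse.\<close>

lemma reflection_exists:
  assumes S: "S \<subseteq> carrier H"
  shows "\<exists>R. unitary_op H R \<and> (\<forall>s\<in>S. R s = s) \<and>
    (\<forall>v\<in>carrier H. (\<forall>s\<in>S. ip H v s = 0) \<longrightarrow> R v = (- 1) \<odot> v)"
proof -
  define P where "P = {v \<in> carrier H. \<forall>s\<in>S. ip H v s = 0}"
  define L where "L = {p \<in> carrier H. \<forall>v\<in>P. ip H p v = 0}"
  have Lc: "l \<in> carrier H" if "l \<in> L" for l using that by (simp add: L_def)
  have SL: "S \<subseteq> L"
  proof
    fix s assume s: "s \<in> S"
    then show "s \<in> L" using S ip_cnj[of _ s] by (force simp: L_def P_def)
  qed
  have Ladd: "x \<oplus> y \<in> L" "x \<ominus> y \<in> L" if "x \<in> L" "y \<in> L" for x y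
    using that by (auto simp: L_def P_def ip_simps)
  have Lsm: "c \<odot> x \<in> L" if "x \<in> L" for x c
    using that by (auto simp: L_def P_def ip_simps)
  have "\<forall>h\<in>carrier H. \<exists>p. p \<in> L \<and> (\<forall>l\<in>L. ip H (h \<ominus> p) l = 0)"
  proof
    fix h assume h: "h \<in> carrier H"
    have "\<exists>p\<in>L. \<forall>l\<in>L. ip H (h \<ominus> p) l = 0"
  proof (rule orthogonal_projection)
    fix X x assume "\<And>n::nat. X n \<in> L" "x \<in> carrier H" "(\<lambda>n. hnorm H (X n \<ominus> x)) \<longlonglongrightarrow> 0"
    then show "x \<in> L" using ip_tendsto_zero[of X x] by (auto simp: L_def P_def)
    qed (use h in \<open>auto simp: L_def P_def ip_simps\<close>)
    then show "\<exists>p. p \<in> L \<and> (\<forall>l\<in>L. ip H (h \<ominus> p) l = 0)" by blast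
  qed
  then obtain p where p: "\<And>h. h \<in> carrier H \<Longrightarrow> p h \<in> L"
    "\<And>h l. \<lbrakk>h \<in> carrier H; l \<in> L\<rbrakk> \<Longrightarrow> ip H (h \<ominus> p h) l = 0"
    by (subst (asm) bchoice_iff) blast
  note [simp] = Lc[OF p(1)]
  have puniq: "p h = q" if h: "h \<in> carrier H" and q: "q \<in> L" "\<And>l. l \<in> L \<Longrightarrow> ip H (h \<ominus> q) l = 0" for h q
  proof -
    have l: "p h \<ominus> q \<in> L" using p q h Ladd by auto
    have "ip H (p h \<ominus> q) (p h \<ominus> q) = ip H (h \<ominus> q) (p h \<ominus> q) - ip H (h \<ominus> p h) (p h \<ominus> q)"
      using h Lc[OF q(1)] by (simp add: ip_diff)
    then have "ip H (p h \<ominus> q) (p h \<ominus> q) = 0" using q(2)[OF l] p(2)[OF h l] by simp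
    moreover have "p h \<in> carrier H" "q \<in> carrier H" using h Lc q(1) by auto
    ultimately show ?thesis by (intro minus_eq_zeroD[OF _ _ ip_definite]) auto
  qed
  have ph: "ip H (p h) l = ip H h l" if "h \<in> carrier H" "l \<in> L" for h l
    using p(2)[OF that] that Lc by (simp add: ip_diff)
  have ph': "ip H l (p h) = ip H l h" if "h \<in> carrier H" "l \<in> L" for h l
    using ph[OF that] that Lc by (metis p(1) ip_cnj)
  have padd: "p (x \<oplus> y) = p x \<oplus> p y" if "x \<in> carrier H" "y \<in> carrier H" for x y
    using that by (intro puniq) (simp_all add: ip_simps ph p(1) Ladd Lsm Lc)
  have psm: "p (c \<odot> x) = c \<odot> p x" if "x \<in> carrier H" for x c
    using that by (intro puniq) (simp_all add: ip_simps ph p(1) Ladd Lsm Lc)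
  define R where "R h = (2 \<odot> p h) \<ominus> h" for h
  have Rc [simp]: "R h \<in> carrier H" if "h \<in> carrier H" for h using that by (simp add: R_def)
  have Rsa: "ip H (R h) k = ip H h (R k)" if "h \<in> carrier H" "k \<in> carrier H" for h k
  proof -
    have "ip H (p h) k = ip H h (p k)"
      using that ph[OF that(1) p(1)[OF that(2)]] ph'[OF that(2) p(1)[OF that(1)]] by simp
    then show ?thesis using that by (simp add: R_def ip_simps)
  qed
  have pR: "p (R h) = p h" if "h \<in> carrier H" for h
    using that by (intro puniq) (simp_all add: R_def ip_simps ph p(1) Lc)
  have RR: "R (R h) = h" if "h \<in> carrier H" for h
  proof -
    have "R (R h) = (2 \<odot> p h) \<ominus> ((2 \<odot> p h) \<ominus> h)" using pR[OF that] by (simp add: R_def)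
    also have "\<dots> = h" using that by (intro ip_eqI) (auto simp: ip_simps)
    finally show ?thesis .
  qed
  have Rn: "hnorm H (R h) = hnorm H h" if "h \<in> carrier H" for h
    using that by (simp add: hnorm_def Rsa RR)
  have Rb: "bounded_op H H R"
  proof (rule bounded_opI[where b = 1])
    show "R (x \<oplus> y) = R x \<oplus> R y" if "x \<in> carrier H" "y \<in> carrier H" for x y
      using that unfolding R_def by (intro ip_eqI) (auto simp: ip_simps padd algebra_simps)
    show "R (c \<odot> x) = c \<odot> R x" if "x \<in> carrier H" for x c
      using that unfolding R_def by (intro ip_eqI) (auto simp: ip_simps psm algebra_simps)
  qed (auto simp: Rn)
  have "unitary_op H R"
    unfolding unitary_op_def adjoint_ops_def inverse_ops_def using Rb Rsa RR by blast
  moreover have "R s = s" if "s \<in> S" for s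
  proof -
    have s: "s \<in> L" "s \<in> carrier H" using that SL S by auto
    have "p s = s" using s Lc by (intro puniq) (simp_all add: ip_diff)
    then show ?thesis using s unfolding R_def by (intro ip_eqI) (auto simp: ip_simps)
  qed
  moreover have "R v = (- 1) \<odot> v" if v: "v \<in> carrier H" "\<forall>s\<in>S. ip H v s = 0" for v
  proof -
    have "ip H l v = 0" if "l \<in> L" for l using that v by (simp add: L_def P_def)
    then have "ip H v l = 0" if "l \<in> L" for l using that v Lc ip_cnj[of l v] by simp
    moreover have "v \<ominus> \<zero> = v" using v by (intro ip_eqI) (auto simp: ip_simps)
    ultimately have "p v = \<zero>" using v(1) by (intro puniq) (simp_all add: L_def P_def)
    then show ?thesis using v unfolding R_def by (intro ip_eqI) (auto simp: ip_simps)
  qed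
  ultimately show ?thesis by blast
qed

end

lemma unitary_op_comp:
  assumes H: "hilbert_space H" and U: "unitary_op H U" and W: "unitary_op H W"
  shows "unitary_op H (U \<circ> W)"
proof -
  obtain U' where U': "bounded_op H H U'" "adjoint_ops H U U'" "inverse_ops H U U'"
    using U by (auto simp: unitary_op_def)
  obtain W' where W': "bounded_op H H W'" "adjoint_ops H W W'" "inverse_ops H W W'"
    using W by (auto simp: unitary_op_def)
  note b = unitary_op_bounded[OF U] unitary_op_bounded[OF W]
  have "adjoint_ops H (U \<circ> W) (W' \<circ> U')" "inverse_ops H (U \<circ> W) (W' \<circ> U')"
    using U' W' bounded_opD(1)[OF b(1)] bounded_opD(1)[OF b(2)] bounded_opD(1)[OF U'(1)] bounded_opD(1)[OF W'(1)]
    by (simp_all add: adjoint_ops_def inverse_ops_def)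
  then show ?thesis
    unfolding unitary_op_def using bounded_op_comp[OF H H H] b U'(1) W'(1) by blast
qed

lemma hilbert_sum_simps:
  "carrier (hilbert_sum H K) = carrier H \<times> carrier K"
  "\<zero>\<^bsub>hilbert_sum H K\<^esub> = (\<zero>\<^bsub>H\<^esub>, \<zero>\<^bsub>K\<^esub>)"
  "(x, y) \<oplus>\<^bsub>hilbert_sum H K\<^esub> (x', y') = (x \<oplus>\<^bsub>H\<^esub> x', y \<oplus>\<^bsub>K\<^esub> y')"
  "c \<odot>\<^bsub>hilbert_sum H K\<^esub> (x, y) = (c \<odot>\<^bsub>H\<^esub> x, c \<odot>\<^bsub>K\<^esub> y)"
  "ip (hilbert_sum H K) (x, y) (x', y') = ip H x x' + ip K y y'"
  by (simp_all add: hilbert_sum_def)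

lemma unitary_op_swap:
  assumes "hilbert_space H"
  shows "unitary_op (hilbert_sum H H) prod.swap"
proof -
  have "bounded_op (hilbert_sum H H) (hilbert_sum H H) prod.swap"
    by (rule bounded_opI[where b = 1]) (auto simp: hilbert_sum_simps hnorm_def)
  then show ?thesis
    unfolding unitary_op_def adjoint_ops_def inverse_ops_def
    by (intro conjI exI[of _ prod.swap]) (auto simp: hilbert_sum_simps)
qed

text \<open>The reflection of \<open>H \<oplus> H\<close> in the closed span of the pairs \<open>(x\<^sub>i, y\<^sub>i)\<close> exchanges \<open>(x\<^sub>i, 0)\<close> and
  \<open>(0, y\<^sub>i)\<close>, because equality of the Gram matrices makes \<open>(x\<^sub>i, - y\<^sub>i)\<close> orthogonal to all these pairs.\<close>

lemma unitary_extension: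
  assumes H: "hilbert_space H" and x: "\<And>i. x i \<in> carrier H" and y: "\<And>i. y i \<in> carrier H"
    and gram: "\<And>i j. ip H (x i) (x j) = ip H (y i) (y j)"
  shows "\<exists>W. unitary_op (hilbert_sum H H) W \<and> (\<forall>i. W (x i, \<zero>\<^bsub>H\<^esub>) = (y i, \<zero>\<^bsub>H\<^esub>))"
proof -
  interpret H: hilbert_space H by fact
  let ?S = "hilbert_sum H H"
  interpret S: hilbert_space ?S using hilbert_space_sum[OF H H] .
  obtain R where R: "unitary_op ?S R" "\<And>i. R (x i, y i) = (x i, y i)"
    and R': "\<And>v. \<lbrakk>v \<in> carrier ?S; \<forall>i. ip ?S v (x i, y i) = 0\<rbrakk> \<Longrightarrow> R v = (- 1) \<odot>\<^bsub>?S\<^esub> v"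
    using S.reflection_exists[of "range (\<lambda>i. (x i, y i))"] x y by (force simp: hilbert_sum_simps)
  note Rs = bounded_opD[OF unitary_op_bounded[OF R(1)]]
  have "R (x i, \<zero>\<^bsub>H\<^esub>) = (\<zero>\<^bsub>H\<^esub>, y i)" for i
  proof -
    let ?u = "(x i, y i)" and ?v = "(x i, (- 1) \<odot>\<^bsub>H\<^esub> y i)"
    have uv: "?u \<in> carrier ?S" "?v \<in> carrier ?S" using x y by (auto simp: hilbert_sum_simps)
    have Rv: "R ?v = (- 1) \<odot>\<^bsub>?S\<^esub> ?v"
      using x y by (intro R') (auto simp: hilbert_sum_simps H.ip_simps gram)
    have "(x i, \<zero>\<^bsub>H\<^esub>) = ((1/2) \<odot>\<^bsub>?S\<^esub> ?u) \<oplus>\<^bsub>?S\<^esub> ((1/2) \<odot>\<^bsub>?S\<^esub> ?v)"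
      using x y by (auto simp: hilbert_sum_simps H.ip_simps intro!: H.ip_eqI)
    then have "R (x i, \<zero>\<^bsub>H\<^esub>) = ((1/2) \<odot>\<^bsub>?S\<^esub> ?u) \<oplus>\<^bsub>?S\<^esub> ((1/2) \<odot>\<^bsub>?S\<^esub> ((- 1) \<odot>\<^bsub>?S\<^esub> ?v))"
      using uv by (simp add: Rs R(2) Rv)
    also have "\<dots> = (\<zero>\<^bsub>H\<^esub>, y i)"
      using x y by (auto simp: hilbert_sum_simps H.ip_simps intro!: H.ip_eqI)
    finally show ?thesis .
  qed
  then show ?thesis
    using unitary_op_comp[OF S.hilbert_space_axioms unitary_op_swap[OF H] R(1)]
    by (intro exI[of _ "prod.swap \<circ> R"]) simp
qed

section \<open>Factorization of positive kernels\<close>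

text \<open>The index type is left free: \<open>nat\<close> serves for Gram vectors,
  \<open>int \<times> nat\<close> for Fourier coefficients on
  \<open>L2 \<otimes> H2\<close>.\<close>

definition ell2 :: "('i \<Rightarrow> complex) hilbert" where
  "ell2 = \<lparr>carrier = {x. (\<lambda>t. (cmod (x t))\<^sup>2) summable_on UNIV}, mult = undefined, one = undefined,
     zero = (\<lambda>t. 0), add = (\<lambda>x y t. x t + y t), smult = (\<lambda>c x t. c * x t),
     ip = (\<lambda>x y. \<Sum>\<^sub>\<infinity>t. x t * cnj (y t))\<rparr>"

lemma cmod_add_sq_le: "(cmod (a + b))\<^sup>2 \<le> 2 * (cmod a)\<^sup>2 + 2 * (cmod b)\<^sup>2"
proof -
  have "(cmod (a + b))\<^sup>2 \<le> (cmod a + cmod b)\<^sup>2"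
    by (intro power_mono norm_triangle_ineq) auto
  also have "\<dots> \<le> 2 * (cmod a)\<^sup>2 + 2 * (cmod b)\<^sup>2"
    using zero_le_power2[of "cmod a - cmod b"] by (simp add: power2_eq_square algebra_simps)
  finally show ?thesis .
qed

lemma summable_sq_add:
  fixes x y :: "'i \<Rightarrow> complex"
  assumes "(\<lambda>t. (cmod (x t))\<^sup>2) summable_on A" "(\<lambda>t. (cmod (y t))\<^sup>2) summable_on A"
  shows "(\<lambda>t. (cmod (x t + y t))\<^sup>2) summable_on A"
  by (rule summable_on_comparison_test[where f = "\<lambda>t. 2 * (cmod (x t))\<^sup>2 + 2 * (cmod (y t))\<^sup>2"])
    (use assms cmod_add_sq_le in \<open>auto intro!: summable_on_add summable_on_cmult_right\<close>)

lemma summable_sq_diff: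
  fixes x y :: "'i \<Rightarrow> complex"
  assumes "(\<lambda>t. (cmod (x t))\<^sup>2) summable_on A" "(\<lambda>t. (cmod (y t))\<^sup>2) summable_on A"
  shows "(\<lambda>t. (cmod (x t - y t))\<^sup>2) summable_on A"
  using summable_sq_add[of x A "\<lambda>t. - y t"] assms by simp

lemma summable_mult_cnj:
  fixes x y :: "'i \<Rightarrow> complex"
  assumes "(\<lambda>t. (cmod (x t))\<^sup>2) summable_on A" "(\<lambda>t. (cmod (y t))\<^sup>2) summable_on A"
  shows "(\<lambda>t. x t * cnj (y t)) summable_on A"
proof (rule abs_summable_summable, rule summable_on_comparison_test)
  show "(\<lambda>t. (cmod (x t))\<^sup>2 + (cmod (y t))\<^sup>2) summable_on A" by (intro summable_on_add assms)
  show "cmod (x t * cnj (y t)) \<le> (cmod (x t))\<^sup>2 + (cmod (y t))\<^sup>2" for t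
  proof -
    have "0 \<le> cmod (x t) * cmod (y t)" by simp
    then show ?thesis
      using sum_squares_bound[of "cmod (x t)" "cmod (y t)"] unfolding norm_mult complex_mod_cnj by linarith
  qed
qed auto

lemma abelian_group_ell2: "abelian_group ell2"
proof (rule abelian_groupI)
  fix x :: "'i \<Rightarrow> complex"
  assume x: "x \<in> carrier ell2"
  show "\<exists>y\<in>carrier ell2. y \<oplus>\<^bsub>ell2\<^esub> x = \<zero>\<^bsub>ell2\<^esub>"
    by (rule bexI[of _ "\<lambda>n. - x n"]) (use x in \<open>auto simp: ell2_def\<close>)
qed (auto simp: ell2_def summable_sq_add algebra_simps)

lemma ell2_minus:
  assumes "y \<in> carrier ell2"
  shows "x \<ominus>\<^bsub>ell2\<^esub> y = (\<lambda>t. x t - y t)"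
proof -
  interpret abelian_group ell2 by (rule abelian_group_ell2)
  have "\<ominus>\<^bsub>ell2\<^esub> y = (\<lambda>n. - y n)"
    by (rule minus_equality) (use assms in \<open>auto simp: ell2_def\<close>)
  then show ?thesis by (simp add: a_minus_def) (simp add: ell2_def)
qed

lemma ell2_ip_self: "ip ell2 x x = of_real (\<Sum>\<^sub>\<infinity>t. (cmod (x t))\<^sup>2)"
proof -
  have "ip ell2 x x = (\<Sum>\<^sub>\<infinity>t. of_real ((cmod (x t))\<^sup>2))"
    by (simp add: ell2_def complex_norm_square del: of_real_power)
  also have "\<dots> = of_real (\<Sum>\<^sub>\<infinity>t. (cmod (x t))\<^sup>2)"
    by (rule infsum_bounded_linear_strong[OF _ bounded_linear_of_real])
      (auto intro: summable_on_of_real dest: summable_on_Re simp del: of_real_power)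
  finally show ?thesis .
qed

lemma ell2_hnorm: "(hnorm ell2 x)\<^sup>2 = (\<Sum>\<^sub>\<infinity>t. (cmod (x t))\<^sup>2)"
  by (simp add: hnorm_def ell2_ip_self infsum_nonneg)

lemma hilbert_space_ell2: "hilbert_space (ell2 :: ('i \<Rightarrow> complex) hilbert)"
proof (intro hilbert_space.intro hilbert_space_axioms.intro)
  show "module complex_ring (ell2 :: ('i \<Rightarrow> complex) hilbert)"
    by (rule moduleI[OF cring_complex_ring abelian_group_ell2])
      (auto simp: complex_ring_def ell2_def algebra_simps norm_mult power_mult_distrib intro: summable_on_cmult_right)
next
  fix x y :: "'i \<Rightarrow> complex"
  have "(\<Sum>\<^sub>\<infinity>t. y t * cnj (x t)) = (\<Sum>\<^sub>\<infinity>t. cnj (x t * cnj (y t)))" by (simp add: mult.commute)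
  then show "ip ell2 y x = cnj (ip ell2 x y)" by (simp add: ell2_def del: complex_cnj_mult)
next
  fix x :: "'i \<Rightarrow> complex"
  assume x: "x \<in> carrier ell2"
  show "0 \<le> Re (ip ell2 x x)" by (simp add: ell2_ip_self infsum_nonneg)
  assume "ip ell2 x x = 0"
  then have "(\<Sum>\<^sub>\<infinity>t. (cmod (x t))\<^sup>2) \<le> 0" by (simp add: ell2_ip_self)
  then have "(cmod (x t))\<^sup>2 = 0" for t by (rule nonneg_infsum_le_0D) (use x in \<open>auto simp: ell2_def\<close>)
  then show "x = \<zero>\<^bsub>ell2\<^esub>" by (simp add: ell2_def fun_eq_iff)
next
  fix X :: "nat \<Rightarrow> 'i \<Rightarrow> complex"
  assume X: "\<And>n. X n \<in> carrier ell2"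
    and cauchy: "\<And>e. e > 0 \<Longrightarrow> \<exists>N. \<forall>m\<ge>N. \<forall>n\<ge>N. hnorm ell2 (X m \<ominus>\<^bsub>ell2\<^esub> X n) < e"
  interpret abelian_group ell2 by (rule abelian_group_ell2)
  have Xs: "(\<lambda>k. (cmod (X n k))\<^sup>2) summable_on UNIV" for n using X[of n] by (simp add: ell2_def)
  have part: "(\<Sum>k\<in>F. (cmod (X m k - X n k))\<^sup>2) \<le> (hnorm ell2 (X m \<ominus>\<^bsub>ell2\<^esub> X n))\<^sup>2" if "finite F" for m n F
    unfolding ell2_hnorm ell2_minus[OF X]
    using that by (intro finite_sum_le_infsum summable_sq_diff Xs) auto
  have n0: "0 \<le> hnorm ell2 x" for x :: "'i \<Rightarrow> complex"
    by (simp add: hnorm_def ell2_ip_self infsum_nonneg)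
  have pt: "cmod (X m k - X n k) \<le> hnorm ell2 (X m \<ominus>\<^bsub>ell2\<^esub> X n)" for m n k
    using part[of "{k}" m n] by (intro power2_le_imp_le[OF _ n0]) simp
  have "Cauchy (\<lambda>n. X n k)" for k
    unfolding Cauchy_def dist_norm using cauchy pt by (meson le_less_trans)
  then have "\<exists>l. (\<lambda>n. X n k) \<longlonglongrightarrow> l" for k using Cauchy_convergent convergent_def by blast
  then obtain x where x: "\<And>k. (\<lambda>n. X n k) \<longlonglongrightarrow> x k" by metis
  \<comment> \<open>The coordinatewise limit is a norm limit: finite partial sums pass to the limit
    in \<open>n\<close> with a bound that does not depend on the finite set.\<close>
  have close: "\<exists>N. \<forall>m\<ge>N. (\<lambda>k. (cmod (X m k - x k))\<^sup>2) summable_on UNIV \<and> (\<Sum>\<^sub>\<infinity>k. (cmod (X m k - x k))\<^sup>2) \<le> e\<^sup>2"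
    if e: "e > 0" for e
  proof -
    obtain N where N: "\<And>m n. \<lbrakk>m \<ge> N; n \<ge> N\<rbrakk> \<Longrightarrow> hnorm ell2 (X m \<ominus>\<^bsub>ell2\<^esub> X n) < e" using cauchy[OF e] by blast
    have "(\<lambda>k. (cmod (X m k - x k))\<^sup>2) summable_on UNIV \<and> (\<Sum>\<^sub>\<infinity>k. (cmod (X m k - x k))\<^sup>2) \<le> e\<^sup>2"
      if m: "m \<ge> N" for m
    proof -
      have le: "(\<Sum>k\<in>F. (cmod (X m k - x k))\<^sup>2) \<le> e\<^sup>2" if F: "finite F" for F
      proof (rule LIMSEQ_le_const2)
        show "(\<lambda>n. \<Sum>k\<in>F. (cmod (X m k - X n k))\<^sup>2) \<longlonglongrightarrow> (\<Sum>k\<in>F. (cmod (X m k - x k))\<^sup>2)"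
          by (intro tendsto_intros x)
        have "(\<Sum>k\<in>F. (cmod (X m k - X n k))\<^sup>2) \<le> e\<^sup>2" if "n \<ge> N" for n
        proof -
          have "(hnorm ell2 (X m \<ominus>\<^bsub>ell2\<^esub> X n))\<^sup>2 \<le> e\<^sup>2"
            using N[OF m that] n0 by (intro power_mono) auto
          then show ?thesis using part[OF F] order_trans by blast
        qed
        then show "\<exists>N. \<forall>n\<ge>N. (\<Sum>k\<in>F. (cmod (X m k - X n k))\<^sup>2) \<le> e\<^sup>2" by blast
      qed
      then have "(\<lambda>k. (cmod (X m k - x k))\<^sup>2) summable_on UNIV"
        by (intro nonneg_bdd_above_summable_on bdd_aboveI[of _ "e\<^sup>2"]) auto
      with le show ?thesis by (auto intro: infsum_le_finite_sums)
    qed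
    then show ?thesis by blast
  qed
  obtain N where "(\<lambda>k. (cmod (X N k - x k))\<^sup>2) summable_on UNIV" using close[of 1] by auto
  then have "(\<lambda>k. (cmod (X N k - (X N k - x k)))\<^sup>2) summable_on UNIV"
    by (rule summable_sq_diff[OF Xs])
  then have xc: "x \<in> carrier ell2" by (simp add: ell2_def)
  have "(\<lambda>n. hnorm ell2 (X n \<ominus>\<^bsub>ell2\<^esub> x)) \<longlonglongrightarrow> 0"
  proof (rule LIMSEQ_I)
    fix e :: real assume e: "e > 0"
    obtain N where N: "\<And>m. m \<ge> N \<Longrightarrow> (\<Sum>\<^sub>\<infinity>k. (cmod (X m k - x k))\<^sup>2) \<le> (e / 2)\<^sup>2"
      using close[of "e / 2"] e by auto
    have "norm (hnorm ell2 (X n \<ominus>\<^bsub>ell2\<^esub> x) - 0) < e" if n: "n \<ge> N" for n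
    proof -
      have "(hnorm ell2 (X n \<ominus>\<^bsub>ell2\<^esub> x))\<^sup>2 \<le> (e / 2)\<^sup>2"
        unfolding ell2_hnorm ell2_minus[OF xc] using N[OF n] .
      then have "\<bar>hnorm ell2 (X n \<ominus>\<^bsub>ell2\<^esub> x)\<bar> \<le> \<bar>e / 2\<bar>" by (simp only: abs_le_square_iff)
      then show ?thesis using e by simp
    qed
    then show "\<exists>N. \<forall>n\<ge>N. norm (hnorm ell2 (X n \<ominus>\<^bsub>ell2\<^esub> x) - 0) < e" by blast
  qed
  with xc show "\<exists>x\<in>carrier ell2. (\<lambda>n. hnorm ell2 (X n \<ominus>\<^bsub>ell2\<^esub> x)) \<longlonglongrightarrow> 0" by blast
next
  fix x y z :: "'i \<Rightarrow> complex"
  assume "x \<in> carrier ell2" "y \<in> carrier ell2" "z \<in> carrier ell2"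
  then have "(\<lambda>n. x n * cnj (z n)) summable_on UNIV" "(\<lambda>n. y n * cnj (z n)) summable_on UNIV"
    by (auto simp: ell2_def intro: summable_mult_cnj)
  then show "ip ell2 (x \<oplus>\<^bsub>ell2\<^esub> y) z = ip ell2 x z + ip ell2 y z"
    by (simp add: ell2_def distrib_right infsum_add)
next
  fix c and x y :: "'i \<Rightarrow> complex"
  show "ip ell2 (c \<odot>\<^bsub>ell2\<^esub> x) y = c * ip ell2 x y"
    by (simp add: ell2_def mult.assoc infsum_cmult_right')
qed

section \<open>Positive kernels on the natural numbers and their Cholesky factorization\<close>

definition kernel_form :: "nat \<Rightarrow> (nat \<Rightarrow> nat \<Rightarrow> complex) \<Rightarrow> (nat \<Rightarrow> complex) \<Rightarrow> complex" where
  "kernel_form N K c = (\<Sum>i<N. \<Sum>j<N. c i * cnj (c j) * K i j)"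

definition psd_kernel :: "(nat \<Rightarrow> nat \<Rightarrow> complex) \<Rightarrow> bool" where
  "psd_kernel K \<longleftrightarrow> (\<forall>i j. K j i = cnj (K i j)) \<and> (\<forall>N c. 0 \<le> Re (kernel_form N K c))"

text \<open>Changing one coordinate gives a quadratic in \<open>t\<close>. Suitable choices of
  \<open>t\<close> yield the vanishing of rows with zero pivot and the positivity of Schur
  complements.\<close>

lemma kernel_form_upd:
  assumes K: "\<And>i j. K j i = cnj (K i j)" and n: "n < N"
  shows "Re (kernel_form N K (c(n := c n + t)))
    = Re (kernel_form N K c) + 2 * Re (cnj t * (\<Sum>i<N. c i * K i n)) + (cmod t)\<^sup>2 * Re (K n n)"
proof -
  define d where "d i = (if i = n then t else 0)" for i
  have c: "c(n := c n + t) = (\<lambda>i. c i + d i)" by (auto simp: d_def)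
  have del: "(\<Sum>i<N. d i * f i) = t * f n" "(\<Sum>i<N. cnj (d i) * f i) = cnj t * f n" for f
    using n by (simp_all add: d_def if_distrib[of "\<lambda>x. x * _"] if_distrib[of cnj] cong: if_cong)
  have 1: "(\<Sum>i<N. \<Sum>j<N. c i * cnj (d j) * K i j) = cnj t * (\<Sum>i<N. c i * K i n)"
  proof -
    have "(\<Sum>j<N. c i * cnj (d j) * K i j) = cnj t * (c i * K i n)" for i
      using del(2)[of "\<lambda>j. c i * K i j"] by (simp add: algebra_simps)
    then show ?thesis by (simp add: sum_distrib_left)
  qed
  have 2: "(\<Sum>i<N. \<Sum>j<N. d i * cnj (c j) * K i j) = t * (\<Sum>j<N. cnj (c j) * K n j)"
    using del(1)[of "\<lambda>i. \<Sum>j<N. cnj (c j) * K i j"] by (simp add: sum_distrib_left mult.assoc)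
  have 3: "(\<Sum>i<N. \<Sum>j<N. d i * cnj (d j) * K i j) = t * (cnj t * K n n)"
    using del(1)[of "\<lambda>i. \<Sum>j<N. cnj (d j) * K i j"] unfolding del(2)
    by (simp add: mult.assoc del(2) flip: sum_distrib_left)
  define w where "w = cnj t * (\<Sum>i<N. c i * K i n)"
  have 4: "t * (\<Sum>j<N. cnj (c j) * K n j) = cnj w"
    using K[of _ n] by (simp add: w_def)
  have 5: "t * (cnj t * K n n) = of_real ((cmod t)\<^sup>2) * K n n"
    unfolding complex_norm_square by simp
  have "kernel_form N K (\<lambda>i. c i + d i) = kernel_form N K c + (\<Sum>i<N. \<Sum>j<N. c i * cnj (d j) * K i j)
      + (\<Sum>i<N. \<Sum>j<N. d i * cnj (c j) * K i j) + (\<Sum>i<N. \<Sum>j<N. d i * cnj (d j) * K i j)"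
    unfolding kernel_form_def by (simp add: sum.distrib[symmetric] algebra_simps)
  then show ?thesis
    unfolding c 1 2 3 4 5 w_def[symmetric] by (simp del: of_real_power)
qed

lemma kernel_form_extend:
  assumes "N \<le> M"
  shows "kernel_form N K c = kernel_form M K (\<lambda>i. if i < N then c i else 0)"
proof -
  let ?c = "\<lambda>i. if i < N then c i else 0"
  have "kernel_form M K ?c = (\<Sum>i<N. \<Sum>j<M. ?c i * cnj (?c j) * K i j)"
    unfolding kernel_form_def using assms by (intro sum.mono_neutral_right) auto
  also have "\<dots> = (\<Sum>i<N. \<Sum>j<N. ?c i * cnj (?c j) * K i j)"
    using assms by (intro sum.cong refl sum.mono_neutral_right) auto
  also have "\<dots> = kernel_form N K c" unfolding kernel_form_def by (intro sum.cong) auto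
  finally show ?thesis by simp
qed

lemma psd_kernelD:
  assumes "psd_kernel K"
  shows "K j i = cnj (K i j)" "0 \<le> Re (kernel_form N K c)"
  using assms unfolding psd_kernel_def by blast+

lemma psd_kernel_diag:
  assumes "psd_kernel K"
  shows "K n n = of_real (Re (K n n))" "0 \<le> Re (K n n)"
proof -
  have K: "\<And>i j. K j i = cnj (K i j)" using psd_kernelD[OF assms] by blast
  show "K n n = of_real (Re (K n n))" using K[of n n] by (simp add: complex_eq_iff)
  have "Re (kernel_form (Suc n) K ((\<lambda>i. 0)(n := 0 + 1))) = Re (K n n)"
    by (subst kernel_form_upd[OF K]) (auto simp: kernel_form_def)
  then show "0 \<le> Re (K n n)" using psd_kernelD(2)[OF assms] by metis
qed

text \<open>With \<open>K n n = 0\<close> the form at \<open>e + t e_n\<close>, where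
  \<open>e\<close> is the unit vector at \<open>j\<close>, is affine in \<open>t\<close>, and an
  affine function bounded below is constant.\<close>

lemma psd_kernel_zero_row:
  assumes "psd_kernel K" and 0: "K n n = 0"
  shows "K j n = 0"
proof (cases "j = n")
  case False
  have K: "\<And>i j. K j i = cnj (K i j)" using psd_kernelD[OF assms(1)] by blast
  define N where "N = Suc (max j n)"
  have jn: "j < N" "n < N" by (auto simp: N_def)
  define e where "e i = (if i = j then 1 else 0 :: complex)" for i
  have s: "(\<Sum>i<N. e i * f i) = f j" for f
    using jn by (simp add: e_def if_distrib[of "\<lambda>x. x * _"] cong: if_cong)
  have se: "(\<Sum>i<N. e i * K i n) = K j n" using s .
  have le: "0 \<le> Re (kernel_form N K e) + 2 * Re (cnj t * K j n)" for t
  proof -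
    have "0 \<le> Re (kernel_form N K (e(n := e n + t)))" using psd_kernelD(2)[OF assms(1)] .
    then show ?thesis by (subst (asm) kernel_form_upd[OF K jn(2)]) (simp add: se 0)
  qed
  let ?q = "Re (kernel_form N K e)"
  have "?q \<ge> 0" using psd_kernelD(2)[OF assms(1)] .
  have "(cmod (K j n))\<^sup>2 = 0"
  proof (rule ccontr)
    assume *: "(cmod (K j n))\<^sup>2 \<noteq> 0"
    \<comment> \<open>Chosen so that the slope term becomes \<open>- 2 (?q + 1)\<close>, which
      outweighs \<open>?q\<close>.\<close>
    define r where "r = (?q + 1) / (cmod (K j n))\<^sup>2"
    have "cnj (- of_real r * K j n) * K j n = - of_real r * of_real ((cmod (K j n))\<^sup>2)"
      unfolding complex_norm_square by simp
    then have "Re (cnj (- of_real r * K j n) * K j n) = - r * (cmod (K j n))\<^sup>2"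
      by (metis Re_complex_of_real of_real_minus of_real_mult)
    also have "\<dots> = - (?q + 1)" using * by (simp add: r_def)
    finally show False using le[of "- of_real r * K j n"] \<open>?q \<ge> 0\<close> by simp
  qed
  then show ?thesis by simp
qed (use 0 in simp)

text \<open>One elimination step with pivot \<open>K n n\<close>. If the pivot is 0, division by
  zero leaves \<open>K\<close> unchanged; for a positive kernel this is right, because row
  \<open>n\<close> is already zero by \<open>psd_kernel_zero_row\<close>.\<close>

definition schur_complement :: "(nat \<Rightarrow> nat \<Rightarrow> complex) \<Rightarrow> nat \<Rightarrow> nat \<Rightarrow> nat \<Rightarrow> complex" where
  "schur_complement K n i j = K i j - K i n * K n j / K n n"

lemma schur_complement_zero:
  assumes K: "psd_kernel K"
  shows "schur_complement K n n j = 0"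
proof (cases "K n n = 0")
  case True
  then have "K j n = 0" by (rule psd_kernel_zero_row[OF K])
  then have "K n j = 0" using psd_kernelD(1)[OF K, of n j] by simp
  then show ?thesis by (simp add: schur_complement_def)
qed (simp add: schur_complement_def)

text \<open>For a nonzero pivot \<open>k\<close>, the form of the complement at \<open>b\<close> is
  the value of the form of \<open>K\<close> after coordinate \<open>n\<close> of \<open>b\<close> is
  changed by the minimising \<open>t = - u / k\<close>.\<close>

lemma psd_schur_complement:
  assumes psd: "psd_kernel K"
  shows "psd_kernel (schur_complement K n)"
  unfolding psd_kernel_def
proof (intro conjI allI)
  have K: "\<And>i j. K j i = cnj (K i j)" using psd_kernelD[OF psd] by blast
  obtain d where d: "K n n = of_real d" using psd_kernel_diag(1)[OF psd] by blast
  show "schur_complement K n j i = cnj (schur_complement K n i j)" for i j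
    unfolding schur_complement_def K[of i j] K[of n i] K[of j n] d by (simp add: mult.commute)
  fix N and c :: "nat \<Rightarrow> complex"
  \<comment> \<open>Coordinate \<open>n\<close> has to be in range in order to be varied, so
    \<open>c\<close> is padded by zeros up to \<open>M\<close>.\<close>
  define M where "M = Suc (max N n)"
  define b where "b i = (if i < N then c i else 0)" for i
  define u where "u = (\<Sum>i<M. b i * K i n)"
  define k where "k = Re (K n n)"
  have k: "K n n = of_real k" using psd_kernel_diag[OF psd] by (simp add: k_def)
  have nM: "n < M" by (simp add: M_def)
  have u': "(\<Sum>j<M. cnj (b j) * K n j) = cnj u" using K[of _ n] by (simp add: u_def)
  have *: "kernel_form M (schur_complement K n) b = kernel_form M K b - u * cnj u / K n n"
  proof -
    have "kernel_form M (schur_complement K n) b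
        = kernel_form M K b - (\<Sum>i<M. \<Sum>j<M. (b i * K i n) * (cnj (b j) * K n j)) / K n n"
      unfolding kernel_form_def schur_complement_def
      by (simp add: sum_subtractf[symmetric] sum_divide_distrib algebra_simps)
    also have "(\<Sum>i<M. \<Sum>j<M. (b i * K i n) * (cnj (b j) * K n j)) = u * cnj u"
    proof -
      have "(\<Sum>i<M. \<Sum>j<M. (b i * K i n) * (cnj (b j) * K n j)) = u * (\<Sum>j<M. cnj (b j) * K n j)"
        by (simp add: u_def sum_product)
      then show ?thesis by (simp only: u')
    qed
    finally show ?thesis .
  qed
  have "0 \<le> Re (kernel_form M (schur_complement K n) b)"
  proof (cases "k = 0")
    case True
    then show ?thesis using * k psd_kernelD(2)[OF psd, of M b] by simp
  next
    case False
    define t where "t = - u / of_real k"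
    have uu: "u * cnj u = of_real ((cmod u)\<^sup>2)" unfolding complex_norm_square by simp
    have "cnj t * u = of_real (- (cmod u)\<^sup>2 / k)" unfolding t_def by (simp add: mult.commute[of "cnj u"] uu)
    then have 1: "Re (cnj t * u) = - (cmod u)\<^sup>2 / k" by simp
    have 2: "(cmod t)\<^sup>2 * k = (cmod u)\<^sup>2 / k"
      using False by (simp add: t_def norm_divide power_divide power2_eq_square)
    have "0 \<le> Re (kernel_form M K (b(n := b n + t)))" using psd_kernelD(2)[OF psd] .
    also have "\<dots> = Re (kernel_form M K b) - (cmod u)\<^sup>2 / k"
    proof -
      have "Re (kernel_form M K (b(n := b n + t))) = Re (kernel_form M K b) + 2 * Re (cnj t * u) + (cmod t)\<^sup>2 * k"
        unfolding u_def k_def by (rule kernel_form_upd[OF K nM])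
      then show ?thesis unfolding 1 2 by simp
    qed
    also have "u * cnj u / K n n = of_real ((cmod u)\<^sup>2 / k)" by (simp add: k uu)
    then have "Re (kernel_form M K b) - (cmod u)\<^sup>2 / k = Re (kernel_form M (schur_complement K n) b)"
      unfolding * by simp
    finally show ?thesis .
  qed
  then show "0 \<le> Re (kernel_form N (schur_complement K n) c)"
    unfolding b_def by (subst kernel_form_extend[of N M]) (auto simp: M_def)
qed

primrec cholesky_remainder :: "(nat \<Rightarrow> nat \<Rightarrow> complex) \<Rightarrow> nat \<Rightarrow> nat \<Rightarrow> nat \<Rightarrow> complex" where
  "cholesky_remainder K 0 = K"
| "cholesky_remainder K (Suc n) = schur_complement (cholesky_remainder K n) n"

text \<open>Column \<open>n\<close> of the factor is the pivot column of the remainder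
  \<open>n\<close>, divided by the square root of the pivot (and zero for a zero pivot). Remainder
  \<open>n\<close> vanishes in the rows before \<open>n\<close>, so \<open>v i\<close> is supported
  in \<open>{..i}\<close> and no convergence question arises.\<close>

lemma psd_kernel_factorization:
  assumes psd: "psd_kernel K"
  shows "\<exists>v :: nat \<Rightarrow> nat \<Rightarrow> complex. (\<forall>i. v i \<in> carrier ell2) \<and> (\<forall>i j. ip ell2 (v i) (v j) = K i j)"
proof -
  define R where "R = cholesky_remainder K"
  have R: "psd_kernel (R n)" for n
    by (induction n) (simp_all add: R_def psd psd_schur_complement)
  have herm: "R n j i = cnj (R n i j)" for n i j using psd_kernelD[OF R[of n]] by blast
  have RS: "R (Suc n) i j = R n i j - R n i n * R n n j / R n n n" for n i j
    by (simp add: R_def schur_complement_def)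
  have zero: "R n i j = 0" if "i < n" for n i j
    using that
  proof (induction n arbitrary: j)
    case (Suc n)
    show ?case
    proof (cases "i = n")
      case True
      then show ?thesis using schur_complement_zero[OF R[of n], of n j] by (simp add: R_def)
    next
      case False
      then show ?thesis using Suc by (simp add: RS)
    qed
  qed simp
  define v where "v i n = R n i n / of_real (sqrt (Re (R n n n)))" for i n
  have vv: "v i n * cnj (v j n) = R n i n * R n n j / R n n n" for i j n
  proof -
    have "v i n * cnj (v j n) = R n i n * R n n j / of_real (sqrt (Re (R n n n)) * sqrt (Re (R n n n)))"
      by (simp add: v_def herm[of n j n] del: real_sqrt_mult_self)
    also have "\<dots> = R n i n * R n n j / R n n n"
    proof -
      have "complex_of_real (sqrt (Re (R n n n)) * sqrt (Re (R n n n))) = R n n n"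
        using psd_kernel_diag[OF R, of n n] by (simp only: real_sqrt_mult_self abs_of_nonneg)
      then show ?thesis by (simp only:)
    qed
    finally show ?thesis .
  qed
  have sum: "K i j = (\<Sum>n<N. v i n * cnj (v j n)) + R N i j" for i j N
    by (induction N) (simp_all add: vv RS, simp add: R_def)
  have v0: "v i n = 0" if "n \<notin> {..i}" for i n using zero[of i n n] that by (simp add: v_def)
  have "(\<lambda>n. (cmod (v i n))\<^sup>2) summable_on UNIV" for i
    by (rule finite_nonzero_values_imp_summable_on, rule finite_subset[of _ "{..i}"]) (use v0[of _ i] in auto)
  then have "v i \<in> carrier ell2" for i by (simp add: ell2_def)
  moreover have "ip ell2 (v i) (v j) = K i j" for i j
  proof -
    have "ip ell2 (v i) (v j) = (\<Sum>n<Suc i. v i n * cnj (v j n))"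
    proof -
      have "(\<Sum>\<^sub>\<infinity>n. v i n * cnj (v j n)) = (\<Sum>\<^sub>\<infinity>n\<in>{..<Suc i}. v i n * cnj (v j n))"
        by (rule infsum_cong_neutral) (use v0[of _ i] in auto)
      then show ?thesis by (simp add: ell2_def)
    qed
    also have "\<dots> = K i j" using sum[of i j "Suc i"] zero[of i "Suc i" j] by simp
    finally show ?thesis .
  qed
  ultimately show ?thesis by blast
qed

section \<open>Power series on the bidisc\<close>

text \<open>\<open>g\<close> is controlled only on the open disc, so the Cauchy inequality is
  applied at radii \<open>r m < 1\<close>, which tend to 1.\<close>

lemma taylor_coeff_bound:
  assumes g: "g holomorphic_on ball 0 1" and b: "\<And>z. cmod z < 1 \<Longrightarrow> cmod (g z) \<le> 1"
  shows "cmod ((deriv ^^ n) g 0 / fact n) \<le> 1"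
proof -
  let ?c = "cmod ((deriv ^^ n) g 0 / fact n)"
  define r where "r m = 1 - inverse (real (Suc (Suc m)))" for m
  have r: "0 < r m" "r m < 1" for m by (simp_all add: r_def field_simps)
  have "?c * r m ^ n \<le> 1" for m
  proof -
    have "cmod ((deriv ^^ n) g 0) \<le> fact n * 1 / r m ^ n"
    proof (rule Cauchy_inequality)
      show "g holomorphic_on ball 0 (r m)" using r[of m] by (intro holomorphic_on_subset[OF g]) auto
      show "continuous_on (cball 0 (r m)) g"
        using r[of m] by (intro continuous_on_subset[OF holomorphic_on_imp_continuous_on[OF g]]) auto
    qed (use r[of m] b in auto)
    then show ?thesis using r[of m] by (simp add: norm_divide field_simps)
  qed
  moreover have "(\<lambda>m. ?c * r m ^ n) \<longlonglongrightarrow> ?c * (1 - 0) ^ n"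
    unfolding r_def by (intro tendsto_intros LIMSEQ_Suc[OF LIMSEQ_inverse_real_of_nat])
  ultimately have "?c * (1 - 0) ^ n \<le> 1" by (intro LIMSEQ_le_const2) auto
  then show ?thesis by simp
qed

lemma has_sum_double_geometric:
  fixes u v :: "'a :: {real_normed_field, banach}"
  assumes "norm u < 1" "norm v < 1"
  shows "((\<lambda>(p, q). u ^ p * v ^ q) has_sum (1 / ((1 - u) * (1 - v)))) UNIV"
    and "(\<lambda>(p, q). norm u ^ p * norm v ^ q) summable_on UNIV"
proof -
  have geo: "((\<lambda>q. u ^ q) has_sum (1 / (1 - u))) UNIV" if "norm u < 1" for u :: "'b :: {real_normed_field, banach}"
    using that by (intro norm_summable_imp_has_sum geometric_sums) (simp add: norm_power)
  have "(\<lambda>(p, q). norm u ^ p * norm v ^ q) summable_on (UNIV \<times> UNIV)"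
  proof (rule summable_on_SigmaI)
    show "((\<lambda>q. case (p, q) of (p, q) \<Rightarrow> norm u ^ p * norm v ^ q) has_sum (norm u ^ p * (1 / (1 - norm v)))) UNIV" for p
      unfolding prod.case using assms by (intro has_sum_cmult_right geo) auto
    show "(\<lambda>p. norm u ^ p * (1 / (1 - norm v))) summable_on UNIV"
      using geo[of "norm u"] assms by (intro summable_on_cmult_left) (auto simp: has_sum_iff)
  qed auto
  then show s: "(\<lambda>(p, q). norm u ^ p * norm v ^ q) summable_on UNIV" by simp
  have "(\<lambda>(p, q). u ^ p * v ^ q) summable_on UNIV"
    by (rule abs_summable_summable) (use s in \<open>simp add: case_prod_unfold norm_mult norm_power\<close>)
  then have "((\<lambda>(p, q). u ^ p * v ^ q) has_sum (1 / (1 - u) * (1 / (1 - v)))) (UNIV \<times> UNIV)"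
  proof (intro has_sum_SigmaI[where g = "\<lambda>p. u ^ p * (1 / (1 - v))"])
    show "((\<lambda>q. case (p, q) of (p, q) \<Rightarrow> u ^ p * v ^ q) has_sum (u ^ p * (1 / (1 - v)))) UNIV" for p
      unfolding prod.case by (intro has_sum_cmult_right geo assms)
    show "((\<lambda>p. u ^ p * (1 / (1 - v))) has_sum (1 / (1 - u) * (1 / (1 - v)))) UNIV"
      by (intro has_sum_cmult_left geo assms)
  qed simp
  then show "((\<lambda>(p, q). u ^ p * v ^ q) has_sum (1 / ((1 - u) * (1 - v)))) UNIV" by simp
qed

text \<open>Expansion in \<open>z\<close> with coefficients \<open>\<alpha> p w\<close>, followed by
  expansion of these in \<open>w\<close>. The hypotheses give holomorphy in each variable
  separately, so holomorphy of \<open>\<alpha> p\<close> is the point to prove; the coefficient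
  bounds make the double series absolutely convergent.\<close>

lemma bidisc_power_series:
  fixes f :: "complex \<Rightarrow> complex \<Rightarrow> complex"
  assumes hz: "\<And>w. cmod w < 1 \<Longrightarrow> (\<lambda>z. f z w) holomorphic_on ball 0 1"
    and hw: "\<And>z. cmod z < 1 \<Longrightarrow> f z holomorphic_on ball 0 1"
    and bd: "\<And>z w. \<lbrakk>cmod z < 1; cmod w < 1\<rbrakk> \<Longrightarrow> cmod (f z w) \<le> 1"
  obtains a :: "nat \<Rightarrow> nat \<Rightarrow> complex" where "\<And>p q. cmod (a p q) \<le> 1"
    "\<And>z w. \<lbrakk>cmod z < 1; cmod w < 1\<rbrakk> \<Longrightarrow> ((\<lambda>(p, q). a p q * z ^ p * w ^ q) has_sum f z w) UNIV"
proof -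
  define \<alpha> where "\<alpha> p w = (deriv ^^ p) (\<lambda>z. f z w) 0 / fact p" for p w
  have \<alpha>b: "cmod (\<alpha> p w) \<le> 1" if "cmod w < 1" for p w
    unfolding \<alpha>_def using that hz bd by (intro taylor_coeff_bound) auto
  have \<alpha>s: "(\<lambda>p. \<alpha> p w * z ^ p) sums f z w" if "cmod z < 1" "cmod w < 1" for z w
    using holomorphic_power_series[OF hz[OF that(2)], of z] that by (simp add: \<alpha>_def)
  define x where "x m = inverse (real (Suc (Suc m)))" for m
  have x: "0 < x m" "x m < 1" for m by (simp_all add: x_def field_simps)
  have x0: "(\<lambda>m. x m / (1 - x m)) \<longlonglongrightarrow> 0 / (1 - 0)"
    unfolding x_def by (intro tendsto_intros LIMSEQ_Suc[OF LIMSEQ_inverse_real_of_nat]) auto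
  text \<open>The \<open>p\<close>-th coefficient is the uniform limit of the \<open>p\<close>-th divided remainders at \<open>x\<^sub>m \<rightarrow> 0\<close>.\<close>
  have \<alpha>h: "\<alpha> p holomorphic_on ball 0 1" for p
  proof (induction p rule: less_induct)
    case (less p)
    define g where "g m w = (f (of_real (x m)) w - (\<Sum>l<p. \<alpha> l w * of_real (x m) ^ l)) / of_real (x m) ^ p" for m w
    have gh: "g m holomorphic_on ball 0 1" for m
      unfolding g_def using x[of m] less by (intro holomorphic_intros hw) auto
    \<comment> \<open>The tail from index \<open>Suc p\<close> on is dominated by a geometric
      series, and division by \<open>x m ^ p\<close> leaves one factor \<open>x m\<close>.\<close>
    have gb: "cmod (g m w - \<alpha> p w) \<le> x m / (1 - x m)" if w: "cmod w < 1" for m w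
    proof -
      let ?z = "complex_of_real (x m)"
      have "(\<lambda>l. \<alpha> (l + Suc p) w * ?z ^ (l + Suc p)) sums (f ?z w - (\<Sum>l<Suc p. \<alpha> l w * ?z ^ l))"
        using \<alpha>s[of ?z w] w x[of m] by (intro sums_split_initial_segment) auto
      moreover have "(\<lambda>l. x m ^ Suc p * x m ^ l) sums (x m ^ Suc p * (1 / (1 - x m)))"
        using x[of m] by (intro sums_mult geometric_sums) auto
      moreover have "cmod (\<alpha> (l + Suc p) w * ?z ^ (l + Suc p)) \<le> x m ^ Suc p * x m ^ l" for l
        using \<alpha>b[OF w, of "l + Suc p"] x[of m]
        by (simp add: norm_mult norm_power power_add mult_left_le_one_le mult.assoc mult.commute)
      ultimately have "cmod (f ?z w - (\<Sum>l<Suc p. \<alpha> l w * ?z ^ l)) \<le> x m ^ Suc p * (1 / (1 - x m))"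
        by (metis (no_types, lifting) sums_unique suminf_le norm_suminf_le sums_summable)
      moreover have "g m w - \<alpha> p w = (f ?z w - (\<Sum>l<Suc p. \<alpha> l w * ?z ^ l)) / ?z ^ p"
        using x[of m] by (simp add: g_def field_simps)
      ultimately have "cmod (g m w - \<alpha> p w) \<le> x m ^ Suc p * (1 / (1 - x m)) / x m ^ p"
      proof -
        assume 1: "cmod (f ?z w - (\<Sum>l<Suc p. \<alpha> l w * ?z ^ l)) \<le> x m ^ Suc p * (1 / (1 - x m))"
          and 2: "g m w - \<alpha> p w = (f ?z w - (\<Sum>l<Suc p. \<alpha> l w * ?z ^ l)) / ?z ^ p"
        show ?thesis
          unfolding 2 norm_divide using divide_right_mono[OF 1, of "x m ^ p"] x[of m] by (simp add: norm_power)
      qed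
      also have "\<dots> = x m / (1 - x m)" using x[of m] by (simp add: field_simps)
      finally show ?thesis .
    qed
    show ?case
    proof (rule holomorphic_uniform_sequence[OF open_ball gh])
      fix w :: complex assume w: "w \<in> ball 0 1"
      have sub: "cball w ((1 - cmod w) / 2) \<subseteq> ball 0 1"
      proof
        fix v assume v: "v \<in> cball w ((1 - cmod w) / 2)"
        then have "cmod v \<le> cmod w + (1 - cmod w) / 2"
        proof -
          have "cmod (v - w) \<le> (1 - cmod w) / 2" using v by (simp add: dist_norm norm_minus_commute)
          moreover have "cmod v \<le> cmod w + cmod (v - w)" using norm_triangle_ineq[of w "v - w"] by simp
          ultimately show ?thesis by linarith
        qed
        then show "v \<in> ball 0 1" using w by (simp add: field_simps)
      qed
      have "uniform_limit (cball w ((1 - cmod w) / 2)) g (\<alpha> p) sequentially"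
      proof (rule uniform_limitI)
        fix e :: real assume "e > 0"
        then have "eventually (\<lambda>m. x m / (1 - x m) < e) sequentially"
          using x0 by (intro order_tendstoD(2)[where y = "0 / (1 - 0)"]) auto
        then show "\<forall>\<^sub>F m in sequentially. \<forall>v\<in>cball w ((1 - cmod w) / 2). dist (g m v) (\<alpha> p v) < e"
        proof eventually_elim
          case (elim m)
          show ?case
          proof
            fix v assume "v \<in> cball w ((1 - cmod w) / 2)"
            then have "cmod v < 1" using sub by auto
            then show "dist (g m v) (\<alpha> p v) < e" using gb[of v m] elim by (simp add: dist_norm)
          qed
        qed
      qed
      with w sub show "\<exists>d. 0 < d \<and> cball w d \<subseteq> ball 0 1 \<and> uniform_limit (cball w d) g (\<alpha> p) sequentially"
        by (intro exI[of _ "(1 - cmod w) / 2"]) auto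
    qed
  qed
  define a where "a p q = (deriv ^^ q) (\<alpha> p) 0 / fact q" for p q
  have ab: "cmod (a p q) \<le> 1" for p q
    unfolding a_def using \<alpha>h \<alpha>b by (intro taylor_coeff_bound) auto
  have as: "(\<lambda>q. a p q * w ^ q) sums \<alpha> p w" if "cmod w < 1" for p w
    using holomorphic_power_series[OF \<alpha>h, of w p] that by (simp add: a_def)
  have "((\<lambda>(p, q). a p q * z ^ p * w ^ q) has_sum f z w) UNIV" if zw: "cmod z < 1" "cmod w < 1" for z w
  proof -
    have "(\<lambda>(p, q). cmod z ^ p * cmod w ^ q) summable_on (UNIV \<times> UNIV)"
      using has_sum_double_geometric(2)[OF zw] by simp
    then have "(\<lambda>t. cmod (case t of (p, q) \<Rightarrow> a p q * z ^ p * w ^ q)) summable_on (UNIV \<times> UNIV)"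
      by (rule summable_on_comparison_test)
        (use ab in \<open>auto simp: norm_mult norm_power mult.assoc intro!: mult_left_le_one_le\<close>)
    then have summ: "(\<lambda>(p, q). a p q * z ^ p * w ^ q) summable_on (UNIV \<times> UNIV)"
      by (rule abs_summable_summable)
    have "((\<lambda>(p, q). a p q * z ^ p * w ^ q) has_sum f z w) (UNIV \<times> UNIV)"
    proof (rule has_sum_SigmaI[OF _ _ summ])
      have le1: "cmod (c * w ^ q) \<le> cmod w ^ q" if "cmod c \<le> 1" for c w :: complex and q
        using that mult_right_mono[of "cmod c" 1 "cmod w ^ q"] by (simp add: norm_mult norm_power)
      have "((\<lambda>q. a p q * w ^ q) has_sum \<alpha> p w) UNIV" for p
      proof (rule norm_summable_imp_has_sum[OF _ as[OF zw(2)]])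
        show "summable (\<lambda>q. cmod (a p q * w ^ q))"
          by (rule summable_comparison_test[OF _ summable_geometric[of "cmod w"]]) (use zw ab le1 in auto)
      qed
      then have "((\<lambda>q. z ^ p * (a p q * w ^ q)) has_sum (z ^ p * \<alpha> p w)) UNIV" for p
        by (intro has_sum_cmult_right)
      then show "((\<lambda>q. case (p, q) of (p, q) \<Rightarrow> a p q * z ^ p * w ^ q) has_sum (\<alpha> p w * z ^ p)) UNIV" for p
        by (simp add: algebra_simps)
      show "((\<lambda>p. \<alpha> p w * z ^ p) has_sum f z w) UNIV"
      proof (rule norm_summable_imp_has_sum[OF _ \<alpha>s[OF zw]])
        show "summable (\<lambda>p. cmod (\<alpha> p w * z ^ p))"
          by (rule summable_comparison_test[OF _ summable_geometric[of "cmod z"]]) (use zw \<alpha>b le1 in auto)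
      qed
    qed
    then show ?thesis by simp
  qed
  with ab that show ?thesis by blast
qed

section \<open>Shorted forms\<close>

text \<open>The form may be degenerate and \<open>V\<close> incomplete for it, so orthogonal
  projections are replaced below by minimising sequences.\<close>

locale semi_inner =
  fixes V :: "('i \<Rightarrow> complex) set" and Q :: "('i \<Rightarrow> complex) \<Rightarrow> ('i \<Rightarrow> complex) \<Rightarrow> complex"
  assumes V_zero: "(\<lambda>t. 0) \<in> V"
    and V_add: "\<lbrakk>x \<in> V; y \<in> V\<rbrakk> \<Longrightarrow> (\<lambda>t. x t + y t) \<in> V"
    and V_scale: "x \<in> V \<Longrightarrow> (\<lambda>t. c * x t) \<in> V"
    and Q_add: "\<lbrakk>x \<in> V; y \<in> V; z \<in> V\<rbrakk> \<Longrightarrow> Q (\<lambda>t. x t + y t) z = Q x z + Q y z"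
    and Q_scale: "\<lbrakk>x \<in> V; z \<in> V\<rbrakk> \<Longrightarrow> Q (\<lambda>t. c * x t) z = c * Q x z"
    and Q_cnj: "\<lbrakk>x \<in> V; y \<in> V\<rbrakk> \<Longrightarrow> Q y x = cnj (Q x y)"
    and Q_nonneg: "x \<in> V \<Longrightarrow> 0 \<le> Re (Q x x)"
begin

lemma Q_add_right: "\<lbrakk>x \<in> V; y \<in> V; z \<in> V\<rbrakk> \<Longrightarrow> Q z (\<lambda>t. x t + y t) = Q z x + Q z y"
  using Q_add[of x y z] Q_cnj V_add by (metis complex_cnj_add)

lemma Q_scale_right: "\<lbrakk>x \<in> V; z \<in> V\<rbrakk> \<Longrightarrow> Q z (\<lambda>t. c * x t) = cnj c * Q z x"
  using Q_scale[of x z c] Q_cnj V_scale by (metis complex_cnj_mult)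

lemma V_sum: "(\<And>i. i < (N::nat) \<Longrightarrow> x i \<in> V) \<Longrightarrow> (\<lambda>t. \<Sum>i<N. c i * x i t) \<in> V"
proof (induction N)
  case (Suc N)
  then have "(\<lambda>t. (\<Sum>i<N. c i * x i t) + c N * x N t) \<in> V" by (intro V_add V_scale) auto
  then show ?case by simp
qed (simp add: V_zero)

lemma Q_sum:
  assumes "\<And>i. x i \<in> V" "z \<in> V"
  shows "Q (\<lambda>t. \<Sum>i<(N::nat). c i * x i t) z = (\<Sum>i<N. c i * Q (x i) z)"
proof (induction N)
  case 0
  have "Q (\<lambda>t. 0 * 0) z = 0 * Q (\<lambda>t. 0) z" by (intro Q_scale V_zero assms)
  then show ?case by simp
next
  case (Suc N)
  then show ?case using assms by (simp add: Q_add Q_scale V_sum V_scale)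
qed

lemma Q_sum_right:
  assumes "\<And>i. x i \<in> V" "z \<in> V"
  shows "Q z (\<lambda>t. \<Sum>i<(N::nat). c i * x i t) = (\<Sum>i<N. cnj (c i) * Q z (x i))"
proof -
  have "Q z (\<lambda>t. \<Sum>i<N. c i * x i t) = cnj (Q (\<lambda>t. \<Sum>i<N. c i * x i t) z)"
    using assms by (intro Q_cnj V_sum) auto
  also have "\<dots> = (\<Sum>i<N. cnj (c i) * cnj (Q (x i) z))" using assms by (simp add: Q_sum)
  also have "\<dots> = (\<Sum>i<N. cnj (c i) * Q z (x i))" using assms by (intro sum.cong) (simp_all add: Q_cnj[of _ z])
  finally show ?thesis .
qed

lemma Q_sum_both:
  assumes "\<And>i. x i \<in> V"
  shows "Q (\<lambda>t. \<Sum>i<N. c i * x i t) (\<lambda>t. \<Sum>i<N. c i * x i t) = kernel_form N (\<lambda>i j. Q (x i) (x j)) c"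
  unfolding kernel_form_def using assms
  by (simp add: Q_sum Q_sum_right V_sum sum_distrib_left mult.assoc)

lemma Q_expand:
  assumes "x \<in> V" "y \<in> V"
  shows "Re (Q (\<lambda>t. x t + y t) (\<lambda>t. x t + y t)) = Re (Q x x) + Re (Q y y) + 2 * Re (Q x y)"
  using assms Q_cnj[of x y] by (simp add: Q_add Q_add_right V_add)

text \<open>The quantitative form of the fact that a minimiser is orthogonal. The test direction is
  \<open>c = - u Q r g\<close> with \<open>u = 1 / (Q g g + 1)\<close>; the added 1 covers vectors
  \<open>g\<close> with \<open>Q g g = 0\<close>.\<close>

lemma nearly_orthogonal:
  assumes "r \<in> V" "g \<in> V" and min: "\<And>c. Re (Q r r) \<le> Re (Q (\<lambda>t. r t + c * g t) (\<lambda>t. r t + c * g t)) + e"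
  shows "cmod (Q r g) \<le> sqrt (e * (Re (Q g g) + 1))"
proof (rule real_le_rsqrt)
  define q where "q = Re (Q g g)"
  have q: "q \<ge> 0" using Q_nonneg[OF assms(2)] by (simp add: q_def)
  define u where "u = 1 / (q + 1)"
  have u: "u > 0" "u * (q + 1) = 1" using q by (simp_all add: u_def)
  define m where "m = (cmod (Q r g))\<^sup>2"
  have Qgg: "Q g g = of_real q"
    using Q_cnj[OF assms(2,2)] by (simp add: q_def complex_eq_iff)
  define c where "c = - of_real u * Q r g"
  have m': "Q r g * cnj (Q r g) = of_real m" unfolding m_def by (rule complex_norm_square[symmetric])
  have "Re (Q (\<lambda>t. r t + c * g t) (\<lambda>t. r t + c * g t)) = Re (Q r r) + Re (c * cnj c * Q g g) + 2 * Re (cnj c * Q r g)"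
    using assms(1,2) by (simp only: Q_expand V_scale Q_scale Q_scale_right) (simp add: mult.assoc)
  also have "c * cnj c * Q g g = of_real (u\<^sup>2 * q) * (Q r g * cnj (Q r g))"
    by (simp add: c_def Qgg power2_eq_square)
  also have "\<dots> = of_real (u\<^sup>2 * q * m)" by (simp add: m')
  also have "cnj c * Q r g = - of_real u * (Q r g * cnj (Q r g))" by (simp add: c_def)
  also have "\<dots> = of_real (- u * m)" by (simp add: m')
  finally have "2 * u * m \<le> u\<^sup>2 * q * m + e" using min[of c] by simp
  moreover have "u\<^sup>2 * q * m \<le> u * m"
  proof -
    have "u * q \<le> 1" using u by (simp add: algebra_simps)
    then have "(u * m) * (u * q) \<le> (u * m) * 1" using u by (intro mult_left_mono) (auto simp: m_def)
    then show ?thesis by (simp add: power2_eq_square algebra_simps)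
  qed
  ultimately have "u * m \<le> e" by simp
  then have "(q + 1) * (u * m) \<le> (q + 1) * e" using q by (intro mult_left_mono) auto
  then have "m \<le> e * (q + 1)" using u by (simp add: mult.commute mult.left_commute)
  then show "(cmod (Q r g))\<^sup>2 \<le> e * (Re (Q g g) + 1)" by (simp add: m_def q_def)
qed

text \<open>\<open>X\<close> plays the role of the Gram kernel of the \<open>x i\<close> projected
  off \<open>G\<close>, without a completion: \<open>r i n\<close> is nearly minimal in the coset of
  \<open>x i\<close>, and \<open>X i j\<close> is the limit of \<open>Q (r i n) (r j n)\<close>.
  Near-orthogonality to \<open>G\<close> survives linear combinations, so minimising for each
  \<open>i\<close> separately serves all finite sums.\<close>

lemma shorted_kernel:
  assumes x: "\<And>i::nat. x i \<in> V" and G: "G \<subseteq> V" "(\<lambda>t. 0) \<in> G"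
    and G_add: "\<And>g h. \<lbrakk>g \<in> G; h \<in> G\<rbrakk> \<Longrightarrow> (\<lambda>t. g t + h t) \<in> G"
    and G_scale: "\<And>g c. g \<in> G \<Longrightarrow> (\<lambda>t. c * g t) \<in> G"
  obtains X where "\<And>i j. X j i = cnj (X i j)"
    "\<And>N c g. g \<in> G \<Longrightarrow> Re (kernel_form N X c)
        \<le> Re (Q (\<lambda>t. (\<Sum>i<N. c i * x i t) + g t) (\<lambda>t. (\<Sum>i<N. c i * x i t) + g t))"
    "\<And>N c e. e > 0 \<Longrightarrow> \<exists>g\<in>G. Re (Q (\<lambda>t. (\<Sum>i<N. c i * x i t) + g t) (\<lambda>t. (\<Sum>i<N. c i * x i t) + g t))
        < Re (kernel_form N X c) + e"
proof -
  define q where "q y = Re (Q y y)" for y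
  have GV: "g \<in> V" if "g \<in> G" for g using G that by blast
  define m where "m i = (INF g\<in>G. q (\<lambda>t. x i t + g t))" for i
  define \<epsilon> where "\<epsilon> n = inverse (real (Suc n))" for n
  have \<epsilon>: "0 < \<epsilon> n" "\<epsilon> n \<le> 1" for n by (simp_all add: \<epsilon>_def field_simps)
  have q0: "0 \<le> q y" if "y \<in> V" for y using Q_nonneg[OF that] by (simp add: q_def)
  have bdd: "bdd_below ((\<lambda>g. q (\<lambda>t. x i t + g t)) ` G)" for i
    by (rule bdd_belowI[of _ 0]) (auto intro!: q0 V_add intro: x GV)
  have "\<exists>g\<in>G. q (\<lambda>t. x i t + g t) < m i + \<epsilon> n" for i n
    using cINF_less_iff[OF _ bdd[of i], of "m i + \<epsilon> n"] G \<epsilon>(1)[of n] unfolding m_def by auto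
  then obtain g where g: "\<And>i n. g i n \<in> G" "\<And>i n. q (\<lambda>t. x i t + g i n t) < m i + \<epsilon> n" by metis
  have m_le: "m i \<le> q (\<lambda>t. x i t + h t)" if "h \<in> G" for i h
    unfolding m_def using bdd that by (intro cINF_lower)
  define r where "r i n = (\<lambda>t. x i t + g i n t)" for i n
  have rV: "r i n \<in> V" for i n unfolding r_def by (intro V_add x GV g)
  have orth: "cmod (Q (r i n) h) \<le> sqrt (\<epsilon> n * (q h + 1))" if h: "h \<in> G" for i n h
    unfolding q_def
  proof (rule nearly_orthogonal[OF rV GV[OF h]])
    fix c
    have "(\<lambda>t. g i n t + c * h t) \<in> G" by (intro G_add G_scale g h)
    then have "m i \<le> q (\<lambda>t. x i t + (g i n t + c * h t))" by (rule m_le)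
    then have "q (r i n) \<le> q (\<lambda>t. r i n t + c * h t) + \<epsilon> n"
      using g(2)[of i n] unfolding r_def by (simp add: add.assoc)
    then show "Re (Q (r i n) (r i n)) \<le> Re (Q (\<lambda>t. r i n t + c * h t) (\<lambda>t. r i n t + c * h t)) + \<epsilon> n"
      by (simp add: q_def)
  qed
  have "\<exists>l. (\<lambda>n. Q (r i n) (r j n)) \<longlonglongrightarrow> l" for i j
  proof -
    define d where "d i n k = (\<lambda>t. g i n t + (- 1) * g i k t)" for i n k
    have dG: "d i n k \<in> G" for i n k unfolding d_def by (intro G_add G_scale g)
    have r_d: "r i n = (\<lambda>t. r i k t + d i n k t)" for i n k by (simp add: r_def d_def fun_eq_iff)
    \<comment> \<open>By the parallelogram law, the differences of near-minimisers have bounded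
      form, uniformly in \<open>n\<close> and \<open>k\<close>. They lie in \<open>G\<close>, so
      near-orthogonality gives the Cauchy property.\<close>
    define B where "B i = 4 * (m i + 1) + 1" for i
    have dB: "q (d i n k) + 1 \<le> B i" for i n k
    proof -
      have r1: "q (r i n) \<le> m i + 1" for n using g(2)[of i n] \<epsilon>(2)[of n] by (simp add: r_def)
      have d2: "d i n k = (\<lambda>t. r i n t + (- 1) * r i k t)" by (simp add: r_def d_def fun_eq_iff)
      have "q (\<lambda>t. r i n t + r i k t) + q (d i n k) = 2 * q (r i n) + 2 * q (r i k)"
        unfolding q_def d2 using rV
        by (simp only: Q_expand V_scale Q_scale Q_scale_right) simp
      moreover have "q (\<lambda>t. r i n t + r i k t) \<ge> 0" by (intro q0 V_add rV)
      ultimately show ?thesis using r1[of n] r1[of k] by (simp add: B_def)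
    qed
    have B0: "B i \<ge> 0" for i using dB[of i 0 0] q0[OF GV[OF dG]] by (smt (verit))
    have bound: "dist (Q (r i n) (r j n)) (Q (r i k) (r j k)) \<le> sqrt (\<epsilon> n * B i) + sqrt (\<epsilon> k * B j)" for n k
    proof -
      have 1: "Q (r i n) (r j n) = Q (r i k) (r j n) + Q (d i n k) (r j n)"
        using rV GV[OF dG] by (subst r_d[of i n k]) (simp add: Q_add)
      have 2: "Q (r i k) (r j n) = Q (r i k) (r j k) + Q (r i k) (d j n k)"
        using rV GV[OF dG] by (subst r_d[of j n k]) (simp add: Q_add_right)
      have "cmod (Q (d i n k) (r j n)) = cmod (Q (r j n) (d i n k))"
        using Q_cnj[OF rV[of j n] GV[OF dG[of i n k]]] by simp
      also have "\<dots> \<le> sqrt (\<epsilon> n * (q (d i n k) + 1))" by (rule orth[OF dG])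
      also have "\<dots> \<le> sqrt (\<epsilon> n * B i)" using dB \<epsilon>(1)[of n] by (simp add: mult_left_mono)
      finally have 3: "cmod (Q (d i n k) (r j n)) \<le> sqrt (\<epsilon> n * B i)" .
      have "cmod (Q (r i k) (d j n k)) \<le> sqrt (\<epsilon> k * (q (d j n k) + 1))" by (rule orth[OF dG])
      also have "\<dots> \<le> sqrt (\<epsilon> k * B j)" using dB \<epsilon>(1)[of k] by (simp add: mult_left_mono)
      finally show ?thesis
        unfolding dist_norm 1 2 using 3 norm_triangle_ineq[of "Q (r i k) (d j n k)" "Q (d i n k) (r j n)"]
        by (simp add: algebra_simps)
    qed
    have lim: "(\<lambda>n. sqrt (\<epsilon> n * B i)) \<longlonglongrightarrow> sqrt (0 * B i)" for i
      unfolding \<epsilon>_def by (intro tendsto_intros LIMSEQ_inverse_real_of_nat)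
    have "Cauchy (\<lambda>n. Q (r i n) (r j n))"
    proof (rule metric_CauchyI)
      fix e :: real assume e: "e > 0"
      have ev: "eventually (\<lambda>n. sqrt (\<epsilon> n * B i) < e / 2) sequentially" for i
        using lim[of i] e by (intro order_tendstoD) auto
      obtain N1 N2 where "\<forall>n\<ge>N1. sqrt (\<epsilon> n * B i) < e / 2" "\<forall>n\<ge>N2. sqrt (\<epsilon> n * B j) < e / 2"
        using ev[of i] ev[of j] by (auto simp: eventually_sequentially)
      then have "dist (Q (r i n) (r j n)) (Q (r i k) (r j k)) < e" if "n \<ge> max N1 N2" "k \<ge> max N1 N2" for n k
        using bound[of n k] that by (smt (verit) field_sum_of_halves max.bounded_iff)
      then show "\<exists>M. \<forall>m\<ge>M. \<forall>n\<ge>M. dist (Q (r i m) (r j m)) (Q (r i n) (r j n)) < e" by blast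
    qed
    then show ?thesis using Cauchy_convergent convergent_def by blast
  qed
  then obtain X where X: "\<And>i j. (\<lambda>n. Q (r i n) (r j n)) \<longlonglongrightarrow> X i j" by metis
  have herm: "X j i = cnj (X i j)" for i j
  proof (rule LIMSEQ_unique[OF X])
    show "(\<lambda>n. Q (r j n) (r i n)) \<longlonglongrightarrow> cnj (X i j)"
      using tendsto_cnj[OF X[of i j]] by (simp add: Q_cnj[OF rV rV, symmetric])
  qed
  define R where "R N c n = (\<lambda>t. \<Sum>i<N. c i * r i n t)" for N c n
  define gs where "gs N c n = (\<lambda>t. \<Sum>i<N. c i * g i n t)" for N :: nat and c n
  have gsG0: "(\<lambda>t. \<Sum>i<N. c i * g i n t) \<in> G" for N :: nat and c :: "nat \<Rightarrow> complex" and n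
  proof (induction N)
    case (Suc N)
    then have "(\<lambda>t. (\<Sum>i<N. c i * g i n t) + c N * g N n t) \<in> G" by (intro G_add G_scale g)
    then show ?case by simp
  qed (simp add: G)
  have gsG: "gs N c n \<in> G" for N c n unfolding gs_def by (rule gsG0)
  have R: "R N c n = (\<lambda>t. (\<Sum>i<N. c i * x i t) + gs N c n t)" for N c n
    by (simp add: R_def gs_def r_def fun_eq_iff distrib_left sum.distrib)
  have RV: "R N c n \<in> V" for N c n unfolding R_def by (intro V_sum rV)
  have Rlim: "(\<lambda>n. q (R N c n)) \<longlonglongrightarrow> Re (kernel_form N X c)" for N c
    unfolding q_def R_def Q_sum_both[OF rV] kernel_form_def by (intro tendsto_intros X)
  show ?thesis
  proof (rule that[OF herm])
    fix N c h assume h: "h \<in> G"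
    let ?y = "\<lambda>t. (\<Sum>i<N. c i * x i t) + h t"
    define S where "S = (\<Sum>i<N. cmod (c i))"
    have S: "S \<ge> 0" by (simp add: S_def sum_nonneg)
    \<comment> \<open>The term linear in \<open>sqrt (q k)\<close> is absorbed by \<open>q k\<close>
      on completing the square; what is left tends to 0 with \<open>\<epsilon> n\<close>.\<close>
    have "q (R N c n) \<le> q ?y + \<epsilon> n * S\<^sup>2 + 2 * (sqrt (\<epsilon> n) * S)" for n
    proof -
      define k where "k = (\<lambda>t. h t + (- 1) * gs N c n t)"
      have kG: "k \<in> G" unfolding k_def by (intro G_add G_scale gsG h)
      have y: "?y = (\<lambda>t. R N c n t + k t)" by (simp add: R k_def fun_eq_iff)
      have "cmod (Q (R N c n) k) \<le> (\<Sum>i<N. cmod (c i) * sqrt (\<epsilon> n * (q k + 1)))"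
        unfolding R_def using rV GV[OF kG] orth[OF kG]
        by (simp only: Q_sum) (rule sum_norm_le, simp add: norm_mult mult_left_mono)
      also have "\<dots> = S * sqrt (\<epsilon> n * (q k + 1))" by (simp add: S_def sum_distrib_right)
      also have "\<dots> \<le> S * (sqrt (\<epsilon> n) * (sqrt (q k) + 1))"
        using S \<epsilon>(1)[of n] q0[OF GV[OF kG]] sqrt_add_le_add_sqrt[of "q k" 1]
        by (intro mult_left_mono) (auto simp: real_sqrt_mult)
      finally have "\<bar>Re (Q (R N c n) k)\<bar> \<le> S * (sqrt (\<epsilon> n) * (sqrt (q k) + 1))"
        using abs_Re_le_cmod order_trans by blast
      then have "q ?y \<ge> q (R N c n) + q k - 2 * (S * (sqrt (\<epsilon> n) * (sqrt (q k) + 1)))"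
        unfolding y q_def Q_expand[OF RV GV[OF kG]] by (simp add: q_def)
      moreover have "0 \<le> (sqrt (q k) - S * sqrt (\<epsilon> n))\<^sup>2" by simp
      then have "2 * (S * (sqrt (\<epsilon> n) * sqrt (q k))) \<le> q k + \<epsilon> n * S\<^sup>2"
        using q0[OF GV[OF kG]] \<epsilon>(1)[of n] by (simp add: power2_diff power_mult_distrib algebra_simps)
      ultimately show ?thesis by (simp add: algebra_simps)
    qed
    moreover have "(\<lambda>n. q ?y + \<epsilon> n * S\<^sup>2 + 2 * (sqrt (\<epsilon> n) * S)) \<longlonglongrightarrow> q ?y + 0 * S\<^sup>2 + 2 * (sqrt 0 * S)"
      unfolding \<epsilon>_def by (intro tendsto_intros LIMSEQ_inverse_real_of_nat)
    ultimately have "Re (kernel_form N X c) \<le> q ?y + 0 * S\<^sup>2 + 2 * (sqrt 0 * S)"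
      using LIMSEQ_le[OF Rlim] by blast
    then show "Re (kernel_form N X c) \<le> Re (Q ?y ?y)" by (simp add: q_def)
  next
    fix N c and e :: real assume "e > 0"
    then have "eventually (\<lambda>n. q (R N c n) < Re (kernel_form N X c) + e) sequentially"
      by (intro order_tendstoD[OF Rlim]) auto
    then obtain n where "q (R N c n) < Re (kernel_form N X c) + e"
      using eventually_happens[of _ sequentially] by auto
    then show "\<exists>g\<in>G. Re (Q (\<lambda>t. (\<Sum>i<N. c i * x i t) + g t) (\<lambda>t. (\<Sum>i<N. c i * x i t) + g t))
        < Re (kernel_form N X c) + e"
      using gsG by (auto simp: R q_def)
  qed
qed

end

section \<open>The Agler decomposition on the bidisc\<close>

lemma sum_cis_roots:
  fixes d :: int
  assumes "N > 0"
  shows "(\<Sum>u<N. cis (2 * pi * (real u * of_int d) / real N)) = (if int N dvd d then of_nat N else 0)"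
proof -
  define z where "z = cis (2 * pi * of_int d / real N)"
  have zu: "cis (2 * pi * (real u * of_int d) / real N) = z ^ u" for u
    by (simp add: z_def Complex.DeMoivre algebra_simps)
  have zN: "z ^ N = 1"
    using assms cis_multiple_2pi[of "of_int d"] by (simp add: z_def Complex.DeMoivre mult.commute)
  show ?thesis
  proof (cases "int N dvd d")
    case True
    then obtain e where "d = int N * e" by blast
    then have "2 * pi * of_int d / real N = 2 * pi * of_int e" using assms by simp
    then have "z = cis (2 * pi * of_int e)" by (simp only: z_def)
    also have "\<dots> = 1" by (rule cis_multiple_2pi) simp
    finally have "z = 1" .
    then show ?thesis using True by (simp add: zu)
  next
    case False
    have "z \<noteq> 1"
    proof
      assume "z = 1"
      then have "cos (2 * pi * of_int d / real N) = 1" by (simp add: z_def complex_eq_iff)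
      then obtain e :: int where "2 * pi * of_int d / real N = of_int e * 2 * pi"
        using cos_one_2pi_int by blast
      then have "of_int d = (of_int e * of_int (int N) :: real)" using assms by (simp add: field_simps)
      then have "d = e * int N" by (metis of_int_eq_iff of_int_mult)
      then show False using False by simp
    qed
    then show ?thesis using False zN geometric_sum[of z N] by (simp add: zu)
  qed
qed

definition torus_char :: "nat \<Rightarrow> nat \<Rightarrow> nat \<Rightarrow> int \<times> int \<Rightarrow> complex" where
  "torus_char N u v s = cis (2 * pi * (real u * of_int (fst s)) / real N) * cis (2 * pi * (real v * of_int (snd s)) / real N)"

lemma torus_char_mult: "torus_char N u v s * torus_char N u v t = torus_char N u v (s + t)"
  by (simp add: torus_char_def cis_mult add_divide_distrib algebra_simps)

lemma torus_char_cnj: "cnj (torus_char N u v s) = torus_char N u v (- s)"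
  by (simp add: torus_char_def cis_cnj)

text \<open>\<open>small\<close> excludes aliasing: distinct exponents in \<open>S\<close> remain
  distinct modulo \<open>N\<close> in some coordinate, so their characters are orthogonal on the
  grid.\<close>

lemma discrete_Parseval:
  assumes S: "finite S" and N: "N > 0"
    and small: "\<And>s t. \<lbrakk>s \<in> S; t \<in> S\<rbrakk> \<Longrightarrow> \<bar>fst s - fst t\<bar> < int N \<and> \<bar>snd s - snd t\<bar> < int N"
  shows "(\<Sum>u<N. \<Sum>v<N. (cmod (\<Sum>s\<in>S. y s * torus_char N u v s))\<^sup>2) = (real N)\<^sup>2 * (\<Sum>s\<in>S. (cmod (y s))\<^sup>2)"
proof -
  have orth: "(\<Sum>u<N. \<Sum>v<N. torus_char N u v (s - t)) = (if s = t then (of_nat N)\<^sup>2 else 0)"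
    if "s \<in> S" "t \<in> S" for s t
  proof -
    have dvd: "int N dvd d \<longleftrightarrow> d = 0" if "\<bar>d\<bar> < int N" for d
      using that by (metis dvd_0_right zdvd_not_zless abs_dvd_iff dvd_abs_iff abs_ge_zero abs_eq_0 less_le)
    have "(\<Sum>u<N. \<Sum>v<N. torus_char N u v (s - t)) =
        (\<Sum>u<N. cis (2 * pi * (real u * of_int (fst s - fst t)) / real N)) *
        (\<Sum>v<N. cis (2 * pi * (real v * of_int (snd s - snd t)) / real N))"
      by (simp add: torus_char_def sum_product)
    then show ?thesis
      using small[OF that] by (simp only: sum_cis_roots[OF N] dvd) (auto simp: power2_eq_square prod_eq_iff)
  qed
  have "complex_of_real (\<Sum>u<N. \<Sum>v<N. (cmod (\<Sum>s\<in>S. y s * torus_char N u v s))\<^sup>2)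
      = (\<Sum>u<N. \<Sum>v<N. \<Sum>s\<in>S. \<Sum>t\<in>S. y s * cnj (y t) * torus_char N u v (s - t))"
    by (simp add: complex_norm_square sum_product torus_char_cnj mult.assoc mult.left_commute torus_char_mult
        del: of_real_power)
  also have "\<dots> = (\<Sum>s\<in>S. \<Sum>t\<in>S. y s * cnj (y t) * (\<Sum>u<N. \<Sum>v<N. torus_char N u v (s - t)))"
    by (simp add: sum_distrib_left sum.swap[of _ S "{..<N}"])
  also have "\<dots> = (\<Sum>s\<in>S. \<Sum>t\<in>S. if s = t then y s * cnj (y t) * (of_nat N)\<^sup>2 else 0)"
    by (intro sum.cong refl) (simp add: orth)
  also have "\<dots> = (\<Sum>s\<in>S. y s * cnj (y s) * (of_nat N)\<^sup>2)"
    using S by (simp add: sum.delta')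
  also have "\<dots> = complex_of_real ((real N)\<^sup>2 * (\<Sum>s\<in>S. (cmod (y s))\<^sup>2))"
    by (simp add: complex_norm_square sum_distrib_left mult.commute del: of_real_power)
      (simp add: complex_norm_square)
  finally show ?thesis by (simp only: of_real_eq_iff)
qed

text \<open>On the finite group of \<open>N\<close>-th roots of unity the adjoint of multiplication by a polynomial \<open>b\<close> becomes
  multiplication by the conjugate of \<open>b\<close>, provided \<open>N\<close> exceeds the diameter of all supports.\<close>

lemma polynomial_backward_bound:
  fixes x :: "int \<times> int \<Rightarrow> complex"
  assumes S: "finite S" "\<And>t. t \<notin> S \<Longrightarrow> x t = 0" and B: "finite B"
    and bd: "\<And>z w. \<lbrakk>cmod z = 1; cmod w = 1\<rbrakk> \<Longrightarrow> cmod (\<Sum>(p, q)\<in>{..<L} \<times> {..<L}. b p q * z ^ p * w ^ q) \<le> C"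
  shows "(\<Sum>t\<in>B. (cmod (\<Sum>(p, q)\<in>{..<L} \<times> {..<L}. cnj (b p q) * x (t + (int p, int q))))\<^sup>2)
    \<le> C\<^sup>2 * (\<Sum>t\<in>S. (cmod (x t))\<^sup>2)"
proof -
  let ?I = "{..<L} \<times> {..<L}"
  define y where "y t = (\<Sum>(p, q)\<in>?I. cnj (b p q) * x (t + (int p, int q)))" for t
  have "\<exists>R::int. R \<ge> 0 \<and> S \<union> B \<subseteq> {-R..R} \<times> {-R..R}"
  proof -
    define R where "R = Max (insert 0 ((\<lambda>t. \<bar>fst t\<bar> + \<bar>snd t\<bar>) ` (S \<union> B)))"
    have "0 \<le> R" "\<And>t. t \<in> S \<union> B \<Longrightarrow> \<bar>fst t\<bar> + \<bar>snd t\<bar> \<le> R"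
      unfolding R_def using S B by (auto intro!: Max_ge)
    then show ?thesis by (intro exI[of _ R]) (fastforce simp: mem_Times_iff)
  qed
  then obtain R :: int where R: "R \<ge> 0" "S \<subseteq> {-R..R} \<times> {-R..R}" "B \<subseteq> {-R..R} \<times> {-R..R}" by auto
  \<comment> \<open>Widened by \<open>L\<close> on the negative side, so that a backward shift of
    the support of \<open>x\<close> by \<open>p, q < L\<close> stays inside. \<open>N\<close> is
    chosen one larger than the greatest coordinate difference in \<open>D\<close>.\<close>
  define D where "D = {-(R + int L)..R} \<times> {-(R + int L)..R}"
  have D: "finite D" "S \<subseteq> D" "B \<subseteq> D" using R by (auto simp: D_def)
  define N where "N = nat (2 * R + int L + 1)"
  have N: "N > 0" "int N = 2 * R + int L + 1" using R by (auto simp: N_def)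
  have small: "\<bar>fst s - fst t\<bar> < int N \<and> \<bar>snd s - snd t\<bar> < int N" if "s \<in> D" "t \<in> D" for s t
    using that unfolding N D_def by auto
  have C: "C \<ge> 0" by (rule order_trans[OF norm_ge_zero bd[of 1 1]]) simp_all
  have four: "(\<Sum>t\<in>D. y t * torus_char N u v t) =
      cnj (\<Sum>(p, q)\<in>?I. b p q * torus_char N u v (int p, int q)) * (\<Sum>t\<in>D. x t * torus_char N u v t)" for u v
  proof -
    have sh: "(\<Sum>t\<in>D. x (t + (int p, int q)) * torus_char N u v t)
        = torus_char N u v (- (int p, int q)) * (\<Sum>t\<in>D. x t * torus_char N u v t)" if pq: "(p, q) \<in> ?I" for p q
    proof -
      let ?h = "\<lambda>t. t + (int p, int q)"
      have "(\<Sum>t\<in>D. x (?h t) * torus_char N u v t)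
          = (\<Sum>t\<in>D. x (?h t) * torus_char N u v (?h t) * torus_char N u v (- (int p, int q)))"
        by (simp only: mult.assoc torus_char_mult add.assoc right_minus add_0_right)
      also have "\<dots> = (\<Sum>t\<in>?h ` D. x t * torus_char N u v t * torus_char N u v (- (int p, int q)))"
        by (subst sum.reindex) (auto simp: inj_on_def)
      also have "\<dots> = (\<Sum>t\<in>S. x t * torus_char N u v t * torus_char N u v (- (int p, int q)))"
      proof (rule sum.mono_neutral_right)
        show "S \<subseteq> ?h ` D"
        proof
          fix t assume t: "t \<in> S"
          then have "t - (int p, int q) \<in> D" using R pq unfolding D_def by (cases t) auto
          then show "t \<in> ?h ` D" by (rule rev_image_eqI) simp
        qed
      qed (use D S in auto)
      also have "\<dots> = (\<Sum>t\<in>D. x t * torus_char N u v t * torus_char N u v (- (int p, int q)))"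
        using D S by (intro sum.mono_neutral_left) auto
      also have "\<dots> = torus_char N u v (- (int p, int q)) * (\<Sum>t\<in>D. x t * torus_char N u v t)"
        unfolding sum_distrib_left by (intro sum.cong) (simp_all only: mult_ac)
      finally show ?thesis .
    qed
    have "(\<Sum>t\<in>D. y t * torus_char N u v t)
        = (\<Sum>pq\<in>?I. cnj (b (fst pq) (snd pq)) * (\<Sum>t\<in>D. x (t + (int (fst pq), int (snd pq))) * torus_char N u v t))"
      unfolding y_def
      by (simp add: sum_distrib_right sum_distrib_left case_prod_unfold sum.swap[of _ ?I] mult.assoc)
    also have "\<dots> = (\<Sum>pq\<in>?I. cnj (b (fst pq) (snd pq)) *
        (torus_char N u v (- (int (fst pq), int (snd pq))) * (\<Sum>t\<in>D. x t * torus_char N u v t)))"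
      by (intro sum.cong refl) (subst sh, auto)
    also have "\<dots> = cnj (\<Sum>(p, q)\<in>?I. b p q * torus_char N u v (int p, int q)) * (\<Sum>t\<in>D. x t * torus_char N u v t)"
      by (simp add: sum_distrib_right case_prod_unfold torus_char_cnj mult.assoc)
    finally show ?thesis .
  qed
  have P: "cmod (\<Sum>(p, q)\<in>?I. b p q * torus_char N u v (int p, int q)) \<le> C" for u v
  proof -
    have "torus_char N u v (int p, int q) = cis (2 * pi * real u / real N) ^ p * cis (2 * pi * real v / real N) ^ q" for p q
      by (simp add: torus_char_def Complex.DeMoivre algebra_simps)
    then show ?thesis
      using bd[of "cis (2 * pi * real u / real N)" "cis (2 * pi * real v / real N)"] by (simp add: mult.assoc)
  qed
  have "(real N)\<^sup>2 * (\<Sum>t\<in>D. (cmod (y t))\<^sup>2) = (\<Sum>u<N. \<Sum>v<N. (cmod (\<Sum>t\<in>D. y t * torus_char N u v t))\<^sup>2)"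
    using discrete_Parseval[OF D(1) N(1) small] by simp
  also have "\<dots> \<le> (\<Sum>u<N. \<Sum>v<N. C\<^sup>2 * (cmod (\<Sum>t\<in>D. x t * torus_char N u v t))\<^sup>2)"
    unfolding four norm_mult complex_mod_cnj power_mult_distrib using P
    by (intro sum_mono mult_right_mono power_mono) auto
  also have "\<dots> = C\<^sup>2 * ((real N)\<^sup>2 * (\<Sum>t\<in>D. (cmod (x t))\<^sup>2))"
    using discrete_Parseval[OF D(1) N(1) small, of x] by (simp add: sum_distrib_left[symmetric])
  also have "\<dots> = (real N)\<^sup>2 * (C\<^sup>2 * (\<Sum>t\<in>D. (cmod (x t))\<^sup>2))" by simp
  finally have 1: "(\<Sum>t\<in>D. (cmod (y t))\<^sup>2) \<le> C\<^sup>2 * (\<Sum>t\<in>D. (cmod (x t))\<^sup>2)"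
    using N(1) by simp
  have 2: "(\<Sum>t\<in>D. (cmod (x t))\<^sup>2) = (\<Sum>t\<in>S. (cmod (x t))\<^sup>2)"
    using D S by (intro sum.mono_neutral_right) auto
  have "(\<Sum>t\<in>B. (cmod (y t))\<^sup>2) \<le> (\<Sum>t\<in>D. (cmod (y t))\<^sup>2)"
    using D by (intro sum_mono2) auto
  with 1 show ?thesis unfolding 2 y_def by linarith
qed

section \<open>Backward bounds for finitely supported families\<close>

locale schur_series =
  fixes a :: "nat \<Rightarrow> nat \<Rightarrow> complex" and f :: "complex \<Rightarrow> complex \<Rightarrow> complex"
  assumes a_bound: "cmod (a p q) \<le> 1"
    and f_sum: "\<lbrakk>cmod z < 1; cmod w < 1\<rbrakk> \<Longrightarrow> ((\<lambda>(p, q). a p q * z ^ p * w ^ q) has_sum f z w) UNIV"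
    and f_bound: "\<lbrakk>cmod z < 1; cmod w < 1\<rbrakk> \<Longrightarrow> cmod (f z w) \<le> 1"
begin

text \<open>Truncations of the series of \<open>f\<close> need not be bounded by 1 on the torus.
  After dilation by \<open>r < 1\<close> the discarded tail is below a geometric remainder,
  uniformly on the torus.\<close>

lemma dilated_polynomial_bound:
  assumes r: "0 \<le> r" "r < 1" and e: "e > 0"
  shows "\<exists>L\<ge>L0. \<forall>z w. cmod z = 1 \<longrightarrow> cmod w = 1 \<longrightarrow>
    cmod (\<Sum>(p, q)\<in>{..<L} \<times> {..<L}. (a p q * of_real (r ^ (p + q))) * z ^ p * w ^ q) \<le> 1 + e"
proof -
  have geo: "(\<lambda>(p, q). r ^ p * r ^ q) summable_on UNIV"
    using has_sum_double_geometric(2)[of r r] r by simp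
  obtain F where F: "finite F" "dist (sum (\<lambda>(p, q). r ^ p * r ^ q) F) (infsum (\<lambda>(p, q). r ^ p * r ^ q) UNIV) \<le> e"
    using infsum_finite_approximation[OF geo e] by blast
  obtain L1 where L1: "\<forall>(p, q)\<in>F. p < L1 \<and> q < L1"
  proof
    show "\<forall>(p, q)\<in>F. p < Suc (Max (insert 0 ((\<lambda>(p, q). p + q) ` F))) \<and> q < Suc (Max (insert 0 ((\<lambda>(p, q). p + q) ` F)))"
    proof (clarify)
      fix p q assume "(p, q) \<in> F"
      then have "p + q \<le> Max (insert 0 ((\<lambda>(p, q). p + q) ` F))" using F(1) by (intro Max_ge) auto
      then show "p < Suc (Max (insert 0 ((\<lambda>(p, q). p + q) ` F))) \<and> q < Suc (Max (insert 0 ((\<lambda>(p, q). p + q) ` F)))"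
        by linarith
    qed
  qed
  define L where "L = max L0 L1"
  let ?I = "{..<L} \<times> {..<L}"
  have FI: "F \<subseteq> ?I" using L1 by (force simp: L_def)
  have "cmod (\<Sum>(p, q)\<in>?I. (a p q * of_real (r ^ (p + q))) * z ^ p * w ^ q) \<le> 1 + e"
    if zw: "cmod z = 1" "cmod w = 1" for z w
  proof -
    let ?g = "\<lambda>(p, q). a p q * (of_real r * z) ^ p * (of_real r * w) ^ q"
    let ?h = "\<lambda>(p, q). r ^ p * r ^ q"
    have n: "cmod (of_real r * z) < 1" "cmod (of_real r * w) < 1" using zw r by (simp_all add: norm_mult)
    have gh: "cmod (?g t) \<le> ?h t" for t
      using a_bound[of "fst t" "snd t"] r zw
      by (auto simp: case_prod_unfold norm_mult norm_power mult.assoc intro!: mult_left_le_one_le)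
    have hc: "?h summable_on (- ?I)" using geo summable_on_subset_banach by blast
    have ga: "(\<lambda>t. cmod (?g t)) summable_on (- ?I)"
      using hc by (rule summable_on_comparison_test) (use gh in auto)
    have gs: "?g summable_on UNIV" using f_sum[OF n] by (auto simp: has_sum_iff)
    have "f (of_real r * z) (of_real r * w) = infsum ?g UNIV" using f_sum[OF n] by (simp add: has_sum_iff)
    also have "\<dots> = infsum ?g (?I \<union> - ?I)" by simp
    also have "\<dots> = infsum ?g ?I + infsum ?g (- ?I)"
      using gs summable_on_subset_banach by (intro infsum_Un_disjoint) auto
    finally have "(\<Sum>t\<in>?I. ?g t) = f (of_real r * z) (of_real r * w) - infsum ?g (- ?I)" by simp
    moreover have "cmod (infsum ?g (- ?I)) \<le> e"
    proof -
      have "cmod (infsum ?g (- ?I)) \<le> infsum (\<lambda>t. cmod (?g t)) (- ?I)" by (rule norm_infsum_bound[OF ga])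
      also have "\<dots> \<le> infsum ?h (- ?I)" using ga hc gh by (intro infsum_mono) auto
      also have "infsum ?h (- ?I) = infsum ?h UNIV - sum ?h ?I"
      proof -
        have "infsum ?h (?I \<union> - ?I) = infsum ?h ?I + infsum ?h (- ?I)"
          using geo summable_on_subset_banach by (intro infsum_Un_disjoint) auto
        then show ?thesis by simp
      qed
      also have "sum ?h ?I \<ge> sum ?h F" using FI r by (intro sum_mono2) (auto intro!: mult_nonneg_nonneg)
      then have "infsum ?h UNIV - sum ?h ?I \<le> e" using F(2) by (simp add: dist_real_def)
      finally show ?thesis .
    qed
    ultimately have "cmod (\<Sum>t\<in>?I. ?g t) \<le> 1 + e"
      using f_bound[OF n] norm_triangle_ineq4[of "f (of_real r * z) (of_real r * w)" "infsum ?g (- ?I)"] by simp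
    also have "(\<Sum>t\<in>?I. ?g t) = (\<Sum>(p, q)\<in>?I. (a p q * of_real (r ^ (p + q))) * z ^ p * w ^ q)"
      by (intro sum.cong refl) (auto simp: power_mult_distrib power_add)
    finally show ?thesis .
  qed
  then show ?thesis by (intro exI[of _ L]) (auto simp: L_def)
qed

text \<open>For this \<open>x\<close> only exponents below \<open>L0\<close> contribute, so the
  truncation level can be raised, and \<open>e\<close> made small, without changing
  \<open>W r\<close>. The passage to \<open>r = 1\<close> is continuity of the finite sum
  \<open>W\<close>.\<close>

lemma finite_backward_bound:
  fixes x :: "int \<times> int \<Rightarrow> complex"
  assumes S: "finite S" "\<And>t. t \<notin> S \<Longrightarrow> x t = 0" and B: "finite B"
    and L0: "\<And>t p q. \<lbrakk>t \<in> B; p \<ge> L0 \<or> q \<ge> L0\<rbrakk> \<Longrightarrow> x (t + (int p, int q)) = 0"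
  shows "(\<Sum>t\<in>B. (cmod (\<Sum>(p, q)\<in>{..<L0} \<times> {..<L0}. cnj (a p q) * x (t + (int p, int q))))\<^sup>2)
    \<le> (\<Sum>t\<in>S. (cmod (x t))\<^sup>2)"
proof -
  let ?I = "{..<L0} \<times> {..<L0}"
  define W where "W r = (\<Sum>t\<in>B. (cmod (\<Sum>(p, q)\<in>?I. cnj (a p q * of_real (r ^ (p + q))) * x (t + (int p, int q))))\<^sup>2)" for r
  define n where "n = (\<Sum>t\<in>S. (cmod (x t))\<^sup>2)"
  have n: "n \<ge> 0" by (simp add: n_def sum_nonneg)
  have "W r \<le> (1 + e)\<^sup>2 * n" if r: "0 \<le> r" "r < 1" and e: "e > 0" for r e
  proof -
    obtain L where L: "L \<ge> L0" "\<And>z w. \<lbrakk>cmod z = 1; cmod w = 1\<rbrakk> \<Longrightarrow>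
        cmod (\<Sum>(p, q)\<in>{..<L} \<times> {..<L}. (a p q * of_real (r ^ (p + q))) * z ^ p * w ^ q) \<le> 1 + e"
      using dilated_polynomial_bound[OF r e, of L0] by blast
    have "(\<Sum>(p, q)\<in>?I. cnj (a p q * of_real (r ^ (p + q))) * x (t + (int p, int q)))
        = (\<Sum>(p, q)\<in>{..<L} \<times> {..<L}. cnj (a p q * of_real (r ^ (p + q))) * x (t + (int p, int q)))" if "t \<in> B" for t
    proof (rule sum.mono_neutral_left)
      show "\<forall>pq\<in>{..<L} \<times> {..<L} - ?I. (case pq of (p, q) \<Rightarrow> cnj (a p q * of_real (r ^ (p + q))) * x (t + (int p, int q))) = 0"
      proof
        fix pq assume pq: "pq \<in> {..<L} \<times> {..<L} - ?I"
        obtain p q where e: "pq = (p, q)" by (cases pq)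
        have "p \<ge> L0 \<or> q \<ge> L0" using pq by (auto simp: e)
        then show "(case pq of (p, q) \<Rightarrow> cnj (a p q * of_real (r ^ (p + q))) * x (t + (int p, int q))) = 0"
          using L0[OF that] by (simp add: e)
      qed
    qed (use L(1) in auto)
    then have "W r = (\<Sum>t\<in>B. (cmod (\<Sum>(p, q)\<in>{..<L} \<times> {..<L}. cnj (a p q * of_real (r ^ (p + q))) * x (t + (int p, int q))))\<^sup>2)"
      unfolding W_def by simp
    also have "\<dots> \<le> (1 + e)\<^sup>2 * n" unfolding n_def by (rule polynomial_backward_bound[OF S B L(2)])
    finally show ?thesis .
  qed
  note le = this
  have lim1: "(\<lambda>m. 1 + inverse (real (Suc m))) \<longlonglongrightarrow> 1 + 0"
    by (intro tendsto_intros LIMSEQ_inverse_real_of_nat)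
  have "W r \<le> n" if r: "0 \<le> r" "r < 1" for r
  proof (rule LIMSEQ_le_const)
    show "(\<lambda>m. (1 + inverse (real (Suc m)))\<^sup>2 * n) \<longlonglongrightarrow> n"
      using tendsto_mult_right[OF tendsto_power[OF lim1, of 2], of n] by simp
    show "\<exists>M. \<forall>m\<ge>M. W r \<le> (1 + inverse (real (Suc m)))\<^sup>2 * n" using le[OF r] by auto
  qed
  moreover have "(\<lambda>m. W (1 - inverse (real (Suc m)))) \<longlonglongrightarrow> W (1 - 0)"
    unfolding W_def case_prod_unfold by (intro tendsto_intros LIMSEQ_inverse_real_of_nat)
  ultimately have "W (1 - 0) \<le> n"
    by (intro LIMSEQ_le_const2) (auto simp: field_simps intro!: exI[of _ 0])
  then show ?thesis by (simp add: W_def n_def)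
qed

end

text \<open>On absolutely summable families the sum defining \<open>backward\<close> converges at
  every index from \<open>cmod (a p q) \<le> 1\<close> alone, and the Szego vectors belong to
  them.\<close>

definition ell1 :: "('i \<Rightarrow> complex) set" where
  "ell1 = {x. (\<lambda>t. cmod (x t)) summable_on UNIV}"

lemma ell1_zero: "(\<lambda>t. 0) \<in> ell1"
  by (simp add: ell1_def)

lemma ell1_add: "\<lbrakk>x \<in> ell1; y \<in> ell1\<rbrakk> \<Longrightarrow> (\<lambda>t. x t + y t) \<in> ell1"
  unfolding ell1_def mem_Collect_eq
  by (rule summable_on_comparison_test[where f = "\<lambda>t. cmod (x t) + cmod (y t)"])
    (auto intro: summable_on_add norm_triangle_ineq)

lemma ell1_scale: "x \<in> ell1 \<Longrightarrow> (\<lambda>t. c * x t) \<in> ell1"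
  unfolding ell1_def mem_Collect_eq norm_mult by (rule summable_on_cmult_right)

lemma ell1_comp: "\<lbrakk>x \<in> ell1; inj h\<rbrakk> \<Longrightarrow> (\<lambda>t. x (h t)) \<in> ell1"
  unfolding ell1_def mem_Collect_eq
  using summable_on_reindex[of h UNIV "\<lambda>t. cmod (x t)"] summable_on_subset_banach[of "\<lambda>t. cmod (x t)" UNIV "range h"]
  by (simp add: o_def)

lemma ell1_ell2: "x \<in> ell1 \<Longrightarrow> x \<in> carrier ell2"
proof -
  assume x: "x \<in> ell1"
  define K where "K = infsum (\<lambda>t. cmod (x t)) UNIV"
  have le: "cmod (x t) \<le> K" for t
    using finite_sum_le_infsum[of "\<lambda>t. cmod (x t)" UNIV "{t}"] x by (simp add: K_def ell1_def)
  have "(\<lambda>t. (cmod (x t))\<^sup>2) summable_on UNIV"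
    by (rule summable_on_comparison_test[where f = "\<lambda>t. K * cmod (x t)"])
      (use x le in \<open>auto simp: ell1_def power2_eq_square intro: summable_on_cmult_right mult_right_mono\<close>)
  then show ?thesis by (simp add: ell2_def)
qed

lemma ell2_ip_add: "\<lbrakk>x \<in> carrier ell2; y \<in> carrier ell2; z \<in> carrier ell2\<rbrakk>
    \<Longrightarrow> ip ell2 (\<lambda>t. x t + y t) z = ip ell2 x z + ip ell2 y z"
  using hilbert_space.ip_add[OF hilbert_space_ell2, of x y z] by (simp add: ell2_def)

lemma ell2_ip_scale: "\<lbrakk>x \<in> carrier ell2; z \<in> carrier ell2\<rbrakk> \<Longrightarrow> ip ell2 (\<lambda>t. c * x t) z = c * ip ell2 x z"
  using hilbert_space.ip_smult[OF hilbert_space_ell2, of x z c] by (simp add: ell2_def)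

lemma ell2_ip_cnj: "\<lbrakk>x \<in> carrier ell2; y \<in> carrier ell2\<rbrakk> \<Longrightarrow> ip ell2 y x = cnj (ip ell2 x y)"
  by (rule hilbert_space.ip_cnj[OF hilbert_space_ell2])

interpretation ell1: semi_inner "ell1 :: ('i \<Rightarrow> complex) set" "ip ell2"
  by unfold_locales
    (auto intro: ell1_zero ell1_add ell1_scale ell2_ip_add ell2_ip_scale ell2_ip_cnj ell1_ell2
      hilbert_space.ip_nonneg[OF hilbert_space_ell2])

text \<open>The first index belongs to the \<open>L2\<close> variable and the second to the
  \<open>H2\<close> variable. Hence \<open>shift_left\<close> preserves the inner product, whereas
  \<open>level_down\<close> loses the row of level 0; the two halves of the decomposition rest on
  this difference.\<close>

definition level_down :: "(int \<times> nat \<Rightarrow> complex) \<Rightarrow> int \<times> nat \<Rightarrow> complex" where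
  "level_down x = (\<lambda>(j, k). x (j, Suc k))"

definition level_up :: "(int \<times> nat \<Rightarrow> complex) \<Rightarrow> int \<times> nat \<Rightarrow> complex" where
  "level_up x = (\<lambda>(j, k). case k of 0 \<Rightarrow> 0 | Suc k' \<Rightarrow> x (j, k'))"

definition shift_left :: "(int \<times> nat \<Rightarrow> complex) \<Rightarrow> int \<times> nat \<Rightarrow> complex" where
  "shift_left x = (\<lambda>(j, k). x (j + 1, k))"

lemma shift_left_ell1: "x \<in> ell1 \<Longrightarrow> shift_left x \<in> ell1"
  using ell1_comp[of x "\<lambda>(j, k). (j + 1, k)"] by (simp add: shift_left_def case_prod_unfold inj_on_def)

lemma level_up_ell1:
  assumes x: "x \<in> ell1"
  shows "level_up x \<in> ell1"
proof -
  let ?h = "\<lambda>(j :: int, k). (j, Suc k)"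
  have "inj ?h" by (auto simp: inj_on_def)
  then have "(\<lambda>t. cmod (level_up x t)) summable_on range ?h"
    using x by (subst summable_on_reindex) (auto simp: ell1_def o_def level_up_def case_prod_unfold)
  then have "(\<lambda>t. cmod (level_up x t)) summable_on UNIV"
    by (rule summable_on_cong_neutral[THEN iffD1, rotated -1])
      (auto simp: level_up_def image_iff split: nat.splits)
  then show ?thesis by (simp add: ell1_def)
qed

lemma level_down_up: "level_down (level_up x) = x"
  by (simp add: level_down_def level_up_def)

lemma shift_left_ip: "ip ell2 (shift_left x) (shift_left y) = ip ell2 x y"
proof -
  have "bij_betw (\<lambda>(j :: int, k :: nat). (j + 1, k)) UNIV UNIV"
    by (rule bij_betw_byWitness[where f' = "\<lambda>(j, k). (j - 1, k)"]) auto
  from infsum_reindex_bij_betw[OF this, of "\<lambda>t. x t * cnj (y t)"]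
  show ?thesis by (simp add: ell2_def shift_left_def case_prod_unfold)
qed

lemma ip_level_split:
  assumes x: "x \<in> carrier ell2"
  shows "Re (ip ell2 x x) = Re (ip ell2 (level_down x) (level_down x)) + (\<Sum>\<^sub>\<infinity>j. (cmod (x (j, 0)))\<^sup>2)"
proof -
  let ?h = "\<lambda>(j :: int, k). (j, Suc k)" and ?g = "\<lambda>j :: int. (j, 0 :: nat)" and ?f = "\<lambda>t. (cmod (x t))\<^sup>2"
  have s: "?f summable_on A" for A
    using x summable_on_subset_banach[of ?f UNIV A] by (simp add: ell2_def)
  have "infsum ?f (range ?g \<union> range ?h) = infsum ?f (range ?g) + infsum ?f (range ?h)"
    by (rule infsum_Un_disjoint[OF s s]) auto
  moreover have "range ?g \<union> range ?h = UNIV"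
  proof -
    have "(j, k) \<in> range ?g \<union> range ?h" for j k by (cases k) (auto simp: image_iff)
    then show ?thesis by auto
  qed
  moreover have "infsum ?f (range ?g) = (\<Sum>\<^sub>\<infinity>j. ?f (j, 0))"
    by (subst infsum_reindex) (auto simp: inj_on_def o_def)
  moreover have "infsum ?f (range ?h) = (\<Sum>\<^sub>\<infinity>t. (cmod (level_down x t))\<^sup>2)"
    by (subst infsum_reindex) (auto simp: inj_on_def o_def level_down_def case_prod_unfold)
  ultimately show ?thesis by (simp add: ell2_ip_self)
qed

section \<open>The adjoint of multiplication by \<open>f\<close> and its defect form\<close>

context schur_series
begin

text \<open>The adjoint of multiplication by \<open>f\<close> on \<open>L\<^sup>2 \<otimes> H\<^sup>2\<close>, in Fourier coefficients.\<close>

definition backward :: "(int \<times> nat \<Rightarrow> complex) \<Rightarrow> int \<times> nat \<Rightarrow> complex" where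
  "backward x = (\<lambda>(j, k). \<Sum>\<^sub>\<infinity>(p, q). cnj (a p q) * x (j + int p, k + q))"

lemma backward_summable:
  assumes x: "x \<in> ell1"
  shows "(\<lambda>(p, q). cmod (cnj (a p q) * x (j + int p, k + q))) summable_on UNIV"
proof -
  have "(\<lambda>t. x (case t of (p, q) \<Rightarrow> (j + int p, k + q))) \<in> ell1"
    by (rule ell1_comp[OF x]) (auto simp: inj_on_def)
  then have "(\<lambda>t. cmod (x (case t of (p, q) \<Rightarrow> (j + int p, k + q)))) summable_on UNIV" by (simp add: ell1_def)
  then show ?thesis
    by (rule summable_on_comparison_test)
      (use a_bound in \<open>auto simp: norm_mult intro!: mult_left_le_one_le\<close>)
qed

lemma backward_summable':
  assumes "x \<in> ell1"
  shows "(\<lambda>(p, q). cnj (a p q) * x (j + int p, k + q)) summable_on UNIV"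
  by (rule abs_summable_summable) (use backward_summable[OF assms] in \<open>simp add: case_prod_unfold\<close>)

lemma backward_add:
  assumes "x \<in> ell1" "y \<in> ell1"
  shows "backward (\<lambda>t. x t + y t) = (\<lambda>t. backward x t + backward y t)"
  unfolding backward_def fun_eq_iff
  using infsum_add[OF backward_summable'[OF assms(1)] backward_summable'[OF assms(2)]]
  by (simp add: case_prod_unfold distrib_left)

lemma backward_scale: "backward (\<lambda>t. c * x t) = (\<lambda>t. c * backward x t)"
  unfolding backward_def fun_eq_iff
  by (simp add: case_prod_unfold mult.left_commute[of _ c] infsum_cmult_right')

lemma backward_shift_left: "backward (shift_left x) = shift_left (backward x)"
  by (simp add: backward_def shift_left_def fun_eq_iff add.commute add.left_commute)

lemma backward_level_down: "backward (level_down x) = level_down (backward x)"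
  by (simp add: backward_def level_down_def fun_eq_iff)

text \<open>A crude bound that extends the contraction property from finitely supported families to
  \<open>ell1\<close>: approximation in the \<open>ell1\<close> norm yields pointwise convergence of
  \<open>backward\<close>.\<close>

lemma backward_le:
  assumes x: "x \<in> ell1"
  shows "cmod (backward x t) \<le> infsum (\<lambda>t. cmod (x t)) UNIV"
proof -
  obtain j k where t: "t = (j, k)" by (cases t)
  let ?h = "\<lambda>(p, q). (j + int p, k + q)"
  have inj: "inj ?h" by (auto simp: inj_on_def)
  have xs: "(\<lambda>t. cmod (x t)) summable_on A" for A
    using x summable_on_subset_banach[of "\<lambda>t. cmod (x t)" UNIV A] by (simp add: ell1_def)
  have "cmod (backward x t) \<le> infsum (\<lambda>(p, q). cmod (cnj (a p q) * x (j + int p, k + q))) UNIV"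
    using norm_infsum_bound[of "\<lambda>(p, q). cnj (a p q) * x (j + int p, k + q)" UNIV] backward_summable[OF x, of j k]
    by (simp add: t backward_def case_prod_unfold)
  also have "\<dots> \<le> infsum (\<lambda>pq. cmod (x (?h pq))) UNIV"
  proof (rule infsum_mono[OF backward_summable[OF x]])
    show "(\<lambda>pq. cmod (x (?h pq))) summable_on UNIV"
      using xs[of "range ?h"] by (subst (asm) summable_on_reindex[OF inj]) (simp add: o_def)
  qed (use a_bound in \<open>auto simp: norm_mult intro!: mult_left_le_one_le\<close>)
  also have "\<dots> = infsum (\<lambda>t. cmod (x t)) (range ?h)"
    by (subst infsum_reindex[OF inj]) (simp add: o_def)
  also have "\<dots> \<le> infsum (\<lambda>t. cmod (x t)) UNIV"
    by (rule infsum_mono2) (auto intro: xs)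
  finally show ?thesis .
qed

lemma backward_finite_bound:
  fixes x :: "int \<times> nat \<Rightarrow> complex"
  assumes S: "finite S" "\<And>t. t \<notin> S \<Longrightarrow> x t = 0" and B: "finite B"
  shows "(\<Sum>t\<in>B. (cmod (backward x t))\<^sup>2) \<le> (\<Sum>t\<in>S. (cmod (x t))\<^sup>2)"
proof -
  define h where "h = (\<lambda>(j :: int, k). (j, int k))"
  have inj: "inj_on h A" for A by (auto simp: h_def inj_on_def)
  \<comment> \<open>Extension by zero to negative levels, which makes the bound on
    \<open>int \<times> int\<close> applicable.\<close>
  define x' where "x' = (\<lambda>(j, k). if k \<ge> 0 then x (j, nat k) else 0)"
  have x'h: "x' (h t + (int p, int q)) = x (fst t + int p, snd t + q)" for t p q
    by (cases t) (simp add: x'_def h_def nat_add_distrib)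
  have x'h0: "x' (h t) = x t" for t by (cases t) (simp add: x'_def h_def)
  have S': "x' t = 0" if "t \<notin> h ` S" for t
  proof (rule ccontr)
    assume "x' t \<noteq> 0"
    then have "snd t \<ge> 0" "x (fst t, nat (snd t)) \<noteq> 0" by (auto simp: x'_def case_prod_unfold split: if_splits)
    then have "(fst t, nat (snd t)) \<in> S" "t = h (fst t, nat (snd t))" using S(2) by (auto simp: h_def)
    then show False using that by blast
  qed
  obtain M :: nat where M: "\<And>t. t \<in> S \<union> B \<Longrightarrow> \<bar>fst t\<bar> \<le> int M \<and> snd t \<le> M"
  proof -
    define m where "m = Max (insert 0 ((\<lambda>t. nat \<bar>fst t\<bar> + snd t) ` (S \<union> B)))"
    have "nat \<bar>fst t\<bar> + snd t \<le> m" if "t \<in> S \<union> B" for t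
      unfolding m_def using S B that by (intro Max_ge) auto
    then show ?thesis using that[of m] by force
  qed
  \<comment> \<open>\<open>S\<close> and \<open>B\<close> lie in a box of radius \<open>M\<close>,
    so a shift by more than \<open>2 * M\<close> in one coordinate carries \<open>B\<close> off
    \<open>S\<close>.\<close>
  define L0 where "L0 = Suc (2 * M)"
  have L0: "x (fst t + int p, snd t + q) = 0" if "t \<in> B" "p \<ge> L0 \<or> q \<ge> L0" for t p q
  proof (rule ccontr)
    assume "x (fst t + int p, snd t + q) \<noteq> 0"
    then have "(fst t + int p, snd t + q) \<in> S" using S by blast
    then show False using M[of t] M[of "(fst t + int p, snd t + q)"] that by (auto simp: L0_def)
  qed
  have bw: "backward x t = (\<Sum>(p, q)\<in>{..<L0} \<times> {..<L0}. cnj (a p q) * x' (h t + (int p, int q)))" if t: "t \<in> B" for t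
  proof -
    have "backward x t = (\<Sum>\<^sub>\<infinity>pq. cnj (a (fst pq) (snd pq)) * x (fst t + int (fst pq), snd t + snd pq))"
      by (simp add: backward_def case_prod_unfold)
    also have "\<dots> = (\<Sum>\<^sub>\<infinity>pq\<in>{..<L0} \<times> {..<L0}. cnj (a (fst pq) (snd pq)) * x (fst t + int (fst pq), snd t + snd pq))"
    proof (rule infsum_cong_neutral)
      fix pq assume "pq \<in> UNIV - {..<L0} \<times> {..<L0}"
      then have "fst pq \<ge> L0 \<or> snd pq \<ge> L0" by (cases pq) auto
      then show "cnj (a (fst pq) (snd pq)) * x (fst t + int (fst pq), snd t + snd pq) = 0"
        using L0[OF t] by simp
    qed auto
    finally show ?thesis by (simp add: x'h case_prod_unfold)
  qed
  have "(\<Sum>t\<in>h ` B. (cmod (\<Sum>(p, q)\<in>{..<L0} \<times> {..<L0}. cnj (a p q) * x' (t + (int p, int q))))\<^sup>2)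
      \<le> (\<Sum>t\<in>h ` S. (cmod (x' t))\<^sup>2)"
    by (rule finite_backward_bound) (use S S' B L0 in \<open>auto simp: x'h\<close>)
  then show ?thesis
    by (simp add: sum.reindex[OF inj] x'h0 bw)
qed

lemma backward_bound:
  assumes x: "x \<in> ell1" and B: "finite B"
  shows "(\<Sum>t\<in>B. (cmod (backward x t))\<^sup>2) \<le> (\<Sum>\<^sub>\<infinity>t. (cmod (x t))\<^sup>2)"
proof -
  have xs: "(\<lambda>t. cmod (x t)) summable_on A" for A
    using x summable_on_subset_banach[of "\<lambda>t. cmod (x t)" UNIV A] by (simp add: ell1_def)
  have "\<exists>F. finite F \<and> F \<subseteq> UNIV \<and> dist (sum (\<lambda>t. cmod (x t)) F) (infsum (\<lambda>t. cmod (x t)) UNIV) \<le> inverse (real (Suc n))" for n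
    using infsum_finite_approximation[OF xs, of "inverse (real (Suc n))"] by auto
  then obtain F where F: "\<And>n. finite (F n)"
    "\<And>n. dist (sum (\<lambda>t. cmod (x t)) (F n)) (infsum (\<lambda>t. cmod (x t)) UNIV) \<le> inverse (real (Suc n))" by metis
  define y where "y n = (\<lambda>t. if t \<in> F n then x t else 0)" for n
  define z where "z n = (\<lambda>t. if t \<in> F n then 0 else x t)" for n
  have yz: "y n \<in> ell1" "z n \<in> ell1" for n
    unfolding ell1_def mem_Collect_eq y_def z_def
    by (rule summable_on_comparison_test[OF xs[of UNIV]]; simp)+
  have "cmod (backward x t - backward (y n) t) \<le> inverse (real (Suc n))" for n t
  proof -
    have "x = (\<lambda>t. y n t + z n t)" by (auto simp: y_def z_def)
    then have "backward x t = backward (y n) t + backward (z n) t" using backward_add[OF yz[of n]] by simp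
    then have "cmod (backward x t - backward (y n) t) \<le> infsum (\<lambda>t. cmod (z n t)) UNIV"
      using backward_le[OF yz(2)[of n], of t] by simp
    also have "infsum (\<lambda>t. cmod (z n t)) UNIV = infsum (\<lambda>t. cmod (x t)) (- F n)"
      by (rule infsum_cong_neutral) (auto simp: z_def)
    also have "infsum (\<lambda>t. cmod (x t)) (F n \<union> - F n) = infsum (\<lambda>t. cmod (x t)) (F n) + infsum (\<lambda>t. cmod (x t)) (- F n)"
      by (rule infsum_Un_disjoint[OF xs xs]) auto
    then have "infsum (\<lambda>t. cmod (x t)) (- F n) \<le> inverse (real (Suc n))"
      using F[of n] by (simp add: dist_real_def)
    finally show ?thesis .
  qed
  then have "(\<lambda>n. backward (y n) t - backward x t) \<longlonglongrightarrow> 0" for t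
    by (intro Lim_null_comparison[OF _ LIMSEQ_inverse_real_of_nat]) (auto simp: norm_minus_commute)
  then have "(\<lambda>n. backward (y n) t) \<longlonglongrightarrow> backward x t" for t
    by (rule LIM_zero_cancel)
  then have "(\<lambda>n. \<Sum>t\<in>B. (cmod (backward (y n) t))\<^sup>2) \<longlonglongrightarrow> (\<Sum>t\<in>B. (cmod (backward x t))\<^sup>2)"
    by (intro tendsto_intros)
  moreover have "(\<Sum>t\<in>B. (cmod (backward (y n) t))\<^sup>2) \<le> (\<Sum>\<^sub>\<infinity>t. (cmod (x t))\<^sup>2)" for n
  proof -
    have "(\<Sum>t\<in>B. (cmod (backward (y n) t))\<^sup>2) \<le> (\<Sum>t\<in>F n. (cmod (y n t))\<^sup>2)"
      by (rule backward_finite_bound) (use F B in \<open>auto simp: y_def\<close>)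
    also have "\<dots> = (\<Sum>t\<in>F n. (cmod (x t))\<^sup>2)" by (simp add: y_def)
    also have "\<dots> \<le> (\<Sum>\<^sub>\<infinity>t. (cmod (x t))\<^sup>2)"
      using ell1_ell2[OF x] F by (intro finite_sum_le_infsum) (auto simp: ell2_def)
    finally show ?thesis .
  qed
  ultimately show ?thesis by (intro LIMSEQ_le_const2) auto
qed

lemma backward_contraction:
  assumes x: "x \<in> ell1"
  shows "backward x \<in> carrier ell2" "Re (ip ell2 (backward x) (backward x)) \<le> Re (ip ell2 x x)"
proof -
  have "(\<lambda>t. (cmod (backward x t))\<^sup>2) summable_on UNIV"
    by (rule nonneg_bdd_above_summable_on)
      (auto intro!: bdd_aboveI[where M = "\<Sum>\<^sub>\<infinity>t. (cmod (x t))\<^sup>2"] backward_bound[OF x])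
  note s = this
  then show "backward x \<in> carrier ell2" by (simp add: ell2_def)
  show "Re (ip ell2 (backward x) (backward x)) \<le> Re (ip ell2 x x)"
    unfolding ell2_ip_self Re_complex_of_real by (rule infsum_le_finite_sums[OF s backward_bound[OF x]])
qed

definition defect :: "(int \<times> nat \<Rightarrow> complex) \<Rightarrow> (int \<times> nat \<Rightarrow> complex) \<Rightarrow> complex" where
  "defect x y = ip ell2 x y - ip ell2 (backward x) (backward y)"

sublocale defect: semi_inner ell1 defect
proof
  fix x y z :: "int \<times> nat \<Rightarrow> complex"
  assume "x \<in> ell1" "y \<in> ell1" "z \<in> ell1"
  then show "defect (\<lambda>t. x t + y t) z = defect x z + defect y z"
    by (simp add: defect_def backward_add ell2_ip_add ell1_ell2 backward_contraction(1))
next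
  fix x z :: "int \<times> nat \<Rightarrow> complex" and c
  assume "x \<in> ell1" "z \<in> ell1"
  then show "defect (\<lambda>t. c * x t) z = c * defect x z"
    by (simp add: defect_def backward_scale ell2_ip_scale ell1_ell2 backward_contraction(1) right_diff_distrib)
next
  fix x y :: "int \<times> nat \<Rightarrow> complex"
  assume xy: "x \<in> ell1" "y \<in> ell1"
  show "defect y x = cnj (defect x y)"
    unfolding defect_def ell2_ip_cnj[OF ell1_ell2[OF xy(1)] ell1_ell2[OF xy(2)]]
      ell2_ip_cnj[OF backward_contraction(1)[OF xy(1)] backward_contraction(1)[OF xy(2)]] by simp
next
  fix x :: "int \<times> nat \<Rightarrow> complex"
  assume "x \<in> ell1"
  then show "0 \<le> Re (defect x x)" using backward_contraction(2)[of x] by (simp add: defect_def)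
qed (auto intro: ell1_zero ell1_add ell1_scale)

lemma defect_shift_left: "defect (shift_left x) (shift_left y) = defect x y"
  by (simp add: defect_def backward_shift_left shift_left_ip)

text \<open>Because \<open>backward\<close> commutes with \<open>level_down\<close>, only the rows
  of level 0 distinguish the two values.\<close>

lemma defect_level_down:
  assumes "x \<in> ell1"
  shows "Re (defect x x) = Re (defect (level_down x) (level_down x))
    + ((\<Sum>\<^sub>\<infinity>j. (cmod (x (j, 0)))\<^sup>2) - (\<Sum>\<^sub>\<infinity>j. (cmod (backward x (j, 0)))\<^sup>2))"
  using ip_level_split[OF ell1_ell2[OF assms]] ip_level_split[OF backward_contraction(1)[OF assms]]
  by (simp add: defect_def backward_level_down)

end

text \<open>Coefficients of the Szego kernel of \<open>H2 \<otimes> H2\<close>, continued by zero to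
  negative first index. It is an eigenvector of \<open>level_down\<close>; under
  \<open>shift_left\<close> the eigenvector equation fails exactly in the column of index
  \<open>- 1\<close>.\<close>

definition szego :: "complex \<Rightarrow> complex \<Rightarrow> int \<times> nat \<Rightarrow> complex" where
  "szego z w = (\<lambda>(j, k). if j \<ge> 0 then cnj z ^ nat j * cnj w ^ k else 0)"

lemma infsum_nonneg_first:
  fixes g :: "int \<times> nat \<Rightarrow> 'a :: {comm_monoid_add, t2_space}"
  assumes "\<And>j k. j < 0 \<Longrightarrow> g (j, k) = 0"
  shows "infsum g UNIV = infsum (\<lambda>(p, q). g (int p, q)) UNIV"
    and "g summable_on UNIV \<longleftrightarrow> (\<lambda>(p, q). g (int p, q)) summable_on UNIV"
proof -
  let ?h = "\<lambda>(p, q :: nat). (int p, q)"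
  have inj: "inj ?h" by (auto simp: inj_on_def)
  have out: "g t = 0" if "t \<notin> range ?h" for t
  proof (cases t)
    case (Pair j k)
    have "j < 0"
    proof (rule ccontr)
      assume "\<not> j < 0"
      then have "t = ?h (nat j, k)" by (simp add: Pair)
      then show False using that by blast
    qed
    then show ?thesis using assms by (simp add: Pair)
  qed
  have "infsum g UNIV = infsum g (range ?h)" by (rule infsum_cong_neutral) (auto intro: out)
  also have "infsum g (range ?h) = infsum (g \<circ> ?h) UNIV" by (rule infsum_reindex[OF inj])
  also have "g \<circ> ?h = (\<lambda>(p, q). g (int p, q))" by (simp add: o_def case_prod_unfold)
  finally show "infsum g UNIV = infsum (\<lambda>(p, q). g (int p, q)) UNIV" .
  have "g summable_on UNIV \<longleftrightarrow> g summable_on range ?h"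
    by (rule summable_on_cong_neutral) (auto intro: out)
  also have "g summable_on range ?h \<longleftrightarrow> (g \<circ> ?h) summable_on UNIV" by (rule summable_on_reindex[OF inj])
  also have "g \<circ> ?h = (\<lambda>(p, q). g (int p, q))" by (simp add: o_def case_prod_unfold)
  finally show "g summable_on UNIV \<longleftrightarrow> (\<lambda>(p, q). g (int p, q)) summable_on UNIV" .
qed

lemma szego_ell1:
  assumes "cmod z < 1" "cmod w < 1"
  shows "szego z w \<in> ell1"
  unfolding ell1_def mem_Collect_eq
  by (subst infsum_nonneg_first(2))
    (use has_sum_double_geometric(2)[of z w] assms in \<open>auto simp: szego_def norm_mult norm_power\<close>)

lemma szego_ip:
  assumes "cmod z < 1" "cmod w < 1" "cmod z' < 1" "cmod w' < 1"
  shows "ip ell2 (szego z w) (szego z' w') = 1 / ((1 - cnj z * z') * (1 - cnj w * w'))"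
proof -
  have "cmod z * cmod z' < 1" "cmod w * cmod w' < 1"
    using assms mult_strict_mono'[of "cmod z" 1 "cmod z'" 1] mult_strict_mono'[of "cmod w" 1 "cmod w'" 1] by auto
  then have n: "cmod (cnj z * z') < 1" "cmod (cnj w * w') < 1" by (simp_all add: norm_mult)
  have "ip ell2 (szego z w) (szego z' w') = (\<Sum>\<^sub>\<infinity>t. szego z w t * cnj (szego z' w' t))"
    by (simp add: ell2_def)
  also have "\<dots> = (\<Sum>\<^sub>\<infinity>(p, q). (cnj z * z') ^ p * (cnj w * w') ^ q)"
    by (subst infsum_nonneg_first(1)) (auto simp: szego_def power_mult_distrib mult_ac)
  also have "\<dots> = 1 / ((1 - cnj z * z') * (1 - cnj w * w'))"
    using has_sum_double_geometric(1)[OF n] by (simp add: has_sum_iff)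
  finally show ?thesis .
qed

lemma szego_level_down: "level_down (szego z w) = (\<lambda>t. cnj w * szego z w t)"
  by (auto simp: level_down_def szego_def fun_eq_iff)

lemma kernel_form_diff: "kernel_form N (\<lambda>i j. K i j - L i j) c = kernel_form N K c - kernel_form N L c"
  by (simp add: kernel_form_def right_diff_distrib sum_subtractf)

lemma kernel_form_twist:
  "kernel_form N (\<lambda>i j. (1 - cnj (l i) * l j) * K i j) c = kernel_form N K c - kernel_form N K (\<lambda>i. c i * cnj (l i))"
  unfolding kernel_form_def sum_subtractf[symmetric] by (intro sum.cong refl) (simp add: algebra_simps)

text \<open>The factor \<open>1 - cnj (l i) * l j\<close> subtracts the form at the twisted
  coefficients. For Szego vectors twisting is the action of a backward shift, so positivity of the
  product means that the form decreases under that shift.\<close>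

lemma psd_kernel_twistI:
  assumes "\<And>i j. K j i = cnj (K i j)"
    and "\<And>N c. Re (kernel_form N K (\<lambda>i. c i * cnj (l i))) \<le> Re (kernel_form N K c)"
  shows "psd_kernel (\<lambda>i j. (1 - cnj (l i) * l j) * K i j)"
  unfolding psd_kernel_def
proof (intro conjI allI)
  show "(1 - cnj (l j) * l i) * K j i = cnj ((1 - cnj (l i) * l j) * K i j)" for i j
    using assms(1)[of j i] by simp
  show "0 \<le> Re (kernel_form N (\<lambda>i j. (1 - cnj (l i) * l j) * K i j) c)" for N c
    using assms(2)[of N c] by (simp add: kernel_form_twist)
qed

section \<open>Shorting the defect form to the Hardy space of the bidisc\<close>

context schur_series
begin

text \<open>For \<open>j \<ge> 0\<close> the summation never meets the indices where
  \<open>szego\<close> is cut off, so the power series of \<open>f\<close> can be factored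
  out.\<close>

lemma backward_szego:
  assumes "cmod z < 1" "cmod w < 1" "j \<ge> 0"
  shows "backward (szego z w) (j, k) = cnj (f z w) * szego z w (j, k)"
proof -
  have "((\<lambda>t. cnj (case t of (p, q) \<Rightarrow> a p q * z ^ p * w ^ q)) has_sum cnj (f z w)) UNIV"
    using f_sum[OF assms(1,2)] by (simp only: has_sum_cnj_iff)
  then have "((\<lambda>t. cnj (case t of (p, q) \<Rightarrow> a p q * z ^ p * w ^ q) * szego z w (j, k)) has_sum (cnj (f z w) * szego z w (j, k))) UNIV"
    by (rule has_sum_cmult_left)
  moreover have "cnj (case t of (p, q) \<Rightarrow> a p q * z ^ p * w ^ q) * szego z w (j, k)
      = (case t of (p, q) \<Rightarrow> cnj (a p q) * szego z w (j + int p, k + q))" for t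
    using assms(3) by (cases t) (simp add: szego_def nat_add_distrib power_add mult_ac)
  ultimately show ?thesis by (simp add: backward_def infsumI)
qed

lemma backward_sum:
  assumes "\<And>i. x i \<in> ell1"
  shows "backward (\<lambda>t. \<Sum>i<(N::nat). c i * x i t) = (\<lambda>t. \<Sum>i<N. c i * backward (x i) t)"
proof (induction N)
  case 0
  show ?case using backward_scale[of 0 "\<lambda>t. 0"] by simp
next
  case (Suc N)
  have "backward (\<lambda>t. (\<Sum>i<N. c i * x i t) + c N * x N t)
      = (\<lambda>t. backward (\<lambda>t. \<Sum>i<N. c i * x i t) t + backward (\<lambda>t. c N * x N t) t)"
    by (intro backward_add ell1.V_sum ell1_scale assms)
  then show ?case by (simp add: Suc backward_scale)
qed

text \<open>What \<open>L2 \<otimes> H2\<close> contains beyond \<open>H2 \<otimes> H2\<close>; each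
  coset of it is determined by its coefficients with \<open>j \<ge> 0\<close>.\<close>

definition negative_part :: "(int \<times> nat \<Rightarrow> complex) set" where
  "negative_part = {x \<in> ell1. \<forall>j k. j \<ge> 0 \<longrightarrow> x (j, k) = 0}"

lemma backward_negative_part:
  assumes "x \<in> negative_part" "j \<ge> 0"
  shows "backward x (j, k) = 0"
proof -
  have "(\<lambda>(p, q). cnj (a p q) * x (j + int p, k + q)) = (\<lambda>_. 0)"
    using assms by (auto simp: negative_part_def)
  then show ?thesis by (simp add: backward_def)
qed

text \<open>Let \<open>X\<close> be the form obtained by minimising the defect form of \<open>f\<close> over the cosets of \<open>negative_part\<close>, and
  \<open>Y = P - X\<close> with \<open>P\<close> the defect form of \<open>f\<close> on \<open>H\<^sup>2\<close>. The shift to the left maps cosets to cosets, which makes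
  \<open>X\<close> decrease under the first backward shift. For \<open>Y\<close>, a vector that is nearly optimal for \<open>X\<close> after the second
  backward shift is lifted by one level; lifting changes the defect form by no more than it changes \<open>P\<close>.\<close>

theorem agler_decomposition:
  assumes l1: "\<And>i. cmod (l1 i) < 1" and l2: "\<And>i. cmod (l2 i) < 1"
  obtains K1 K2 where "psd_kernel K1" "psd_kernel K2"
    "\<And>i j::nat. 1 - cnj (f (l1 i) (l2 i)) * f (l1 j) (l2 j)
      = (1 - cnj (l1 i) * l1 j) * K1 i j + (1 - cnj (l2 i) * l2 j) * K2 i j"
proof -
  define F where "F i = f (l1 i) (l2 i)" for i
  define h where "h i = szego (l1 i) (l2 i)" for i
  have h: "h i \<in> ell1" for i unfolding h_def by (intro szego_ell1 l1 l2)
  let ?G = negative_part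
  have G: "?G \<subseteq> ell1" "(\<lambda>t. 0) \<in> ?G" by (auto simp: negative_part_def ell1_zero)
  have G_add: "(\<lambda>t. g t + k t) \<in> ?G" if "g \<in> ?G" "k \<in> ?G" for g k
    using that by (auto simp: negative_part_def ell1_add)
  have G_scale: "(\<lambda>t. c * g t) \<in> ?G" if "g \<in> ?G" for g c
    using that by (auto simp: negative_part_def ell1_scale)
  have G_sum: "(\<lambda>t. \<Sum>i<N. c i * g i t) \<in> ?G" if "\<And>i. g i \<in> ?G" for N :: nat and c and g :: "nat \<Rightarrow> int \<times> nat \<Rightarrow> complex"
    using that ell1.V_sum[of N g c] by (auto simp: negative_part_def)
  define H where "H N c = (\<lambda>t. \<Sum>i<N. c i * h i t)" for N :: nat and c
  have H: "H N c \<in> ell1" for N c unfolding H_def by (intro ell1.V_sum h)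
  obtain X where Xc: "\<And>i j. X j i = cnj (X i j)"
    and X_le0: "\<And>N c g. g \<in> ?G \<Longrightarrow> Re (kernel_form N X c)
        \<le> Re (defect (\<lambda>t. (\<Sum>i<N. c i * h i t) + g t) (\<lambda>t. (\<Sum>i<N. c i * h i t) + g t))"
    and X_ex0: "\<And>N c e. e > 0 \<Longrightarrow> \<exists>g\<in>?G. Re (defect (\<lambda>t. (\<Sum>i<N. c i * h i t) + g t) (\<lambda>t. (\<Sum>i<N. c i * h i t) + g t))
        < Re (kernel_form N X c) + e"
    using defect.shorted_kernel[where x = h, OF h G G_add G_scale] by blast
  have X_le: "Re (kernel_form N X c) \<le> Re (defect (\<lambda>t. H N c t + g t) (\<lambda>t. H N c t + g t))" if "g \<in> ?G" for N c g
    unfolding H_def by (rule X_le0[OF that])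
  have X_ex: "\<exists>g\<in>?G. Re (defect (\<lambda>t. H N c t + g t) (\<lambda>t. H N c t + g t)) < Re (kernel_form N X c) + e" if "e > 0" for N c e
    unfolding H_def by (rule X_ex0[OF that])
  define P where "P i j = ip ell2 (h i) (h j) - cnj (F i) * F j * ip ell2 (h i) (h j)" for i j
  define Y where "Y i j = P i j - X i j" for i j
  have hc: "ip ell2 (h j) (h i) = cnj (ip ell2 (h i) (h j))" for i j
    by (intro ell2_ip_cnj ell1_ell2 h)
  have Yc: "Y j i = cnj (Y i j)" for i j
    unfolding Y_def P_def Xc[of j i] hc[of j i] by (simp add: mult.commute)
  define K1 where "K1 i j = (1 - cnj (l2 i) * l2 j) * Y i j" for i j
  define K2 where "K2 i j = (1 - cnj (l1 i) * l1 j) * X i j" for i j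
  have "psd_kernel K2"
    unfolding K2_def
  proof (rule psd_kernel_twistI[OF Xc])
    fix N c
    let ?c = "\<lambda>i. c i * cnj (l1 i)"
    \<comment> \<open>The column of the shifted Szego vector that crosses to index
      \<open>- 1\<close>. It lies in \<open>negative_part\<close>, so modulo cosets
      \<open>h i\<close> is an eigenvector of the first shift as well.\<close>
    define g where "g i = (\<lambda>(j :: int, k). if j = - 1 then cnj (l2 i) ^ k else 0 :: complex)" for i
    have sh: "shift_left (h i) = (\<lambda>t. cnj (l1 i) * h i t + g i t)" for i
    proof -
      have "nat (j + 1) = Suc (nat j)" if "0 \<le> j" for j using that by simp
      then show ?thesis by (auto simp: shift_left_def h_def szego_def g_def fun_eq_iff)
    qed
    have g: "g i \<in> ?G" for i
    proof -
      have "(\<lambda>t. shift_left (h i) t + (- cnj (l1 i)) * h i t) \<in> ell1"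
        by (intro ell1_add ell1_scale shift_left_ell1 h)
      then have "g i \<in> ell1" by (simp add: sh)
      then show ?thesis by (auto simp: negative_part_def g_def)
    qed
    show "Re (kernel_form N X ?c) \<le> Re (kernel_form N X c)"
    proof (rule field_le_epsilon)
      fix e :: real assume "e > 0"
      then obtain y where y: "y \<in> ?G" "Re (defect (\<lambda>t. H N c t + y t) (\<lambda>t. H N c t + y t)) < Re (kernel_form N X c) + e"
        using X_ex by blast
      define y' where "y' = (\<lambda>t. (\<Sum>i<N. c i * g i t) + shift_left y t)"
      have sy: "shift_left y \<in> ?G"
        using y(1) shift_left_ell1[of y] by (auto simp: negative_part_def shift_left_def)
      have "y' \<in> ?G" unfolding y'_def by (intro G_add G_sum sy g)
      moreover have "shift_left (\<lambda>t. H N c t + y t) = (\<lambda>t. H N ?c t + y' t)"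
      proof -
        have "shift_left (\<lambda>t. H N c t + y t) = (\<lambda>t. (\<Sum>i<N. c i * shift_left (h i) t) + shift_left y t)"
          by (simp add: shift_left_def H_def case_prod_unfold)
        then show ?thesis
          by (simp add: sh H_def y'_def distrib_left sum.distrib mult.assoc add.assoc)
      qed
      ultimately have "Re (kernel_form N X ?c) \<le> Re (defect (shift_left (\<lambda>t. H N c t + y t)) (shift_left (\<lambda>t. H N c t + y t)))"
        using X_le[of y' N ?c] by simp
      then show "Re (kernel_form N X ?c) \<le> Re (kernel_form N X c) + e" using y(2) by (simp add: defect_shift_left)
    qed
  qed
  moreover have "psd_kernel K1"
    unfolding K1_def
  proof (rule psd_kernel_twistI[OF Yc])
    fix N c
    let ?c = "\<lambda>i. c i * cnj (l2 i)"
    define FH where "FH c = (\<lambda>t. \<Sum>i<N. c i * (cnj (F i) * h i t))" for c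
    have FH: "FH c \<in> ell1" for c unfolding FH_def by (intro ell1.V_sum ell1_scale h)
    have ipsm: "ip ell2 (\<lambda>t. cnj (F i) * h i t) (\<lambda>t. cnj (F j) * h j t) = cnj (F i) * F j * ip ell2 (h i) (h j)" for i j
      using ell1.Q_scale[OF h[of i] ell1_scale[OF h[of j], of "cnj (F j)"], of "cnj (F i)"]
        ell1.Q_scale_right[OF h[of j] h[of i], of "cnj (F j)"] by simp
    have P: "Re (kernel_form N P c) = Re (ip ell2 (H N c) (H N c)) - Re (ip ell2 (FH c) (FH c))" for c
      unfolding H_def FH_def ell1.Q_sum_both[OF h] ell1.Q_sum_both[OF ell1_scale[OF h]] ipsm P_def kernel_form_diff
      by simp
    have Hd: "level_down (H N c) = H N ?c" and FHd: "level_down (FH c) = FH ?c"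
      using szego_level_down
      by (simp_all add: level_down_def H_def FH_def h_def fun_eq_iff mult_ac case_prod_unfold)
    have Pdiff: "Re (kernel_form N P c) - Re (kernel_form N P ?c)
        = (\<Sum>\<^sub>\<infinity>j. (cmod (H N c (j, 0)))\<^sup>2) - (\<Sum>\<^sub>\<infinity>j. (cmod (FH c (j, 0)))\<^sup>2)"
      using ip_level_split[OF ell1_ell2[OF H[of N c]]] ip_level_split[OF ell1_ell2[OF FH[of c]]]
      by (simp add: P Hd FHd)
    \<comment> \<open>Rearranged, this is the monotonicity of \<open>Y = P - X\<close> under the
      twist by \<open>l2\<close>.\<close>
    have "Re (kernel_form N X c) \<le> Re (kernel_form N X ?c) + (Re (kernel_form N P c) - Re (kernel_form N P ?c))"
    proof (rule field_le_epsilon)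
      fix e :: real assume "e > 0"
      then obtain g where g: "g \<in> ?G" "Re (defect (\<lambda>t. H N ?c t + g t) (\<lambda>t. H N ?c t + g t)) < Re (kernel_form N X ?c) + e"
        using X_ex by blast
      \<comment> \<open>\<open>level_down\<close> returns \<open>g\<close>, and the row of
        \<open>g'\<close> at level 0 is zero, so \<open>y\<close> keeps the row of
        \<open>H N c\<close> there.\<close>
      define g' where "g' = level_up g"
      have g': "g' \<in> ?G"
        using g(1) level_up_ell1[of g] by (auto simp: g'_def negative_part_def level_up_def split: nat.splits)
      define y where "y = (\<lambda>t. H N c t + g' t)"
      have y: "y \<in> ell1" unfolding y_def using g' by (intro ell1_add H) (simp add: negative_part_def)
      have yd: "level_down y = (\<lambda>t. H N ?c t + g t)"
        using Hd level_down_up[of g] by (simp add: y_def g'_def level_down_def fun_eq_iff)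
      have y0: "y (j, 0) = H N c (j, 0)" for j by (simp add: y_def g'_def level_up_def)
      \<comment> \<open>For \<open>j \<ge> 0\<close> the lifted part contributes nothing and
        equality holds; for \<open>j < 0\<close> the left side is zero. The inequality is thus lossy
        only in negative columns.\<close>
      have by0: "cmod (FH c (j, 0)) \<le> cmod (backward y (j, 0))" for j
      proof (cases "j \<ge> 0")
        case True
        have "backward y (j, 0) = backward (H N c) (j, 0) + backward g' (j, 0)"
          unfolding y_def using g' by (subst backward_add[OF H]) (auto simp: negative_part_def)
        also have "backward g' (j, 0) = 0" by (rule backward_negative_part[OF g' True])
        also have "backward (H N c) (j, 0) = FH c (j, 0)"
          unfolding H_def FH_def using True
          by (subst backward_sum[OF h]) (simp add: h_def backward_szego l1 l2 F_def)
        finally show ?thesis by simp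
      next
        case False
        then show ?thesis by (simp add: FH_def h_def szego_def)
      qed
      have row: "(\<lambda>j. (cmod (x (j, 0)))\<^sup>2) summable_on UNIV" if "x \<in> carrier ell2" for x :: "int \<times> nat \<Rightarrow> complex"
      proof -
        have "(\<lambda>t. (cmod (x t))\<^sup>2) summable_on range (\<lambda>j. (j, 0))"
          using that summable_on_subset_banach[of "\<lambda>t. (cmod (x t))\<^sup>2" UNIV] by (simp add: ell2_def)
        then show ?thesis by (subst (asm) summable_on_reindex) (auto simp: inj_on_def o_def)
      qed
      have "(\<Sum>\<^sub>\<infinity>j. (cmod (FH c (j, 0)))\<^sup>2) \<le> (\<Sum>\<^sub>\<infinity>j. (cmod (backward y (j, 0)))\<^sup>2)"
        by (intro infsum_mono row ell1_ell2 FH backward_contraction(1) y power_mono by0) auto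
      moreover have "Re (kernel_form N X c) \<le> Re (defect y y)"
        unfolding y_def by (rule X_le[OF g'])
      ultimately show "Re (kernel_form N X c)
          \<le> Re (kernel_form N X ?c) + (Re (kernel_form N P c) - Re (kernel_form N P ?c)) + e"
        using defect_level_down[OF y] g(2) unfolding Pdiff yd y0 by linarith
    qed
    then show "Re (kernel_form N Y ?c) \<le> Re (kernel_form N Y c)"
      unfolding Y_def kernel_form_diff by simp
  qed
  moreover have "1 - cnj (F i) * F j = (1 - cnj (l1 i) * l1 j) * K1 i j + (1 - cnj (l2 i) * l2 j) * K2 i j" for i j
  proof -
    have lt: "cmod (cnj (l i) * l j) < 1" if "\<And>i. cmod (l i) < 1" for l :: "nat \<Rightarrow> complex"
      using that[of i] that[of j] mult_strict_mono'[of "cmod (l i)" 1 "cmod (l j)" 1] by (simp add: norm_mult)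
    have ne0: "1 - u \<noteq> 0" if "cmod u < 1" for u :: complex using that by auto
    have ne: "1 - cnj (l1 i) * l1 j \<noteq> 0" "1 - cnj (l2 i) * l2 j \<noteq> 0"
      by (rule ne0[OF lt[of l1, OF l1]], rule ne0[OF lt[of l2, OF l2]])
    have "(1 - cnj (l1 i) * l1 j) * K1 i j + (1 - cnj (l2 i) * l2 j) * K2 i j
        = (1 - cnj (l1 i) * l1 j) * (1 - cnj (l2 i) * l2 j) * P i j"
      by (simp add: K1_def K2_def Y_def algebra_simps)
    also have "\<dots> = 1 - cnj (F i) * F j"
    proof -
      have "P i j = (1 - cnj (F i) * F j) * (1 / ((1 - cnj (l1 i) * l1 j) * (1 - cnj (l2 i) * l2 j)))"
        unfolding P_def h_def szego_ip[OF l1 l2 l1 l2] by (simp only: left_diff_distrib mult_1_left)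
      moreover have "(1 - cnj (l1 i) * l1 j) * (1 - cnj (l2 i) * l2 j) \<noteq> 0" using ne by (simp only: mult_eq_0_iff) blast
      ultimately show ?thesis by simp
    qed
    finally show ?thesis by simp
  qed
  ultimately show ?thesis using that unfolding F_def by blast
qed

end

section \<open>Colligations and transport of structure\<close>

lemma (in hilbert_space) minus_smult: "\<lbrakk>x \<in> carrier H; y \<in> carrier H\<rbrakk> \<Longrightarrow> x \<ominus> y = x \<oplus> ((- 1) \<odot> y)"
  by (intro ip_eqI) (auto simp: ip_simps)

text \<open>Operators are total functions with meaningful values only on the carrier, so
  \<open>block_op\<close> is compared with a given unitary only there.\<close>

lemma unitary_op_cong:
  assumes U: "unitary_op H U" and eq: "\<And>x. x \<in> carrier H \<Longrightarrow> U' x = U x" and H: "hilbert_space H"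
  shows "unitary_op H U'"
proof -
  interpret hilbert_space H by fact
  obtain V where V: "bounded_op H H V" "adjoint_ops H U V" "inverse_ops H U V"
    using U by (auto simp: unitary_op_def)
  have "bounded_op H H U'"
    using unitary_op_bounded[OF U] unfolding bounded_op_def by (auto simp: eq Pi_iff)
  moreover have "adjoint_ops H U' V" "inverse_ops H U' V"
    using V bounded_opD(1)[OF V(1)] by (auto simp: adjoint_ops_def inverse_ops_def eq)
  ultimately show ?thesis using V unfolding unitary_op_def by blast
qed

section \<open>Isometric isomorphisms and transport of unitaries\<close>

locale hilbert_iso = H: hilbert_space H + K: hilbert_space K
  for H :: "'a hilbert" and K :: "'b hilbert" +
  fixes J :: "'a \<Rightarrow> 'b" and J' :: "'b \<Rightarrow> 'a"
  assumes J_in: "x \<in> carrier H \<Longrightarrow> J x \<in> carrier K" and J'_in: "u \<in> carrier K \<Longrightarrow> J' u \<in> carrier H"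
    and J'_J: "x \<in> carrier H \<Longrightarrow> J' (J x) = x" and J_J': "u \<in> carrier K \<Longrightarrow> J (J' u) = u"
    and J_add: "\<lbrakk>x \<in> carrier H; y \<in> carrier H\<rbrakk> \<Longrightarrow> J (x \<oplus>\<^bsub>H\<^esub> y) = J x \<oplus>\<^bsub>K\<^esub> J y"
    and J_smult: "x \<in> carrier H \<Longrightarrow> J (c \<odot>\<^bsub>H\<^esub> x) = c \<odot>\<^bsub>K\<^esub> J x"
    and J_ip: "\<lbrakk>x \<in> carrier H; y \<in> carrier H\<rbrakk> \<Longrightarrow> ip K (J x) (J y) = ip H x y"
begin

lemma J'_add: "\<lbrakk>x \<in> carrier K; y \<in> carrier K\<rbrakk> \<Longrightarrow> J' (x \<oplus>\<^bsub>K\<^esub> y) = J' x \<oplus>\<^bsub>H\<^esub> J' y"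
  using J_add[of "J' x" "J' y"] J'_J[of "J' x \<oplus>\<^bsub>H\<^esub> J' y"] by (simp add: J'_in J_J')

lemma J'_smult: "x \<in> carrier K \<Longrightarrow> J' (c \<odot>\<^bsub>K\<^esub> x) = c \<odot>\<^bsub>H\<^esub> J' x"
  using J_smult[of "J' x" c] J'_J[of "c \<odot>\<^bsub>H\<^esub> J' x"] by (simp add: J'_in J_J')

lemma J'_ip: "\<lbrakk>x \<in> carrier K; y \<in> carrier K\<rbrakk> \<Longrightarrow> ip H (J' x) (J' y) = ip K x y"
  using J_ip[of "J' x" "J' y"] by (simp add: J'_in J_J')

lemma J_minus: "\<lbrakk>x \<in> carrier H; y \<in> carrier H\<rbrakk> \<Longrightarrow> J (x \<ominus>\<^bsub>H\<^esub> y) = J x \<ominus>\<^bsub>K\<^esub> J y"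
  by (simp add: H.minus_smult K.minus_smult J_add J_smult J_in)

lemma J_hnorm: "x \<in> carrier H \<Longrightarrow> hnorm K (J x) = hnorm H x"
  by (simp add: hnorm_def J_ip)

lemma bounded_op_transport:
  assumes "bounded_op H H U"
  shows "bounded_op K K (J \<circ> U \<circ> J')"
proof -
  obtain b where b: "\<And>x. x \<in> carrier H \<Longrightarrow> hnorm H (U x) \<le> b * hnorm H x"
    using bounded_op_bound[OF H.hilbert_space_axioms assms] by blast
  note U = bounded_opD[OF assms]
  have "hnorm K ((J \<circ> U \<circ> J') y) \<le> b * hnorm K y" if "y \<in> carrier K" for y
    using b[OF J'_in[OF that]] J_hnorm[OF U(1)[OF J'_in[OF that]]] J_hnorm[OF J'_in[OF that]] that by (simp add: J_J')
  then show ?thesis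
    by (intro bounded_opI[where b = b]) (auto simp: U J_in J'_in J'_add J'_smult J_add J_smult)
qed

lemma unitary_op_transport:
  assumes "unitary_op H U"
  shows "unitary_op K (J \<circ> U \<circ> J')"
proof -
  obtain V where V: "bounded_op H H V" "adjoint_ops H U V" "inverse_ops H U V"
    using assms by (auto simp: unitary_op_def)
  note U = bounded_opD(1)[OF unitary_op_bounded[OF assms]] and Vc = bounded_opD(1)[OF V(1)]
  have "adjoint_ops K (J \<circ> U \<circ> J') (J \<circ> V \<circ> J')"
    unfolding adjoint_ops_def
  proof (intro ballI)
    fix x y assume xy: "x \<in> carrier K" "y \<in> carrier K"
    have "ip K (J (U (J' x))) (J (J' y)) = ip K (J (J' x)) (J (V (J' y)))"
      using xy V(2) by (simp only: J_ip J'_in U Vc) (simp add: adjoint_ops_def J'_in)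
    then show "ip K ((J \<circ> U \<circ> J') x) y = ip K x ((J \<circ> V \<circ> J') y)" using xy by (simp add: J_J')
  qed
  moreover have "inverse_ops K (J \<circ> U \<circ> J') (J \<circ> V \<circ> J')"
    using V(3) by (auto simp: inverse_ops_def J'_in J'_J J_J' U Vc)
  ultimately show ?thesis
    unfolding unitary_op_def
    using bounded_op_transport[OF V(1)] bounded_op_transport[OF unitary_op_bounded[OF assms]] by blast
qed

end

text \<open>\<open>J\<close> is an arbitrary injection of types along which all structure is copied.
  It brings a space built from nested products into the type
  \<open>nat \<Rightarrow> complex\<close> prescribed for the existence statement.\<close>

definition push_hilbert :: "('a \<Rightarrow> 'b) \<Rightarrow> 'a hilbert \<Rightarrow> 'b hilbert" where
  "push_hilbert J H =
    \<lparr>carrier = J ` carrier H, mult = undefined, one = undefined, zero = J \<zero>\<^bsub>H\<^esub>,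
     add = (\<lambda>x y. J (inv_into UNIV J x \<oplus>\<^bsub>H\<^esub> inv_into UNIV J y)), smult = (\<lambda>c x. J (c \<odot>\<^bsub>H\<^esub> inv_into UNIV J x)),
     ip = (\<lambda>x y. ip H (inv_into UNIV J x) (inv_into UNIV J y))\<rparr>"

lemma push_hilbert_iso:
  assumes H: "hilbert_space H" and J: "inj J"
  shows "hilbert_iso H (push_hilbert J H) J (inv_into UNIV J)"
proof -
  interpret H: hilbert_space H by fact
  let ?K = "push_hilbert J H"
  note S = push_hilbert_def
  have [simp]: "inv_into UNIV J (J x) = x" for x using J by (rule inv_f_f)
  have ab: "abelian_group ?K"
  proof (rule abelian_groupI)
    fix x assume "x \<in> carrier ?K"
    then obtain x' where x': "x = J x'" "x' \<in> carrier H" by (auto simp: S)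
    then have "J (\<ominus>\<^bsub>H\<^esub> x') \<in> carrier ?K \<and> J (\<ominus>\<^bsub>H\<^esub> x') \<oplus>\<^bsub>?K\<^esub> x = \<zero>\<^bsub>?K\<^esub>"
      by (auto simp: S H.l_neg)
    then show "\<exists>y\<in>carrier ?K. y \<oplus>\<^bsub>?K\<^esub> x = \<zero>\<^bsub>?K\<^esub>" by blast
  qed (auto simp: S H.a_ac)
  interpret K: abelian_group ?K by (rule ab)
  have minus: "J x \<ominus>\<^bsub>?K\<^esub> J y = J (x \<ominus>\<^bsub>H\<^esub> y)" if "x \<in> carrier H" "y \<in> carrier H" for x y
  proof -
    have "\<ominus>\<^bsub>?K\<^esub> J y = J (\<ominus>\<^bsub>H\<^esub> y)"
      by (rule K.minus_equality) (use that in \<open>auto simp: S H.l_neg\<close>)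
    then show ?thesis by (simp add: a_minus_def) (simp add: S)
  qed
  have norm: "hnorm ?K (J x) = hnorm H x" for x by (simp add: hnorm_def S)
  have "hilbert_space ?K"
  proof (intro hilbert_space.intro hilbert_space_axioms.intro)
    have U: "c \<in> carrier complex_ring" for c by (simp add: complex_ring_def)
    show "module complex_ring ?K"
      by (rule moduleI[OF cring_complex_ring ab])
        (use U in \<open>auto simp: S H.smult_l_distr H.smult_r_distr H.smult_assoc1\<close>)
  next
    fix X :: "nat \<Rightarrow> 'b"
    assume X: "\<And>n. X n \<in> carrier ?K"
      and C: "\<And>e. e > 0 \<Longrightarrow> \<exists>N. \<forall>m\<ge>N. \<forall>n\<ge>N. hnorm ?K (X m \<ominus>\<^bsub>?K\<^esub> X n) < e"
    have "\<exists>x. x \<in> carrier H \<and> X n = J x" for n using X[of n] by (auto simp: S)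
    then obtain Y where Y: "\<And>n. Y n \<in> carrier H" "\<And>n. X n = J (Y n)" by metis
    have "\<exists>y\<in>carrier H. (\<lambda>n. hnorm H (Y n \<ominus>\<^bsub>H\<^esub> y)) \<longlonglongrightarrow> 0"
      using C by (intro H.hcomplete Y(1)) (simp add: Y minus norm)
    then obtain y where "y \<in> carrier H" "(\<lambda>n. hnorm H (Y n \<ominus>\<^bsub>H\<^esub> y)) \<longlonglongrightarrow> 0" by blast
    then show "\<exists>x\<in>carrier ?K. (\<lambda>n. hnorm ?K (X n \<ominus>\<^bsub>?K\<^esub> x)) \<longlonglongrightarrow> 0"
      by (intro bexI[of _ "J y"]) (simp_all add: Y minus norm, simp add: S)
  next
    fix x y assume "x \<in> carrier ?K" "y \<in> carrier ?K"
    then show "ip ?K y x = cnj (ip ?K x y)"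
      by (auto simp: S intro: H.ip_cnj)
  qed (auto simp: S H.ip_add H.ip_smult H.ip_nonneg dest: H.ip_definite)
  then show ?thesis
    by (intro hilbert_iso.intro hilbert_iso_axioms.intro H) (auto simp: S)
qed

lemma (in hilbert_iso) iso_scalar_sum:
  "hilbert_iso (hilbert_sum scalar_hilbert H) (hilbert_sum scalar_hilbert K) (map_prod id J) (map_prod id J')"
  by (intro hilbert_iso.intro hilbert_iso_axioms.intro hilbert_space_sum hilbert_space_scalar
      H.hilbert_space_axioms K.hilbert_space_axioms)
    (auto simp: hilbert_sum_simps J_in J'_in J_J' J'_J J_add J_smult J_ip)

text \<open>The unitary extension acts on a doubled space whose scalar summand is buried in its left
  half. Regrouping exposes the scalars and collects everything else as the state space.\<close>

definition reassoc :: "('c \<times> 'a) \<times> 'b \<Rightarrow> 'c \<times> 'a \<times> 'b" where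
  "reassoc = (\<lambda>((c, x), k). (c, x, k))"

definition reassoc' :: "'c \<times> 'a \<times> 'b \<Rightarrow> ('c \<times> 'a) \<times> 'b" where
  "reassoc' = (\<lambda>(c, x, k). ((c, x), k))"

lemma reassoc_iso:
  assumes "hilbert_space G" "hilbert_space H" "hilbert_space K"
  shows "hilbert_iso (hilbert_sum (hilbert_sum G H) K) (hilbert_sum G (hilbert_sum H K)) reassoc reassoc'"
  by (intro hilbert_iso.intro hilbert_iso_axioms.intro hilbert_space_sum assms)
    (auto simp: hilbert_sum_simps reassoc_def reassoc'_def)

text \<open>Extending the colligation enlarges the state space; \<open>T\<close> is continued by the
  identity on the new summand, where the model vectors have component zero.\<close>

lemma unitary_op_sum_id:
  assumes H: "hilbert_space H" and K: "hilbert_space K" and T: "unitary_op H T"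
  shows "unitary_op (hilbert_sum H K) (map_prod T id)"
proof -
  interpret S: hilbert_space "hilbert_sum H K" using hilbert_space_sum[OF H K] .
  obtain V where V: "bounded_op H H V" "adjoint_ops H T V" "inverse_ops H T V"
    using T by (auto simp: unitary_op_def)
  have iso: "ip H (V x) (V y) = ip H x y" if "x \<in> carrier H" "y \<in> carrier H" for x y
    using that V bounded_opD(1)[OF V(1)] unitary_op_ip[OF T, of "V x" "V y"] by (simp add: inverse_ops_def)
  have b: "bounded_op (hilbert_sum H K) (hilbert_sum H K) (map_prod R id)"
    if R: "bounded_op H H R" and i: "\<And>x y. \<lbrakk>x \<in> carrier H; y \<in> carrier H\<rbrakk> \<Longrightarrow> ip H (R x) (R y) = ip H x y" for R
    by (rule bounded_opI[where b = 1]) (auto simp: hilbert_sum_simps bounded_opD[OF R] hnorm_def i)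
  show ?thesis
    unfolding unitary_op_def
    using b[OF unitary_op_bounded[OF T] unitary_op_ip[OF T]] b[OF V(1) iso] V(2,3)
    by (intro conjI exI[of _ "map_prod V id"]) (auto simp: adjoint_ops_def inverse_ops_def hilbert_sum_simps)
qed

text \<open>The blocks are read off from \<open>U\<close>. The second conclusion reduces the value
  at a point to one vector equation without inverses, which is the form in which the extended
  isometry supplies it.\<close>

lemma unitary_realization_of_unitary:
  assumes M: "hilbert_space M" and T: "unitary_op M T" and U: "unitary_op (hilbert_sum scalar_hilbert M) U"
  obtains A B C D where "unitary_realization M T A B C D"
    "\<And>s x c. \<lbrakk>s \<in> sym_bidisc; x \<in> carrier M;
        U (1, ((2 * snd s) \<odot>\<^bsub>M\<^esub> T x) \<ominus>\<^bsub>M\<^esub> (fst s \<odot>\<^bsub>M\<^esub> x)) = (c, denom_op M s T x)\<rbrakk>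
      \<Longrightarrow> realization M T A B C D s = c"
proof -
  interpret M: hilbert_space M by fact
  let ?S = "hilbert_sum scalar_hilbert M"
  interpret S: hilbert_space ?S using hilbert_space_sum[OF hilbert_space_scalar M] .
  define A where "A = fst (U (1, \<zero>\<^bsub>M\<^esub>))"
  define B where "B x = fst (U (0, x))" for x
  define C where "C c = snd (U (c, \<zero>\<^bsub>M\<^esub>))" for c
  define D where "D x = snd (U (0, x))" for x
  note Ub = unitary_op_bounded[OF U]
  have Uin: "snd (U (c, x)) \<in> carrier M" if "x \<in> carrier M" for c x
    using bounded_opD(1)[OF Ub, of "(c, x)"] that by (auto simp: hilbert_sum_simps mem_Times_iff scalar_hilbert_def)
  have Uadd: "U (c + d, x \<oplus>\<^bsub>M\<^esub> y) = (fst (U (c, x)) + fst (U (d, y)), snd (U (c, x)) \<oplus>\<^bsub>M\<^esub> snd (U (d, y)))"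
    if "x \<in> carrier M" "y \<in> carrier M" for c d x y
    using bounded_opD(2)[OF Ub, of "(c, x)" "(d, y)"] that
    by (cases "U (c, x)"; cases "U (d, y)") (simp add: hilbert_sum_simps, simp add: scalar_hilbert_def)
  have Usm: "U (k * c, k \<odot>\<^bsub>M\<^esub> x) = (k * fst (U (c, x)), k \<odot>\<^bsub>M\<^esub> snd (U (c, x)))"
    if "x \<in> carrier M" for c k x
    using bounded_opD(3)[OF Ub, of "(c, x)" k] that
    by (cases "U (c, x)") (simp add: hilbert_sum_simps, simp add: scalar_hilbert_def)
  have zz: "\<zero>\<^bsub>M\<^esub> \<oplus>\<^bsub>M\<^esub> \<zero>\<^bsub>M\<^esub> = \<zero>\<^bsub>M\<^esub>" "k \<odot>\<^bsub>M\<^esub> \<zero>\<^bsub>M\<^esub> = \<zero>\<^bsub>M\<^esub>" for k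
    by (simp, intro M.ip_eqI) (auto simp: M.ip_simps)
  have bound: "cmod (fst (U (c, x))) \<le> sqrt ((cmod c)\<^sup>2 + (hnorm M x)\<^sup>2)"
      "hnorm M (snd (U (c, x))) \<le> sqrt ((cmod c)\<^sup>2 + (hnorm M x)\<^sup>2)" if x: "x \<in> carrier M" for c x
  proof -
    have n: "(hnorm ?S (d, y))\<^sup>2 = (cmod d)\<^sup>2 + (hnorm M y)\<^sup>2" if "y \<in> carrier M" for d y
    proof -
      have "Re (d * cnj d) = (cmod d)\<^sup>2" by (metis Re_complex_of_real complex_norm_square)
      then show ?thesis using that by (simp add: hnorm_def hilbert_sum_def scalar_hilbert_def M.ip_nonneg)
    qed
    have "(hnorm ?S (U (c, x)))\<^sup>2 = (hnorm ?S (c, x))\<^sup>2"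
      using unitary_op_hnorm[OF U, of "(c, x)"] x by (simp add: hilbert_sum_simps scalar_hilbert_def)
    then have "(cmod (fst (U (c, x))))\<^sup>2 + (hnorm M (snd (U (c, x))))\<^sup>2 = (cmod c)\<^sup>2 + (hnorm M x)\<^sup>2"
      using n[OF x, of c] n[OF Uin[OF x], of "fst (U (c, x))" c] by simp
    then show "cmod (fst (U (c, x))) \<le> sqrt ((cmod c)\<^sup>2 + (hnorm M x)\<^sup>2)"
      "hnorm M (snd (U (c, x))) \<le> sqrt ((cmod c)\<^sup>2 + (hnorm M x)\<^sup>2)"
      by (metis le_add_same_cancel1 le_add_same_cancel2 real_le_rsqrt zero_le_power2)+
  qed
  have Bb: "bounded_op M scalar_hilbert B"
  proof (rule bounded_opI[where b = 1])
    show "B (x \<oplus>\<^bsub>M\<^esub> y) = B x \<oplus>\<^bsub>scalar_hilbert\<^esub> B y" if "x \<in> carrier M" "y \<in> carrier M" for x y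
      using Uadd[OF that, of 0 0] by (simp add: B_def scalar_hilbert_def)
    show "B (c \<odot>\<^bsub>M\<^esub> x) = c \<odot>\<^bsub>scalar_hilbert\<^esub> B x" if "x \<in> carrier M" for c x
      using Usm[OF that, of c 0] by (simp add: B_def scalar_hilbert_def)
    show "hnorm scalar_hilbert (B x) \<le> 1 * hnorm M x" if "x \<in> carrier M" for x
      using bound(1)[OF that, of 0] that by (simp add: B_def scalar_hilbert_hnorm)
  qed (simp add: scalar_hilbert_def)
  have Cb: "bounded_op scalar_hilbert M C"
  proof (rule bounded_opI[where b = 1])
    show "C (x \<oplus>\<^bsub>scalar_hilbert\<^esub> y) = C x \<oplus>\<^bsub>M\<^esub> C y" for x y
      using Uadd[of "\<zero>\<^bsub>M\<^esub>" "\<zero>\<^bsub>M\<^esub>" x y] by (simp add: C_def zz) (simp add: scalar_hilbert_def)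
    show "C (c \<odot>\<^bsub>scalar_hilbert\<^esub> x) = c \<odot>\<^bsub>M\<^esub> C x" for c x
      using Usm[of "\<zero>\<^bsub>M\<^esub>" c x] by (simp add: C_def zz) (simp add: scalar_hilbert_def)
    show "hnorm M (C x) \<le> 1 * hnorm scalar_hilbert x" for x
      using bound(2)[of "\<zero>\<^bsub>M\<^esub>" x] by (simp add: C_def scalar_hilbert_hnorm)
  qed (simp add: C_def Uin)
  have Db: "bounded_op M M D"
  proof (rule bounded_opI[where b = 1])
    show "D (x \<oplus>\<^bsub>M\<^esub> y) = D x \<oplus>\<^bsub>M\<^esub> D y" if "x \<in> carrier M" "y \<in> carrier M" for x y
      using Uadd[OF that, of 0 0] by (simp add: D_def)
    show "D (c \<odot>\<^bsub>M\<^esub> x) = c \<odot>\<^bsub>M\<^esub> D x" if "x \<in> carrier M" for c x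
      using Usm[OF that, of c 0] by (simp add: D_def)
    show "hnorm M (D x) \<le> 1 * hnorm M x" if "x \<in> carrier M" for x
      using bound(2)[OF that, of 0] that by (simp add: D_def)
  qed (simp add: D_def Uin)
  have block: "block_op M A B C D (c, x) = U (c, x)" if "x \<in> carrier M" for c x
    using Uadd[of "\<zero>\<^bsub>M\<^esub>" x c 0] Usm[of "\<zero>\<^bsub>M\<^esub>" c 1] that
    by (simp add: block_op_def A_def B_def C_def D_def zz mult.commute)
  have "unitary_op ?S (block_op M A B C D)"
    by (rule unitary_op_cong[OF U _ S.hilbert_space_axioms]) (auto simp: hilbert_sum_simps block)
  then have real: "unitary_realization M T A B C D"
    by (intro unitary_realization.intro unitary_realization_axioms.intro M T)
      (simp add: unitary_block_def Bb Cb Db)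
  then interpret R: unitary_realization M T A B C D .
  have "realization M T A B C D s = c"
    if s: "s \<in> sym_bidisc" and x: "x \<in> carrier M"
      and eq: "U (1, ((2 * snd s) \<odot>\<^bsub>M\<^esub> T x) \<ominus>\<^bsub>M\<^esub> (fst s \<odot>\<^bsub>M\<^esub> x)) = (c, denom_op M s T x)" for s x c
  proof -
    have "block_op M A B C D (1, R.numer s x) = (c, denom_op M s T x)"
      using eq block[OF R.numer_in[OF x], of 1 s] by (simp add: R.numer_def)
    then have c: "A + B (R.numer s x) = c" and d: "C 1 \<oplus>\<^bsub>M\<^esub> D (R.numer s x) = denom_op M s T x"
      by (simp_all add: block_op_def)
    have "R.pencil s x = C 1"
      unfolding R.pencil_def d[symmetric] using x by (intro M.ip_eqI) (auto simp: M.ip_simps R.D_simps(1))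
    then show ?thesis using R.realization_eq[OF s x] c by simp
  qed
  with real that show ?thesis by blast
qed

section \<open>Realization of Schur functions\<close>

text \<open>The Agler kernels carry the conjugate on the first index, whereas \<open>ip\<close> is
  linear in its first argument. Transposition matches the conventions; it amounts to conjugating the
  coefficients.\<close>

lemma psd_kernel_transpose:
  assumes "psd_kernel K"
  shows "psd_kernel (\<lambda>i j. K j i)"
  unfolding psd_kernel_def
proof (intro conjI allI)
  show "K i j = cnj (K j i)" for i j using psd_kernelD(1)[OF assms] .
  fix N c
  have "kernel_form N (\<lambda>i j. K j i) c = kernel_form N K (\<lambda>i. cnj (c i))"
    unfolding kernel_form_def by (subst sum.swap) (simp add: mult.commute)
  then show "0 \<le> Re (kernel_form N (\<lambda>i j. K j i) c)" using psd_kernelD(2)[OF assms] by simp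
qed

text \<open>The points are chosen in the bidisc because the decomposition lives there; their
  symmetrizations are dense by continuity.\<close>

lemma sym_bidisc_dense_sequence:
  obtains d :: "nat \<Rightarrow> complex \<times> complex" where
    "\<And>n. cmod (fst (d n)) < 1" "\<And>n. cmod (snd (d n)) < 1"
    "\<And>z w. \<lbrakk>cmod z < 1; cmod w < 1\<rbrakk> \<Longrightarrow> (z, w) \<in> closure (range d)"
proof -
  let ?B = "ball 0 1 \<times> ball 0 1 :: (complex \<times> complex) set"
  obtain S where S: "countable S" "S \<subseteq> ?B" "?B \<subseteq> closure S" using separable by blast
  have "S \<noteq> {}" using S(3) by (auto simp: mem_Times_iff)
  then have "range (from_nat_into S) = S" using S(1) by (rule range_from_nat_into)
  moreover have "from_nat_into S n \<in> ?B" for n using from_nat_into[OF \<open>S \<noteq> {}\<close>, of n] S(2) by blast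
  then have "cmod (fst (from_nat_into S n)) < 1" "cmod (snd (from_nat_into S n)) < 1" for n
    by (simp_all add: mem_Times_iff)
  ultimately show ?thesis using S(3) by (intro that[of "from_nat_into S"]) auto
qed

context hilbert_space
begin

lemma one_minus_unitary:
  assumes T: "unitary_op H T" and l: "cmod l < 1"
  shows "\<And>y. y \<in> carrier H \<Longrightarrow> \<exists>x\<in>carrier H. x \<ominus> (l \<odot> T x) = y"
    and "\<And>x y. \<lbrakk>x \<in> carrier H; y \<in> carrier H; x \<ominus> (l \<odot> T x) = y \<ominus> (l \<odot> T y)\<rbrakk> \<Longrightarrow> x = y"
proof -
  note Tb = unitary_op_bounded[OF T]
  note Ts = bounded_opD[OF Tb]
  have X: "bounded_op H H (\<lambda>x. l \<odot> T x)"
  proof (rule bounded_opI[where b = "cmod l"])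
    show "l \<odot> T (x \<oplus> y) = (l \<odot> T x) \<oplus> (l \<odot> T y)" if "x \<in> carrier H" "y \<in> carrier H" for x y
      using that Ts by (intro ip_eqI) (auto simp: ip_simps algebra_simps)
    show "l \<odot> T (c \<odot> x) = c \<odot> (l \<odot> T x)" if "x \<in> carrier H" for c x
      using that Ts by (intro ip_eqI) (auto simp: ip_simps algebra_simps)
  qed (auto simp: Ts hnorm_smult unitary_op_hnorm[OF T])
  have n: "hnorm H (l \<odot> T x) \<le> cmod l * hnorm H x" if "x \<in> carrier H" for x
    using that Ts by (simp add: hnorm_smult unitary_op_hnorm[OF T])
  show "\<exists>x\<in>carrier H. x \<ominus> (l \<odot> T x) = y" if "y \<in> carrier H" for y
    by (rule contraction_solve[OF X _ l n that]) auto
  have inv: "invertible_op H (\<lambda>x. x \<ominus> (l \<odot> T x))"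
    by (rule one_minus_contraction(1)[OF X _ l n]) auto
  show "x = y" if "x \<in> carrier H" "y \<in> carrier H" "x \<ominus> (l \<odot> T x) = y \<ominus> (l \<odot> T y)" for x y
  proof -
    have "x = op_inv H (\<lambda>x. x \<ominus> (l \<odot> T x)) (x \<ominus> (l \<odot> T x))"
      by (rule invertible_op_inv(3)[OF inv that(1), symmetric])
    also have "\<dots> = op_inv H (\<lambda>x. x \<ominus> (l \<odot> T x)) (y \<ominus> (l \<odot> T y))" by (simp only: that(3))
    also have "\<dots> = y" by (rule invertible_op_inv(3)[OF inv that(2)])
    finally show ?thesis .
  qed
qed

end

lemma hilbert_sum_minus:
  assumes "hilbert_space H" "hilbert_space K" "x \<in> carrier H" "x' \<in> carrier H" "y \<in> carrier K" "y' \<in> carrier K"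
  shows "(x, y) \<ominus>\<^bsub>hilbert_sum H K\<^esub> (x', y') = (x \<ominus>\<^bsub>H\<^esub> x', y \<ominus>\<^bsub>K\<^esub> y')"
proof -
  interpret H: hilbert_space H by fact
  interpret K: hilbert_space K by fact
  interpret S: hilbert_space "hilbert_sum H K" by (rule hilbert_space_sum[OF assms(1,2)])
  show ?thesis using assms(3-) by (simp add: S.minus_smult H.minus_smult K.minus_smult hilbert_sum_simps)
qed

text \<open>The symmetric model: \<open>u\<close> and its flip \<open>u \<circ> \<sigma>\<close> carry the two terms of the Agler decomposition. Since
  \<open>f\<close> is symmetric, \<open>l\<^sub>1 u - l\<^sub>2 (u \<circ> \<sigma>) \<mapsto> u - u \<circ> \<sigma>\<close> preserves the Gram matrix; \<open>T\<close> extends this isometry.\<close>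

lemma symmetric_model:
  fixes l1 l2 F :: "nat \<Rightarrow> complex" and u :: "nat \<Rightarrow> 'a"
  assumes H0: "hilbert_space H0" and u: "\<And>i. u i \<in> carrier H0"
    and l: "\<And>i. cmod (l1 i) < 1" "\<And>i. cmod (l2 i) < 1"
    and \<sigma>: "\<And>i. \<sigma> (\<sigma> i) = i" "\<And>i. l1 (\<sigma> i) = l2 i" "\<And>i. l2 (\<sigma> i) = l1 i" "\<And>i. F (\<sigma> i) = F i"
    and model: "\<And>i j. 2 * (1 - F i * cnj (F j)) = (1 - l1 i * cnj (l1 j)) * ip H0 (u i) (u j)
      + (1 - l2 i * cnj (l2 j)) * ip H0 (u (\<sigma> i)) (u (\<sigma> j))"
  obtains T x y z where "unitary_op (hilbert_sum H0 H0) T" "\<And>i. x i \<in> carrier (hilbert_sum H0 H0)"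
    "\<And>i. denom_op (hilbert_sum H0 H0) (l1 i + l2 i, l1 i * l2 i) T (x i) = y i"
    "\<And>i. ((2 * (l1 i * l2 i)) \<odot>\<^bsub>hilbert_sum H0 H0\<^esub> T (x i))
      \<ominus>\<^bsub>hilbert_sum H0 H0\<^esub> ((l1 i + l2 i) \<odot>\<^bsub>hilbert_sum H0 H0\<^esub> x i) = z i"
    "\<And>i j. 1 + ip (hilbert_sum H0 H0) (z i) (z j) = F i * cnj (F j) + ip (hilbert_sum H0 H0) (y i) (y j)"
proof -
  interpret H0: hilbert_space H0 by fact
  define g where "g i j = ip H0 (u i) (u j)" for i j
  have model': "2 * (1 - F i * cnj (F j)) = (1 - l1 i * cnj (l1 j)) * g i j + (1 - l2 i * cnj (l2 j)) * g (\<sigma> i) (\<sigma> j)" for i j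
    unfolding g_def by (rule model)
  \<comment> \<open>The same identity with the second point flipped. Both expressions have the same
    left side because \<open>F (\<sigma> j) = F j\<close>; this is where symmetry of
    \<open>f\<close> enters.\<close>
  have cross: "2 * (1 - F i * cnj (F j)) = (1 - l1 i * cnj (l2 j)) * g i (\<sigma> j) + (1 - l2 i * cnj (l1 j)) * g (\<sigma> i) j" for i j
    using model'[of i "\<sigma> j"] by (simp add: \<sigma>)
  define xs where "xs i = (l1 i \<odot>\<^bsub>H0\<^esub> u i) \<ominus>\<^bsub>H0\<^esub> (l2 i \<odot>\<^bsub>H0\<^esub> u (\<sigma> i))" for i
  define ys where "ys i = u i \<ominus>\<^bsub>H0\<^esub> u (\<sigma> i)" for i
  have xys: "xs i \<in> carrier H0" "ys i \<in> carrier H0" for i using u by (auto simp: xs_def ys_def)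
  have gram: "ip H0 (xs i) (xs j) = ip H0 (ys i) (ys j)" for i j
  proof -
    have "ip H0 (ys i) (ys j) - ip H0 (xs i) (xs j)
        = ((1 - l1 i * cnj (l1 j)) * g i j + (1 - l2 i * cnj (l2 j)) * g (\<sigma> i) (\<sigma> j))
        - ((1 - l1 i * cnj (l2 j)) * g i (\<sigma> j) + (1 - l2 i * cnj (l1 j)) * g (\<sigma> i) j)"
      using u by (simp add: xs_def ys_def H0.ip_simps g_def algebra_simps)
    also have "\<dots> = 0" unfolding model'[symmetric] cross[symmetric] by simp
    finally show ?thesis by simp
  qed
  let ?H = "hilbert_sum H0 H0"
  interpret H: hilbert_space ?H by (rule hilbert_space_sum[OF H0 H0])
  obtain T where T: "unitary_op ?H T" "\<And>i. T (xs i, \<zero>\<^bsub>H0\<^esub>) = (ys i, \<zero>\<^bsub>H0\<^esub>)"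
    using unitary_extension[where x = xs and y = ys, OF H0 xys gram] by blast
  note Tb = unitary_op_bounded[OF T(1)]
  note Ts = bounded_opD[OF Tb]
  have Tm: "T (x \<ominus>\<^bsub>?H\<^esub> y) = T x \<ominus>\<^bsub>?H\<^esub> T y" if "x \<in> carrier ?H" "y \<in> carrier ?H" for x y
    using bounded_op_diff[OF H.hilbert_space_axioms H.hilbert_space_axioms Tb that] .
  define v where "v i = (u i, \<zero>\<^bsub>H0\<^esub>)" for i
  have v: "v i \<in> carrier ?H" for i using u by (simp add: v_def hilbert_sum_simps)
  have vg: "ip ?H (v i) (v j) = g i j" for i j by (simp add: v_def hilbert_sum_simps g_def)
  have z0: "(c \<odot>\<^bsub>H0\<^esub> \<zero>\<^bsub>H0\<^esub>) = \<zero>\<^bsub>H0\<^esub>" for c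
    by (intro H0.ip_eqI) (auto simp: H0.ip_simps)
  have Tv: "(l1 i \<odot>\<^bsub>?H\<^esub> T (v i)) \<ominus>\<^bsub>?H\<^esub> (l2 i \<odot>\<^bsub>?H\<^esub> T (v (\<sigma> i))) = v i \<ominus>\<^bsub>?H\<^esub> v (\<sigma> i)" for i
  proof -
    have "(l1 i \<odot>\<^bsub>?H\<^esub> v i) \<ominus>\<^bsub>?H\<^esub> (l2 i \<odot>\<^bsub>?H\<^esub> v (\<sigma> i)) = (xs i, \<zero>\<^bsub>H0\<^esub>)"
      using u by (simp add: v_def hilbert_sum_simps hilbert_sum_minus[OF H0 H0] xs_def z0 H0.minus_self)
    moreover have "v i \<ominus>\<^bsub>?H\<^esub> v (\<sigma> i) = (ys i, \<zero>\<^bsub>H0\<^esub>)"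
      using u by (simp add: v_def hilbert_sum_minus[OF H0 H0] ys_def H0.minus_self)
    ultimately show ?thesis using T(2)[of i] v by (metis Tm Ts(3) H.smult_in)
  qed
  have "\<exists>x. x \<in> carrier ?H \<and> x \<ominus>\<^bsub>?H\<^esub> (l2 i \<odot>\<^bsub>?H\<^esub> T x) = v i" for i
    using H.one_minus_unitary(1)[OF T(1) l(2) v] by blast
  then obtain x where x: "\<And>i. x i \<in> carrier ?H" "\<And>i. x i \<ominus>\<^bsub>?H\<^esub> (l2 i \<odot>\<^bsub>?H\<^esub> T (x i)) = v i" by metis
  have Tx: "T (x i) \<in> carrier ?H" "T (T (x i)) \<in> carrier ?H" "T (v i) \<in> carrier ?H" for i
    using x v Ts(1) by auto
  \<comment> \<open>\<open>Tv\<close> says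
    \<open>(1 - l1 T) v = (1 - l2 T) (v \<circ> \<sigma>)\<close>. With
    \<open>v = (1 - l2 T) x\<close> and commuting factors, injectivity of \<open>1 - l2 T\<close>
    cancels it from both sides.\<close>
  have x\<sigma>: "x i \<ominus>\<^bsub>?H\<^esub> (l1 i \<odot>\<^bsub>?H\<^esub> T (x i)) = v (\<sigma> i)" for i
  proof -
    let ?q = "x i \<ominus>\<^bsub>?H\<^esub> (l1 i \<odot>\<^bsub>?H\<^esub> T (x i))"
    have q: "?q \<in> carrier ?H" using x Tx by auto
    have "?q \<ominus>\<^bsub>?H\<^esub> (l2 i \<odot>\<^bsub>?H\<^esub> T ?q) = v i \<ominus>\<^bsub>?H\<^esub> (l1 i \<odot>\<^bsub>?H\<^esub> T (v i))"
      unfolding x(2)[of i, symmetric] using x(1) Tx(1,2)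
      by (intro H.ip_eqI) (auto simp: H.ip_simps Tm Ts algebra_simps)
    also have "\<dots> = v (\<sigma> i) \<ominus>\<^bsub>?H\<^esub> (l2 i \<odot>\<^bsub>?H\<^esub> T (v (\<sigma> i)))"
    proof (rule H.ip_eqI)
      fix w assume w: "w \<in> carrier ?H"
      have "ip ?H ((l1 i \<odot>\<^bsub>?H\<^esub> T (v i)) \<ominus>\<^bsub>?H\<^esub> (l2 i \<odot>\<^bsub>?H\<^esub> T (v (\<sigma> i)))) w = ip ?H (v i \<ominus>\<^bsub>?H\<^esub> v (\<sigma> i)) w"
        by (simp only: Tv)
      then show "ip ?H (v i \<ominus>\<^bsub>?H\<^esub> (l1 i \<odot>\<^bsub>?H\<^esub> T (v i))) w = ip ?H (v (\<sigma> i) \<ominus>\<^bsub>?H\<^esub> (l2 i \<odot>\<^bsub>?H\<^esub> T (v (\<sigma> i)))) w"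
        using v Tx w by (simp add: H.ip_simps algebra_simps)
    qed (use v Tx in auto)
    finally show ?thesis using H.one_minus_unitary(2)[OF T(1) l(2)] q v by blast
  qed
  define y where "y i = (2 \<odot>\<^bsub>?H\<^esub> x i) \<ominus>\<^bsub>?H\<^esub> ((l1 i + l2 i) \<odot>\<^bsub>?H\<^esub> T (x i))" for i
  define z where "z i = ((2 * (l1 i * l2 i)) \<odot>\<^bsub>?H\<^esub> T (x i)) \<ominus>\<^bsub>?H\<^esub> ((l1 i + l2 i) \<odot>\<^bsub>?H\<^esub> x i)" for i
  \<comment> \<open>All Gram kernels involved are combinations of the three scalars
    \<open>p\<close>, \<open>q\<close>, \<open>r\<close>, since \<open>T\<close> is isometric; the
    claim is an identity between their coefficients.\<close>
  have key: "4 * (1 - F i * cnj (F j)) = ip ?H (y i) (y j) - ip ?H (z i) (z j)" for i j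
  proof -
    define p q r where "p = ip ?H (x i) (x j)" and "q = ip ?H (T (x i)) (x j)" and "r = ip ?H (x i) (T (x j))"
    have TT: "ip ?H (T (x i)) (T (x j)) = p" using x unitary_op_ip[OF T(1)] by (simp add: p_def)
    have 1: "g i j = (1 + l2 i * cnj (l2 j)) * p - l2 i * q - cnj (l2 j) * r"
      unfolding vg[symmetric] x(2)[symmetric] using x(1) Tx
      by (simp add: H.ip_simps TT p_def[symmetric] q_def[symmetric] r_def[symmetric] algebra_simps)
    have 2: "g (\<sigma> i) (\<sigma> j) = (1 + l1 i * cnj (l1 j)) * p - l1 i * q - cnj (l1 j) * r"
      unfolding vg[symmetric] x\<sigma>[symmetric] using x(1) Tx
      by (simp add: H.ip_simps TT p_def[symmetric] q_def[symmetric] r_def[symmetric] algebra_simps)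
    have 3: "ip ?H (y i) (y j) = (4 + (l1 i + l2 i) * cnj (l1 j + l2 j)) * p - 2 * (l1 i + l2 i) * q - 2 * cnj (l1 j + l2 j) * r"
      unfolding y_def using x(1) Tx
      by (simp add: H.ip_simps TT p_def[symmetric] q_def[symmetric] r_def[symmetric] algebra_simps)
    have 4: "ip ?H (z i) (z j) = (4 * (l1 i * l2 i) * cnj (l1 j * l2 j) + (l1 i + l2 i) * cnj (l1 j + l2 j)) * p
        - 2 * (l1 i * l2 i) * cnj (l1 j + l2 j) * q - 2 * (l1 i + l2 i) * cnj (l1 j * l2 j) * r"
      unfolding z_def using x(1) Tx
      by (simp add: H.ip_simps TT p_def[symmetric] q_def[symmetric] r_def[symmetric] algebra_simps)
    have "4 * (1 - F i * cnj (F j)) = 2 * (2 * (1 - F i * cnj (F j)))" by simp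
    also have "\<dots> = ip ?H (y i) (y j) - ip ?H (z i) (z j)"
      unfolding model' 1 2 3 4 by (simp add: algebra_simps)
    finally show ?thesis .
  qed
  \<comment> \<open>Halving the vectors removes the factor 4 of \<open>key\<close>: one factor 2
    comes from adding the decomposition to its flip, the other from the normalisation of the
    denominator as \<open>2 - s1 T\<close>.\<close>
  define x' where "x' i = (1/2) \<odot>\<^bsub>?H\<^esub> x i" for i
  have x': "x' i \<in> carrier ?H" for i using x by (simp add: x'_def)
  have y': "(2 \<odot>\<^bsub>?H\<^esub> x' i) \<ominus>\<^bsub>?H\<^esub> ((l1 i + l2 i) \<odot>\<^bsub>?H\<^esub> T (x' i)) = (1/2) \<odot>\<^bsub>?H\<^esub> y i" for i
    unfolding x'_def y_def using x Tx by (intro H.ip_eqI) (auto simp: H.ip_simps Ts algebra_simps)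
  have z': "((2 * (l1 i * l2 i)) \<odot>\<^bsub>?H\<^esub> T (x' i)) \<ominus>\<^bsub>?H\<^esub> ((l1 i + l2 i) \<odot>\<^bsub>?H\<^esub> x' i) = (1/2) \<odot>\<^bsub>?H\<^esub> z i" for i
    unfolding x'_def z_def using x Tx by (intro H.ip_eqI) (auto simp: H.ip_simps Ts algebra_simps)
  have yz: "y i \<in> carrier ?H" "z i \<in> carrier ?H" for i using x Tx by (auto simp: y_def z_def)
  have "1 + ip ?H ((1/2) \<odot>\<^bsub>?H\<^esub> z i) ((1/2) \<odot>\<^bsub>?H\<^esub> z j) = F i * cnj (F j) + ip ?H ((1/2) \<odot>\<^bsub>?H\<^esub> y i) ((1/2) \<odot>\<^bsub>?H\<^esub> y j)" for i j
    using key[of i j] yz by (simp add: H.ip_simps field_simps)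
  with T(1) x' y' z' show ?thesis
    by (intro that[of T x' "\<lambda>i. (1/2) \<odot>\<^bsub>?H\<^esub> y i" "\<lambda>i. (1/2) \<odot>\<^bsub>?H\<^esub> z i"]) (auto simp: denom_op_def)
qed

definition interleave :: "('a \<Rightarrow> nat \<Rightarrow> 'c) \<Rightarrow> ('b \<Rightarrow> nat \<Rightarrow> 'c) \<Rightarrow> 'a \<times> 'b \<Rightarrow> nat \<Rightarrow> 'c" where
  "interleave J K = (\<lambda>(x, y) n. if even n then J x (n div 2) else K y (n div 2))"

lemma inj_interleave:
  assumes "inj J" "inj K"
  shows "inj (interleave J K)"
proof (rule injI, clarify)
  fix x y x' y'
  assume eq: "interleave J K (x, y) = interleave J K (x', y')"
  have "J x n = J x' n" for n using fun_cong[OF eq, of "2 * n"] by (simp add: interleave_def)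
  moreover have "K y n = K y' n" for n using fun_cong[OF eq, of "Suc (2 * n)"] by (simp add: interleave_def)
  ultimately have "J x = J x'" "K y = K y'" by auto
  then show "x = x' \<and> y = y'" using assms by (auto dest: injD)
qed

lemma schur_class_isCont:
  assumes "\<phi> \<in> schur_class" "s \<in> sym_bidisc"
  shows "isCont \<phi> s"
  using assms has_derivative_continuous unfolding schur_class_def analytic2_on_def by blast

lemma schur_class_lift:
  assumes "\<phi> \<in> schur_class"
  obtains a where "schur_series a (\<lambda>z w. \<phi> (z + w, z * w))"
proof -
  define f where "f z w = \<phi> (z + w, z * w)" for z w
  have G: "(z + w, z * w) \<in> sym_bidisc" if "cmod z < 1" "cmod w < 1" for z w
    using that by (auto simp: sym_bidisc_def)
  have hol: "(\<lambda>z. f z w) holomorphic_on ball 0 1" if w: "cmod w < 1" for w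
    unfolding holomorphic_on_open[OF open_ball]
  proof
    fix z :: complex assume "z \<in> ball 0 1"
    then have "(z + w, z * w) \<in> sym_bidisc" using w by (intro G) auto
    then obtain a b where \<phi>: "(\<phi> has_derivative (\<lambda>h. a * fst h + b * snd h)) (at (z + w, z * w))"
      using assms unfolding schur_class_def analytic2_on_def by blast
    have "((\<lambda>z. (z + w, z * w)) has_derivative (\<lambda>h. (h, h * w))) (at z)"
      by (auto intro!: derivative_eq_intros)
    from has_derivative_compose[OF this \<phi>]
    have "((\<lambda>z. f z w) has_derivative (\<lambda>h. (a + b * w) * h)) (at z)"
      by (simp add: f_def algebra_simps)
    then show "\<exists>f'. ((\<lambda>z. f z w) has_field_derivative f') (at z)"
      by (auto simp: has_field_derivative_def)
  qed
  have sym: "f z w = f w z" for z w by (simp add: f_def add.commute mult.commute)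
  have hol': "f z holomorphic_on ball 0 1" if "cmod z < 1" for z
    using hol[OF that] sym[of z] by (metis (no_types, lifting) ext)
  have bd: "cmod (f z w) \<le> 1" if "cmod z < 1" "cmod w < 1" for z w
    using assms G[OF that] by (auto simp: schur_class_def f_def)
  obtain a where "\<And>p q. cmod (a p q) \<le> 1"
    "\<And>z w. \<lbrakk>cmod z < 1; cmod w < 1\<rbrakk> \<Longrightarrow> ((\<lambda>(p, q). a p q * z ^ p * w ^ q) has_sum f z w) UNIV"
    using bidisc_power_series[OF hol hol' bd] by blast
  then have "schur_series a f" using bd by unfold_locales
  then show ?thesis using that by (simp add: f_def[abs_def])
qed

lemma realization_exists:
  assumes \<phi>: "\<phi> \<in> schur_class"
  shows "\<exists>(M :: (nat \<Rightarrow> complex) hilbert) T A B C D.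
    unitary_realization M T A B C D \<and> (\<forall>s\<in>sym_bidisc. \<phi> s = realization M T A B C D s)"
proof -
  define f where "f = (\<lambda>z w. \<phi> (z + w, z * w))"
  obtain a where "schur_series a f" using schur_class_lift[OF \<phi>] unfolding f_def by blast
  then interpret schur_series a f .
  obtain d :: "nat \<Rightarrow> complex \<times> complex" where d: "\<And>n. cmod (fst (d n)) < 1" "\<And>n. cmod (snd (d n)) < 1"
    and dense: "\<And>z w. \<lbrakk>cmod z < 1; cmod w < 1\<rbrakk> \<Longrightarrow> (z, w) \<in> closure (range d)"
    using sym_bidisc_dense_sequence by blast
  \<comment> \<open>Each dense point is listed twice, at an even index as it is and at the next odd
    index flipped, so that \<open>\<sigma>\<close> exchanges neighbours.\<close>
  define l1 where "l1 i = (if even i then fst (d (i div 2)) else snd (d (i div 2)))" for i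
  define l2 where "l2 i = (if even i then snd (d (i div 2)) else fst (d (i div 2)))" for i
  define \<sigma> where "\<sigma> i = (if even i then Suc i else i - 1)" for i :: nat
  have l: "cmod (l1 i) < 1" "cmod (l2 i) < 1" for i by (auto simp: l1_def l2_def d)
  have \<sigma>: "\<sigma> (\<sigma> i) = i" "l1 (\<sigma> i) = l2 i" "l2 (\<sigma> i) = l1 i" for i
    by (cases "even i"; auto simp: \<sigma>_def l1_def l2_def elim!: oddE)+
  define F where "F i = f (l1 i) (l2 i)" for i
  have F\<sigma>: "F (\<sigma> i) = F i" for i by (simp add: F_def \<sigma> f_def add.commute mult.commute)
  obtain K1 K2 where K: "psd_kernel K1" "psd_kernel K2"
    and agler: "\<And>i j. 1 - cnj (F i) * F j = (1 - cnj (l1 i) * l1 j) * K1 i j + (1 - cnj (l2 i) * l2 j) * K2 i j"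
    unfolding F_def using agler_decomposition[of l1 l2, OF l] by blast
  obtain v1 v2 :: "nat \<Rightarrow> nat \<Rightarrow> complex" where v: "\<And>i. v1 i \<in> carrier ell2" "\<And>i. v2 i \<in> carrier ell2"
    "\<And>i j. ip ell2 (v1 i) (v1 j) = K1 j i" "\<And>i j. ip ell2 (v2 i) (v2 j) = K2 j i"
    using psd_kernel_factorization[OF psd_kernel_transpose[OF K(1)]]
      psd_kernel_factorization[OF psd_kernel_transpose[OF K(2)]] by blast
  define H0 where "H0 = hilbert_sum (ell2 :: (nat \<Rightarrow> complex) hilbert) (ell2 :: (nat \<Rightarrow> complex) hilbert)"
  \<comment> \<open>In the sum of the decomposition and its flip, these are the two kernels that
    share the factor \<open>1 - l1 i * cnj (l1 j)\<close>; those with the other factor belong to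
    \<open>u (\<sigma> i)\<close>.\<close>
  define u where "u i = (v1 i, v2 (\<sigma> i))" for i
  have H0: "hilbert_space H0" unfolding H0_def by (intro hilbert_space_sum hilbert_space_ell2)
  have u: "u i \<in> carrier H0" for i by (simp add: u_def H0_def hilbert_sum_simps v)
  have model: "2 * (1 - F i * cnj (F j)) = (1 - l1 i * cnj (l1 j)) * ip H0 (u i) (u j)
      + (1 - l2 i * cnj (l2 j)) * ip H0 (u (\<sigma> i)) (u (\<sigma> j))" for i j
  proof -
    have "2 * (1 - F i * cnj (F j)) = (1 - cnj (F j) * F i) + (1 - cnj (F (\<sigma> j)) * F (\<sigma> i))"
      by (simp add: F\<sigma> mult.commute)
    then show ?thesis
      unfolding agler by (simp add: u_def H0_def hilbert_sum_simps v \<sigma> algebra_simps)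
  qed
  define H where "H = hilbert_sum H0 H0"
  have H: "hilbert_space H" unfolding H_def by (rule hilbert_space_sum[OF H0 H0])
  interpret H: hilbert_space H by (rule H)
  define st where "st i = (l1 i + l2 i, l1 i * l2 i)" for i
  have st: "st i \<in> sym_bidisc" for i using l unfolding st_def sym_bidisc_def by blast
  obtain T x y z where T: "unitary_op H T" and x: "\<And>i. x i \<in> carrier H"
    and y: "\<And>i. denom_op H (st i) T (x i) = y i"
    and z: "\<And>i. ((2 * snd (st i)) \<odot>\<^bsub>H\<^esub> T (x i)) \<ominus>\<^bsub>H\<^esub> (fst (st i) \<odot>\<^bsub>H\<^esub> x i) = z i"
    and gram: "\<And>i j. 1 + ip H (z i) (z j) = F i * cnj (F j) + ip H (y i) (y j)"
    using symmetric_model[of H0 u l1 l2 \<sigma> F, OF H0 u l \<sigma> F\<sigma> model, folded H_def]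
    unfolding st_def fst_conv snd_conv by blast
  have Tx: "T (x i) \<in> carrier H" for i using bounded_opD(1)[OF unitary_op_bounded[OF T] x] .
  have yz: "y i \<in> carrier H" "z i \<in> carrier H" for i
    using x Tx by (auto simp: y[symmetric] z[symmetric] denom_op_def)
  let ?E = "hilbert_sum scalar_hilbert H"
  have E: "hilbert_space ?E" by (rule hilbert_space_sum[OF hilbert_space_scalar H])
  interpret E: hilbert_space ?E by (rule E)
  \<comment> \<open>With a scalar coordinate added, \<open>gram\<close> is equality of the Gram
    matrices of \<open>(1, z i)\<close> and \<open>(F i, y i)\<close>.\<close>
  have "\<exists>W. unitary_op (hilbert_sum ?E ?E) W \<and> (\<forall>i. W ((1, z i), \<zero>\<^bsub>?E\<^esub>) = ((F i, y i), \<zero>\<^bsub>?E\<^esub>))"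
    by (rule unitary_extension[OF E]) (use yz gram in \<open>auto simp: hilbert_sum_simps, auto simp: scalar_hilbert_def\<close>)
  then obtain W where W: "unitary_op (hilbert_sum ?E ?E) W" "\<And>i. W ((1, z i), \<zero>\<^bsub>?E\<^esub>) = ((F i, y i), \<zero>\<^bsub>?E\<^esub>)"
    by blast
  let ?M = "hilbert_sum H ?E"
  have M: "hilbert_space ?M" by (rule hilbert_space_sum[OF H E])
  interpret M: hilbert_space ?M by (rule M)
  define U where "U = reassoc \<circ> W \<circ> reassoc'"
  have U: "unitary_op (hilbert_sum scalar_hilbert ?M) U"
    unfolding U_def by (rule hilbert_iso.unitary_op_transport[OF reassoc_iso[OF hilbert_space_scalar H E] W(1)])
  have Uz: "U (1, z i, \<zero>\<^bsub>?E\<^esub>) = (F i, y i, \<zero>\<^bsub>?E\<^esub>)" for i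
    by (simp add: U_def reassoc_def reassoc'_def W(2))
  obtain S where S_def: "S = map_prod T id" and S: "unitary_op ?M S"
    using unitary_op_sum_id[OF H E T] by blast
  define X where "X i = (x i, \<zero>\<^bsub>?E\<^esub>)" for i
  have X: "X i \<in> carrier ?M" "S (X i) \<in> carrier ?M" for i
    using x Tx by (auto simp: X_def S_def hilbert_sum_simps(1)[of H])
  have E0: "c \<odot>\<^bsub>?E\<^esub> \<zero>\<^bsub>?E\<^esub> = \<zero>\<^bsub>?E\<^esub>" for c
    by (intro E.ip_eqI) (auto simp: E.ip_simps)
  have MX: "(b \<odot>\<^bsub>?M\<^esub> (p, \<zero>\<^bsub>?E\<^esub>)) \<ominus>\<^bsub>?M\<^esub> (c \<odot>\<^bsub>?M\<^esub> (q, \<zero>\<^bsub>?E\<^esub>)) = ((b \<odot>\<^bsub>H\<^esub> p) \<ominus>\<^bsub>H\<^esub> (c \<odot>\<^bsub>H\<^esub> q), \<zero>\<^bsub>?E\<^esub>)"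
    if "p \<in> carrier H" "q \<in> carrier H" for b c p q
    using that by (simp add: hilbert_sum_simps(4)[where H = H] E0 hilbert_sum_minus[OF H E] E.minus_self)
  have num: "((2 * snd (st i)) \<odot>\<^bsub>?M\<^esub> S (X i)) \<ominus>\<^bsub>?M\<^esub> (fst (st i) \<odot>\<^bsub>?M\<^esub> X i) = (z i, \<zero>\<^bsub>?E\<^esub>)" for i
    using MX[OF Tx x] by (simp add: S_def X_def z)
  have den: "(2 \<odot>\<^bsub>?M\<^esub> X i) \<ominus>\<^bsub>?M\<^esub> (fst (st i) \<odot>\<^bsub>?M\<^esub> S (X i)) = (y i, \<zero>\<^bsub>?E\<^esub>)" for i
    using MX[OF x Tx] y by (simp add: S_def X_def denom_op_def)
  \<comment> \<open>The nesting mirrors the type of the state space: \<open>J\<^sub>0\<close>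
    encodes \<open>H0\<close>, \<open>J\<^sub>1\<close> encodes \<open>H\<close>, and scalars become
    constant sequences.\<close>
  define J where "J = (let J\<^sub>0 = interleave id id; J\<^sub>1 = interleave J\<^sub>0 J\<^sub>0
    in interleave J\<^sub>1 (interleave (\<lambda>(c :: complex) n. c) J\<^sub>1))"
  have J: "inj J"
    unfolding J_def Let_def by (intro inj_interleave inj_on_id) (auto simp: inj_on_def dest: fun_cong)
  let ?K = "push_hilbert J ?M" and ?J' = "inv_into UNIV J"
  have J_iso: "hilbert_iso ?M ?K J ?J'" by (rule push_hilbert_iso[OF M J])
  then interpret JI: hilbert_iso ?M ?K J ?J' .
  interpret JS: hilbert_iso "hilbert_sum scalar_hilbert ?M" "hilbert_sum scalar_hilbert ?K" "map_prod id J" "map_prod id ?J'"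
    by (rule JI.iso_scalar_sum)
  define S' where "S' = J \<circ> S \<circ> ?J'"
  define U' where "U' = map_prod id J \<circ> U \<circ> map_prod id ?J'"
  have S': "unitary_op ?K S'" unfolding S'_def by (rule JI.unitary_op_transport[OF S])
  have U': "unitary_op (hilbert_sum scalar_hilbert ?K) U'" unfolding U'_def by (rule JS.unitary_op_transport[OF U])
  obtain A B C D where R: "unitary_realization ?K S' A B C D"
    and val: "\<And>s x c. \<lbrakk>s \<in> sym_bidisc; x \<in> carrier ?K;
        U' (1, ((2 * snd s) \<odot>\<^bsub>?K\<^esub> S' x) \<ominus>\<^bsub>?K\<^esub> (fst s \<odot>\<^bsub>?K\<^esub> x)) = (c, denom_op ?K s S' x)\<rbrakk>
      \<Longrightarrow> realization ?K S' A B C D s = c"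
    using unitary_realization_of_unitary[OF JI.K.hilbert_space_axioms S' U'] by blast
  have S'X: "S' (J (X i)) = J (S (X i))" for i by (simp add: S'_def JI.J'_J[OF X(1)])
  have Jlin: "(b \<odot>\<^bsub>?K\<^esub> J p) \<ominus>\<^bsub>?K\<^esub> (c \<odot>\<^bsub>?K\<^esub> J q) = J ((b \<odot>\<^bsub>?M\<^esub> p) \<ominus>\<^bsub>?M\<^esub> (c \<odot>\<^bsub>?M\<^esub> q))"
    if "p \<in> carrier ?M" "q \<in> carrier ?M" for b c p q
    by (simp only: JI.J_smult[OF that(1), symmetric] JI.J_smult[OF that(2), symmetric]
        JI.J_minus[OF M.smult_in[OF that(1)] M.smult_in[OF that(2)], symmetric])
  have eq: "realization ?K S' A B C D (st i) = \<phi> (st i)" for i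
  proof (rule val[OF st JI.J_in[OF X(1)]])
    have c: "(z i, \<zero>\<^bsub>?E\<^esub>) \<in> carrier ?M" using yz by (simp add: hilbert_sum_simps(1)[of H])
    have "U' (1, J (z i, \<zero>\<^bsub>?E\<^esub>)) = (F i, J (y i, \<zero>\<^bsub>?E\<^esub>))"
      by (simp add: U'_def JI.J'_J[OF c] Uz)
    then show "U' (1, ((2 * snd (st i)) \<odot>\<^bsub>?K\<^esub> S' (J (X i))) \<ominus>\<^bsub>?K\<^esub> (fst (st i) \<odot>\<^bsub>?K\<^esub> J (X i)))
        = (\<phi> (st i), denom_op ?K (st i) S' (J (X i)))"
      unfolding denom_op_def S'X Jlin[OF X(2) X(1)] Jlin[OF X(1) X(2)] num den
      by (simp add: F_def f_def st_def)
  qed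
  \<comment> \<open>\<open>realization_schur_class\<close> makes \<open>\<psi>\<close> continuous,
    so its agreement with \<open>\<phi>\<close> at the points \<open>st i\<close> spreads to the
    whole domain.\<close>
  define \<psi> where "\<psi> = realization ?K S' A B C D"
  have \<psi>: "\<psi> \<in> schur_class"
    by (rule unitary_realization.realization_schur_class[OF R]) (simp add: \<psi>_def)
  have "\<phi> s = \<psi> s" if sG: "s \<in> sym_bidisc" for s
  proof -
    obtain z w where s: "s = (z + w, z * w)" and zw: "cmod z < 1" "cmod w < 1"
      using sG by (auto simp: sym_bidisc_def)
    obtain k where k: "\<And>n. k n \<in> range d" "k \<longlonglongrightarrow> (z, w)"
      using dense[OF zw] unfolding closure_sequential by blast
    define \<pi> where "\<pi> p = (fst p + snd p, fst p * snd p)" for p :: "complex \<times> complex"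
    have lim: "(\<lambda>n. \<pi> (k n)) \<longlonglongrightarrow> s"
    proof -
      have "(\<lambda>n. \<pi> (k n)) \<longlonglongrightarrow> \<pi> (z, w)" unfolding \<pi>_def by (intro tendsto_intros k)
      then show ?thesis by (simp add: \<pi>_def s)
    qed
    have "\<phi> (\<pi> (k n)) = \<psi> (\<pi> (k n))" for n
    proof -
      obtain m where m: "k n = d m" using k(1)[of n] by blast
      have "\<pi> (d m) = st (2 * m)" by (simp add: \<pi>_def st_def l1_def l2_def)
      then show ?thesis using eq[of "2 * m"] by (simp add: m \<psi>_def)
    qed
    then have "(\<lambda>n. \<psi> (\<pi> (k n))) \<longlonglongrightarrow> \<phi> s"
      using isCont_tendsto_compose[OF schur_class_isCont[OF \<phi> sG] lim] by simp
    then show ?thesis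
      using isCont_tendsto_compose[OF schur_class_isCont[OF \<psi> sG] lim] LIMSEQ_unique by blast
  qed
  then show ?thesis using R unfolding \<psi>_def by blast
qed

theorem theorem1p1:
  shows "(\<forall>\<phi> \<in> schur_class.
            \<exists>(M :: (nat \<Rightarrow> complex) hilbert) T A B C D.
              hilbert_space M \<and> unitary_op M T \<and> unitary_block M A B C D \<and>
              (\<forall>s\<in>sym_bidisc. realization_defined M T D s \<and> \<phi> s = realization M T A B C D s))
       \<and>
         (\<forall>(M :: 'a hilbert) T A B C D.
            hilbert_space M \<and> unitary_op M T \<and> unitary_block M A B C D \<longrightarrow>
              (\<forall>s\<in>sym_bidisc. realization_defined M T D s) \<and>
              (\<forall>\<phi>. (\<forall>s\<in>sym_bidisc. \<phi> s = realization M T A B C D s) \<longrightarrow> \<phi> \<in> schur_class))"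
proof (rule conjI; intro ballI allI impI)
  fix \<phi> assume "\<phi> \<in> schur_class"
  then obtain M :: "(nat \<Rightarrow> complex) hilbert" and T A B C D
    where R: "unitary_realization M T A B C D" "\<forall>s\<in>sym_bidisc. \<phi> s = realization M T A B C D s"
    using realization_exists by blast
  interpret unitary_realization M T A B C D by (rule R)
  show "\<exists>(M :: (nat \<Rightarrow> complex) hilbert) T A B C D.
      hilbert_space M \<and> unitary_op M T \<and> unitary_block M A B C D \<and>
      (\<forall>s\<in>sym_bidisc. realization_defined M T D s \<and> \<phi> s = realization M T A B C D s)"
    using R(2) hilbert_space_axioms unitary_T unitary_ABCD realization_defined by blast
next
  fix M :: "'a hilbert" and T A B C D
  assume "hilbert_space M \<and> unitary_op M T \<and> unitary_block M A B C D"
  then interpret unitary_realization M T A B C D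
    by (simp add: unitary_realization_def unitary_realization_axioms_def)
  show "(\<forall>s\<in>sym_bidisc. realization_defined M T D s) \<and>
      (\<forall>\<phi>. (\<forall>s\<in>sym_bidisc. \<phi> s = realization M T A B C D s) \<longrightarrow> \<phi> \<in> schur_class)"
    using realization_defined realization_schur_class by blast
qed

end
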